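(* Let $K$ be an algebraically closed field of positive characteristic $p$. Then there exists a valuation $v$ on the rational function field $K(x,y)$ in two variables over $K$ whose restriction to $K$ is trivial, such that $(K(x,y),v)$ admits an infinite chain of immediate Galois extensions of degree $p$ and defect $p$; that is, there is an infinite chain of valued field extensions $K(x,y)=F_0\subset F_1\subset F_2\subset\cdots$ (with valuations extending $v$) such that each $F_{i+1}|F_i$ is an immediate Galois extension of degree $p$ and defect $p$.
   Context: For a valued field $(L,v)$, $vL$ denotes the value group and $Lv$ the residue field. An extension $(L'|L,v)$ of valued fields is called immediate if $vL'=vL$ and $L'v=Lv$ (under the canonical embeddings). For a finite immediate extension $(L'|L,v)$, its defect is equal to its degree if and only if the extension of $v$ from $L$ to $L'$ is unique (equivalently, $L'|L$ is linearly disjoint from some (or every) henselization of $(L,v)$). So a degree $p$ immediate extension has defect $p$ iff the valuation $v$ of $L$ has a unique extension to $L'$. *)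

theory Defs
  imports "HOL-Algebra.Algebra" "HOL-Algebra.Algebraic_Closure_Type"
begin

section \<open>Krull valuations\<close>

text \<open>
  Value groups are linearly ordered abelian groups. They are written multiplicatively, as
  \<^const>\<open>monoid.mult\<close> dictates, but ordered as usual for additive valuations:
  \<open>v (a + b) \<ge> min (v a) (v b)\<close>, and the valuation ring consists of the elements of value
  \<open>\<ge> \<one>\<close>.
\<close>

record 'g ordered_group = "'g monoid" +
  gle :: "'g \<Rightarrow> 'g \<Rightarrow> bool" (infixl \<open>\<preceq>\<index>\<close> 50)

locale ordered_abelian_group = comm_group \<Gamma> for \<Gamma> :: "('g, 'c) ordered_group_scheme" (structure) +
  assumes gle_antisym: "\<lbrakk> a \<in> carrier \<Gamma>; b \<in> carrier \<Gamma>; a \<preceq> b; b \<preceq> a \<rbrakk> \<Longrightarrow> a = b"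
    and gle_trans: "\<lbrakk> a \<in> carrier \<Gamma>; b \<in> carrier \<Gamma>; c \<in> carrier \<Gamma>; a \<preceq> b; b \<preceq> c \<rbrakk> \<Longrightarrow> a \<preceq> c"
    and gle_total: "\<lbrakk> a \<in> carrier \<Gamma>; b \<in> carrier \<Gamma> \<rbrakk> \<Longrightarrow> a \<preceq> b \<or> b \<preceq> a"
    and gle_mult: "\<lbrakk> a \<in> carrier \<Gamma>; b \<in> carrier \<Gamma>; c \<in> carrier \<Gamma>; a \<preceq> b \<rbrakk> \<Longrightarrow> a \<otimes> c \<preceq> b \<otimes> c"

text \<open>
  A valuation on the subfield \<open>L\<close> of \<open>R\<close>. The value \<open>v \<zero> = \<infinity>\<close> is left implicit: \<open>v\<close> is only ever
  evaluated on \<open>L - {\<zero>}\<close>. It need not be surjective onto \<open>\<Gamma>\<close>.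
\<close>

definition valuation_on ::
    "('g, 'c) ordered_group_scheme \<Rightarrow> ('a, 'b) ring_scheme \<Rightarrow> 'a set \<Rightarrow> ('a \<Rightarrow> 'g) \<Rightarrow> bool" where
  "valuation_on \<Gamma> R L v \<longleftrightarrow>
     ordered_abelian_group \<Gamma> \<and> subfield L R \<and>
     (\<forall>a \<in> L - {\<zero>\<^bsub>R\<^esub>}. v a \<in> carrier \<Gamma>) \<and>
     (\<forall>a \<in> L - {\<zero>\<^bsub>R\<^esub>}. \<forall>b \<in> L - {\<zero>\<^bsub>R\<^esub>}. v (a \<otimes>\<^bsub>R\<^esub> b) = v a \<otimes>\<^bsub>\<Gamma>\<^esub> v b) \<and>
     (\<forall>a \<in> L - {\<zero>\<^bsub>R\<^esub>}. \<forall>b \<in> L - {\<zero>\<^bsub>R\<^esub>}. a \<oplus>\<^bsub>R\<^esub> b \<noteq> \<zero>\<^bsub>R\<^esub> \<longrightarrow>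
        v a \<preceq>\<^bsub>\<Gamma>\<^esub> v (a \<oplus>\<^bsub>R\<^esub> b) \<or> v b \<preceq>\<^bsub>\<Gamma>\<^esub> v (a \<oplus>\<^bsub>R\<^esub> b))"

definition value_group :: "('a, 'b) ring_scheme \<Rightarrow> 'a set \<Rightarrow> ('a \<Rightarrow> 'g) \<Rightarrow> 'g set" where
  "value_group R L v = v ` (L - {\<zero>\<^bsub>R\<^esub>})"

definition valuation_ring ::
    "('g, 'c) ordered_group_scheme \<Rightarrow> ('a, 'b) ring_scheme \<Rightarrow> 'a set \<Rightarrow> ('a \<Rightarrow> 'g) \<Rightarrow> 'a set" where
  "valuation_ring \<Gamma> R L v = {a \<in> L. a = \<zero>\<^bsub>R\<^esub> \<or> \<one>\<^bsub>\<Gamma>\<^esub> \<preceq>\<^bsub>\<Gamma>\<^esub> v a}"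

definition valuation_ideal ::
    "('g, 'c) ordered_group_scheme \<Rightarrow> ('a, 'b) ring_scheme \<Rightarrow> 'a set \<Rightarrow> ('a \<Rightarrow> 'g) \<Rightarrow> 'a set" where
  "valuation_ideal \<Gamma> R L v = {a \<in> L. a = \<zero>\<^bsub>R\<^esub> \<or> (\<one>\<^bsub>\<Gamma>\<^esub> \<preceq>\<^bsub>\<Gamma>\<^esub> v a \<and> v a \<noteq> \<one>\<^bsub>\<Gamma>\<^esub>)}"

definition residue_field ::
    "('g, 'c) ordered_group_scheme \<Rightarrow> ('a, 'b) ring_scheme \<Rightarrow> 'a set \<Rightarrow> ('a \<Rightarrow> 'g) \<Rightarrow> 'a set ring" where
  "residue_field \<Gamma> R L v =
     R\<lparr>carrier := valuation_ring \<Gamma> R L v\<rparr> Quot valuation_ideal \<Gamma> R L v"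


section \<open>Extensions of valued fields\<close>

text \<open>Both valuations take values in one ordered group, so \<open>vL \<subseteq> v'L'\<close> literally.\<close>

definition valued_extension ::
    "('g, 'c) ordered_group_scheme \<Rightarrow> ('a, 'b) ring_scheme \<Rightarrow>
     'a set \<Rightarrow> ('a \<Rightarrow> 'g) \<Rightarrow> 'a set \<Rightarrow> ('a \<Rightarrow> 'g) \<Rightarrow> bool" where
  "valued_extension \<Gamma> R L v L' v' \<longleftrightarrow>
     valuation_on \<Gamma> R L v \<and> valuation_on \<Gamma> R L' v' \<and> L \<subseteq> L' \<and>
     (\<forall>a \<in> L - {\<zero>\<^bsub>R\<^esub>}. v' a = v a)"

text \<open>The image of the residue field \<open>Lv\<close> in \<open>L'v'\<close> under the canonical embedding.\<close>

definition residue_image ::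
    "('g, 'c) ordered_group_scheme \<Rightarrow> ('a, 'b) ring_scheme \<Rightarrow>
     'a set \<Rightarrow> ('a \<Rightarrow> 'g) \<Rightarrow> 'a set \<Rightarrow> ('a \<Rightarrow> 'g) \<Rightarrow> 'a set set" where
  "residue_image \<Gamma> R L v L' v' =
     (\<lambda>a. valuation_ideal \<Gamma> R L' v' +>\<^bsub>R\<^esub> a) ` valuation_ring \<Gamma> R L v"

definition immediate_extension ::
    "('g, 'c) ordered_group_scheme \<Rightarrow> ('a, 'b) ring_scheme \<Rightarrow>
     'a set \<Rightarrow> ('a \<Rightarrow> 'g) \<Rightarrow> 'a set \<Rightarrow> ('a \<Rightarrow> 'g) \<Rightarrow> bool" where
  "immediate_extension \<Gamma> R L v L' v' \<longleftrightarrow>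
     valued_extension \<Gamma> R L v L' v' \<and>
     value_group R L' v' = value_group R L v \<and>
     carrier (residue_field \<Gamma> R L' v') = residue_image \<Gamma> R L v L' v'"

text \<open>Algebraic, normal (minimal polynomials split) and separable (without multiple roots).\<close>

definition galois_extension :: "('a, 'b) ring_scheme \<Rightarrow> 'a set \<Rightarrow> 'a set \<Rightarrow> bool" where
  "galois_extension R L L' \<longleftrightarrow>
     subfield L R \<and> subfield L' R \<and> L \<subseteq> L' \<and>
     (\<forall>a \<in> L'. ring.algebraic R L a \<and>
        ring.splitted (R\<lparr>carrier := L'\<rparr>) (ring.Irr R L a) \<and>
        (\<forall>b. count (ring.roots (R\<lparr>carrier := L'\<rparr>) (ring.Irr R L a)) b \<le> 1))"


section \<open>The defect\<close>

definition ramification_index ::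
    "('g, 'c) ordered_group_scheme \<Rightarrow> ('a, 'b) ring_scheme \<Rightarrow>
     'a set \<Rightarrow> ('a \<Rightarrow> 'g) \<Rightarrow> 'a set \<Rightarrow> ('a \<Rightarrow> 'g) \<Rightarrow> nat" where
  "ramification_index \<Gamma> R L v L' v' =
     card (rcosets\<^bsub>\<Gamma>\<lparr>carrier := value_group R L' v'\<rparr>\<^esub> (value_group R L v))"

definition inertia_degree ::
    "('g, 'c) ordered_group_scheme \<Rightarrow> ('a, 'b) ring_scheme \<Rightarrow>
     'a set \<Rightarrow> ('a \<Rightarrow> 'g) \<Rightarrow> 'a set \<Rightarrow> ('a \<Rightarrow> 'g) \<Rightarrow> nat" where
  "inertia_degree \<Gamma> R L v L' v' =
     ring.dim (residue_field \<Gamma> R L' v')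
       (residue_image \<Gamma> R L v L' v') (carrier (residue_field \<Gamma> R L' v'))"

text \<open>
  Extensions of \<open>v\<close> to \<open>L'\<close> are counted up to equivalence, i.e. through their valuation rings: the
  subrings of \<open>L'\<close> containing \<open>a\<close> or \<open>a\<^sup>-\<^sup>1\<close> for every \<open>a \<noteq> 0\<close>. Thereby no type of value groups
  has to be chosen.
\<close>

definition valuation_extensions ::
    "('g, 'c) ordered_group_scheme \<Rightarrow> ('a, 'b) ring_scheme \<Rightarrow>
     'a set \<Rightarrow> ('a \<Rightarrow> 'g) \<Rightarrow> 'a set \<Rightarrow> 'a set set" where
  "valuation_extensions \<Gamma> R L v L' =
     {V. subring V R \<and> V \<subseteq> L' \<and> (\<forall>a \<in> L' - {\<zero>\<^bsub>R\<^esub>}. a \<in> V \<or> inv\<^bsub>R\<^esub> a \<in> V) \<and>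
         V \<inter> L = valuation_ring \<Gamma> R L v}"

text \<open>
  The defect \<open>d\<close> of a finite Galois extension is given by the fundamental equality
  \<open>[L' : L] = d \<cdot> e \<cdot> f \<cdot> g\<close>, where \<open>g\<close> is the number of extensions of \<open>v\<close> from \<open>L\<close> to \<open>L'\<close>.
  (This is the usual definition \<open>d = [L'L\<^sup>h : L\<^sup>h] / (e \<cdot> f)\<close> through a henselization \<open>L\<^sup>h\<close>, because
  \<open>[L'L\<^sup>h : L\<^sup>h] = [L' : L] / g\<close> for Galois extensions.)
\<close>

definition has_defect ::
    "('g, 'c) ordered_group_scheme \<Rightarrow> ('a, 'b) ring_scheme \<Rightarrow>
     'a set \<Rightarrow> ('a \<Rightarrow> 'g) \<Rightarrow> 'a set \<Rightarrow> ('a \<Rightarrow> 'g) \<Rightarrow> nat \<Rightarrow> bool" where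
  "has_defect \<Gamma> R L v L' v' d \<longleftrightarrow>
     galois_extension R L L' \<and>
     (\<exists>n > 0. ring.dimension R n L L' \<and>
        n = d * ramification_index \<Gamma> R L v L' v' * inertia_degree \<Gamma> R L v L' v'
              * card (valuation_extensions \<Gamma> R L v L'))"


section \<open>Immediate extensions of full defect\<close>

text \<open>
  In the immediate case \<open>e = f = 1\<close>, so that the defect equals the degree if and only if the
  extension of the valuation is unique.
\<close>

locale valued_field = field R for R :: "('a, 'b) ring_scheme" (structure) +
  fixes \<Gamma> :: "('g, 'c) ordered_group_scheme" and L :: "'a set" and v :: "'a \<Rightarrow> 'g"
  assumes valuation: "valuation_on \<Gamma> R L v"
begin

sublocale G: ordered_abelian_group \<Gamma>
  using valuation by (simp add: valuation_on_def)

lemma subfield_L: "subfield L R" using valuation by (simp add: valuation_on_def)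
lemmas L_closed = subringE[OF subfieldE(1)[OF subfield_L]]
lemma L_carrier: "a \<in> L \<Longrightarrow> a \<in> carrier R" using L_closed(1) by auto
lemma v_closed: "a \<in> L \<Longrightarrow> a \<noteq> \<zero> \<Longrightarrow> v a \<in> carrier \<Gamma>" using valuation by (simp add: valuation_on_def)
lemma v_mult: "a \<in> L \<Longrightarrow> a \<noteq> \<zero> \<Longrightarrow> b \<in> L \<Longrightarrow> b \<noteq> \<zero> \<Longrightarrow> v (a \<otimes> b) = v a \<otimes>\<^bsub>\<Gamma>\<^esub> v b"
  using valuation by (simp add: valuation_on_def)
lemma v_add: "a \<in> L \<Longrightarrow> a \<noteq> \<zero> \<Longrightarrow> b \<in> L \<Longrightarrow> b \<noteq> \<zero> \<Longrightarrow> a \<oplus> b \<noteq> \<zero> \<Longrightarrow> 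
   v a \<preceq>\<^bsub>\<Gamma>\<^esub> v (a \<oplus> b) \<or> v b \<preceq>\<^bsub>\<Gamma>\<^esub> v (a \<oplus> b)"
  using valuation by (simp add: valuation_on_def)
lemma L_inv: "a \<in> L \<Longrightarrow> a \<noteq> \<zero> \<Longrightarrow> inv a \<in> L \<and> inv a \<noteq> \<zero> \<and> a \<otimes> inv a = \<one>"
  using subfield_m_inv[OF subfield_L] by auto
lemma v_one: "v \<one> = \<one>\<^bsub>\<Gamma>\<^esub>"
proof -
  have "v \<one> \<otimes>\<^bsub>\<Gamma>\<^esub> v \<one> = v \<one>" using v_mult[of \<one> \<one>] L_closed(3) by simp
  thus ?thesis using v_closed[of \<one>] L_closed(3) by (metis G.r_cancel_one one_not_zero)
qed
lemma v_inv: "a \<in> L \<Longrightarrow> a \<noteq> \<zero> \<Longrightarrow> v (inv a) = inv\<^bsub>\<Gamma>\<^esub> (v a)"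
  using v_mult[of a "inv a"] L_inv[of a] v_one v_closed by (metis G.inv_equality G.m_comm)
lemma gle_refl: "x \<in> carrier \<Gamma> \<Longrightarrow> x \<preceq>\<^bsub>\<Gamma>\<^esub> x" using G.gle_total by blast
lemma square_eq_one: assumes "x \<in> carrier \<Gamma>" "x \<otimes>\<^bsub>\<Gamma>\<^esub> x = \<one>\<^bsub>\<Gamma>\<^esub>" shows "x = \<one>\<^bsub>\<Gamma>\<^esub>"
  using G.gle_total[of x "\<one>\<^bsub>\<Gamma>\<^esub>"] G.gle_mult[of x "\<one>\<^bsub>\<Gamma>\<^esub>" x] G.gle_mult[of "\<one>\<^bsub>\<Gamma>\<^esub>" x x] assms
    G.gle_antisym[of x "\<one>\<^bsub>\<Gamma>\<^esub>"] by auto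
lemma v_neg: assumes "a \<in> L" "a \<noteq> \<zero>" shows "v (\<ominus> a) = v a"
proof -
  have m: "\<ominus> \<one> \<in> L" "\<ominus> \<one> \<noteq> \<zero>" using L_closed(3,5) by (auto simp: add.inv_eq_1_iff)
  have "v (\<ominus> \<one>) \<otimes>\<^bsub>\<Gamma>\<^esub> v (\<ominus> \<one>) = \<one>\<^bsub>\<Gamma>\<^esub>" using v_mult[OF m m] v_one by (simp add: l_minus r_minus)
  hence "v (\<ominus> \<one>) = \<one>\<^bsub>\<Gamma>\<^esub>" using square_eq_one v_closed[OF m] by blast
  thus ?thesis using v_mult[OF m assms] v_closed[OF assms] L_carrier[OF assms(1)] by (simp add: l_minus)
qed

abbreviation O\<^sub>v :: "'a set" where "O\<^sub>v \<equiv> valuation_ring \<Gamma> R L v"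
abbreviation M\<^sub>v :: "'a set" where "M\<^sub>v \<equiv> valuation_ideal \<Gamma> R L v"

lemma one_gle_trans: "\<one>\<^bsub>\<Gamma>\<^esub> \<preceq>\<^bsub>\<Gamma>\<^esub> x \<Longrightarrow> x \<in> carrier \<Gamma> \<Longrightarrow> y \<in> carrier \<Gamma> \<Longrightarrow> x \<preceq>\<^bsub>\<Gamma>\<^esub> y \<Longrightarrow> \<one>\<^bsub>\<Gamma>\<^esub> \<preceq>\<^bsub>\<Gamma>\<^esub> y"
  using G.gle_trans[of "\<one>\<^bsub>\<Gamma>\<^esub>" x y] by auto
lemma one_gless_trans: "\<one>\<^bsub>\<Gamma>\<^esub> \<preceq>\<^bsub>\<Gamma>\<^esub> x \<Longrightarrow> x \<noteq> \<one>\<^bsub>\<Gamma>\<^esub> \<Longrightarrow> x \<in> carrier \<Gamma> \<Longrightarrow> y \<in> carrier \<Gamma> \<Longrightarrow> x \<preceq>\<^bsub>\<Gamma>\<^esub> y \<Longrightarrow> \<one>\<^bsub>\<Gamma>\<^esub> \<preceq>\<^bsub>\<Gamma>\<^esub> y \<and> y \<noteq> \<one>\<^bsub>\<Gamma>\<^esub>"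
  using one_gle_trans[of x y] G.gle_antisym[of "\<one>\<^bsub>\<Gamma>\<^esub>" x] by auto
lemma gle_mult_one: "\<one>\<^bsub>\<Gamma>\<^esub> \<preceq>\<^bsub>\<Gamma>\<^esub> x \<Longrightarrow> x \<in> carrier \<Gamma> \<Longrightarrow> y \<in> carrier \<Gamma> \<Longrightarrow> y \<preceq>\<^bsub>\<Gamma>\<^esub> x \<otimes>\<^bsub>\<Gamma>\<^esub> y"
  using G.gle_mult[of "\<one>\<^bsub>\<Gamma>\<^esub>" x y] by auto

lemma O_add: assumes "a \<in> O\<^sub>v" "b \<in> O\<^sub>v" shows "a \<oplus> b \<in> O\<^sub>v"
proof (cases "a = \<zero> \<or> b = \<zero> \<or> a \<oplus> b = \<zero>")
  case True thus ?thesis using assms L_carrier L_closed(2,7) by (auto simp: valuation_ring_def)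
next
  case False thus ?thesis using assms v_add[of a b] L_closed(7)[of a b] one_gle_trans[OF _ v_closed v_closed] by (auto simp: valuation_ring_def)
qed
lemma M_add: assumes "a \<in> M\<^sub>v" "b \<in> M\<^sub>v" shows "a \<oplus> b \<in> M\<^sub>v"
proof (cases "a = \<zero> \<or> b = \<zero> \<or> a \<oplus> b = \<zero>")
  case True thus ?thesis using assms L_carrier L_closed(2,7) by (auto simp: valuation_ideal_def)
next
  case False thus ?thesis using assms v_add[of a b] L_closed(7)[of a b] one_gless_trans[OF _ _ v_closed v_closed] by (auto simp: valuation_ideal_def)
qed
lemma O_mult: assumes "a \<in> O\<^sub>v" "b \<in> O\<^sub>v" shows "a \<otimes> b \<in> O\<^sub>v"
proof (cases "a = \<zero> \<or> b = \<zero>")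
  case True thus ?thesis using assms L_carrier L_closed(2) by (auto simp: valuation_ring_def)
next
  case False thus ?thesis using assms v_mult[of a b] L_closed(6)[of a b] v_closed[of a] v_closed[of b] 
    one_gle_trans[of "v b" "v a \<otimes>\<^bsub>\<Gamma>\<^esub> v b"] gle_mult_one[of "v a" "v b"] by (auto simp: valuation_ring_def)
qed
lemma M_mult: assumes "a \<in> O\<^sub>v" "b \<in> M\<^sub>v" shows "a \<otimes> b \<in> M\<^sub>v"
proof (cases "a = \<zero> \<or> b = \<zero>")
  case True thus ?thesis using assms L_carrier L_closed(2) by (auto simp: valuation_ring_def valuation_ideal_def)
next
  case False thus ?thesis using assms v_mult[of a b] L_closed(6)[of a b] v_closed[of a] v_closed[of b] integral[of a b] L_carrier
    one_gless_trans[of "v b" "v a \<otimes>\<^bsub>\<Gamma>\<^esub> v b"] gle_mult_one[of "v a" "v b"] by (auto simp: valuation_ring_def valuation_ideal_def)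
qed
lemma O_neg: "a \<in> O\<^sub>v \<Longrightarrow> \<ominus> a \<in> O\<^sub>v" using L_closed(5) v_neg[of a] L_carrier[of a] by (cases "a = \<zero>") (auto simp: valuation_ring_def)
lemma M_neg: "a \<in> M\<^sub>v \<Longrightarrow> \<ominus> a \<in> M\<^sub>v" using L_closed(5) v_neg[of a] L_carrier[of a] by (cases "a = \<zero>") (auto simp: valuation_ideal_def)
lemma one_in_O: "\<one> \<in> O\<^sub>v" using L_closed(3) v_one gle_refl by (auto simp: valuation_ring_def)
lemma zero_in_M: "\<zero> \<in> M\<^sub>v" using L_closed(2) by (auto simp: valuation_ideal_def)
lemma one_notin_M: "\<one> \<notin> M\<^sub>v" using v_one by (auto simp: valuation_ideal_def)
lemma M_subset_O: "M\<^sub>v \<subseteq> O\<^sub>v" by (auto simp: valuation_ring_def valuation_ideal_def)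
lemma O_subset_L: "O\<^sub>v \<subseteq> L" by (auto simp: valuation_ring_def)
lemma O_unit: "a \<in> O\<^sub>v \<Longrightarrow> a \<notin> M\<^sub>v \<Longrightarrow> inv a \<in> O\<^sub>v \<and> a \<otimes> inv a = \<one>"
  using L_inv[of a] v_inv[of a] gle_refl by (auto simp: valuation_ring_def valuation_ideal_def)

lemma valuation_ring_subring: "subring O\<^sub>v R"
  by (rule subringI) (use O_subset_L L_carrier one_in_O O_neg O_mult O_add in auto)

lemma valuation_ideal_ideal: "ideal M\<^sub>v (R\<lparr>carrier := O\<^sub>v\<rparr>)"
proof (rule idealI)
  show r: "ring (R\<lparr>carrier := O\<^sub>v\<rparr>)" by (rule subring_is_ring[OF valuation_ring_subring])
  interpret S: ring "R\<lparr>carrier := O\<^sub>v\<rparr>" by (rule r)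
  show "subgroup M\<^sub>v (add_monoid (R\<lparr>carrier := O\<^sub>v\<rparr>))"
  proof (rule S.add.subgroupI)
    fix a assume a: "a \<in> M\<^sub>v"
    hence "a \<in> O\<^sub>v" using M_subset_O by auto
    hence "\<ominus>\<^bsub>R\<lparr>carrier := O\<^sub>v\<rparr>\<^esub> a = \<ominus> a"
      using S.minus_equality[of "\<ominus> a" a] O_neg[of a] l_neg[OF L_carrier, of a] O_subset_L by auto
    thus "\<ominus>\<^bsub>R\<lparr>carrier := O\<^sub>v\<rparr>\<^esub> a \<in> M\<^sub>v" using M_neg[OF a] by simp
  qed (use M_subset_O zero_in_M M_add in auto)
  fix a x assume "a \<in> M\<^sub>v" "x \<in> carrier (R\<lparr>carrier := O\<^sub>v\<rparr>)"
  moreover from this have "a \<otimes> x = x \<otimes> a" using M_subset_O O_subset_L L_carrier m_comm[of a x] by auto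
  ultimately show "x \<otimes>\<^bsub>R\<lparr>carrier := O\<^sub>v\<rparr>\<^esub> a \<in> M\<^sub>v" "a \<otimes>\<^bsub>R\<lparr>carrier := O\<^sub>v\<rparr>\<^esub> x \<in> M\<^sub>v"
    using M_mult by auto
qed

lemma residue_field_field: "field (residue_field \<Gamma> R L v)"
proof -
  have c: "cring (R\<lparr>carrier := O\<^sub>v\<rparr>)"
    using subcring_iff[of O\<^sub>v] subcringI'[OF valuation_ring_subring] subringE(1)[OF valuation_ring_subring] by auto
  interpret S: cring "R\<lparr>carrier := O\<^sub>v\<rparr>" by (rule c)
  have "maximalideal M\<^sub>v (R\<lparr>carrier := O\<^sub>v\<rparr>)"
  proof (rule maximalidealI[OF valuation_ideal_ideal])
    show "carrier (R\<lparr>carrier := O\<^sub>v\<rparr>) \<noteq> M\<^sub>v" using one_in_O one_notin_M by auto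
    fix J assume J: "ideal J (R\<lparr>carrier := O\<^sub>v\<rparr>)" "M\<^sub>v \<subseteq> J" "J \<subseteq> carrier (R\<lparr>carrier := O\<^sub>v\<rparr>)"
    show "J = M\<^sub>v \<or> J = carrier (R\<lparr>carrier := O\<^sub>v\<rparr>)"
    proof (cases "J = M\<^sub>v")
      case False
      then obtain a where a: "a \<in> J" "a \<notin> M\<^sub>v" using J by auto
      hence "a \<in> O\<^sub>v" using J by auto
      hence "inv a \<in> O\<^sub>v" "a \<otimes> inv a = \<one>" using O_unit a by auto
      hence "\<one> \<in> J" using ideal.I_r_closed[OF J(1) a(1), of "inv a"] by auto
      thus ?thesis using ideal.one_imp_carrier[OF J(1)] by auto
    qed auto
  qed
  from maximalideal.quotient_is_field[OF this c] show ?thesis by (simp add: residue_field_def)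
qed

lemma value_group_subgroup: "subgroup (value_group R L v) \<Gamma>"
proof (rule G.subgroupI)
  show "value_group R L v \<subseteq> carrier \<Gamma>" using v_closed by (auto simp: value_group_def)
  show "value_group R L v \<noteq> {}" using L_closed(3) by (force simp: value_group_def)
  fix a assume "a \<in> value_group R L v"
  then obtain x where x: "x \<in> L" "x \<noteq> \<zero>" "a = v x" by (auto simp: value_group_def)
  thus "inv\<^bsub>\<Gamma>\<^esub> a \<in> value_group R L v" using v_inv[of x] L_inv[of x]
    by (auto simp: value_group_def intro!: image_eqI[of _ _ "inv x"])
  fix b assume "b \<in> value_group R L v"
  then obtain y where y: "y \<in> L" "y \<noteq> \<zero>" "b = v y" by (auto simp: value_group_def)
  thus "a \<otimes>\<^bsub>\<Gamma>\<^esub> b \<in> value_group R L v" using v_mult[of x y] x L_closed(6)[of x y] integral[of x y] L_carrier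
    by (auto simp: value_group_def intro!: image_eqI[of _ _ "x \<otimes> y"])
qed

end

lemma immediate_indices:
  assumes "field R" "immediate_extension \<Gamma> R L v L' v'"
  shows "ramification_index \<Gamma> R L v L' v' = 1" "inertia_degree \<Gamma> R L v L' v' = 1"
proof -
  have val: "valuation_on \<Gamma> R L' v'" and eq: "value_group R L v = value_group R L' v'"
    and res: "residue_image \<Gamma> R L v L' v' = carrier (residue_field \<Gamma> R L' v')"
    using assms(2) by (auto simp: immediate_extension_def valued_extension_def)
  let ?Q = "residue_field \<Gamma> R L' v'" let ?H = "value_group R L' v'"
  interpret V: valued_field R \<Gamma> L' v'
    using assms(1) val by (simp add: valued_field_def valued_field_axioms_def)
  interpret Q: field ?Q using V.residue_field_field .
  show "inertia_degree \<Gamma> R L v L' v' = 1"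
    unfolding inertia_degree_def res using Q.dimI[OF Q.carrier_is_subfield] 
      Q.dimension_one[OF Q.carrier_is_subfield] unfolding over_def by blast
  have sg: "subgroup ?H \<Gamma>" using V.value_group_subgroup .
  interpret H: group "\<Gamma>\<lparr>carrier := ?H\<rparr>" using subgroup.subgroup_is_group[OF sg V.G.is_group] .
  have "subgroup ?H (\<Gamma>\<lparr>carrier := ?H\<rparr>)" using H.subgroup_self by simp
  hence "rcosets\<^bsub>\<Gamma>\<lparr>carrier := ?H\<rparr>\<^esub> ?H = {?H}"
    using H.coset_join2[of _ ?H] H.one_closed by (auto simp: RCOSETS_def)
  thus "ramification_index \<Gamma> R L v L' v' = 1" unfolding ramification_index_def eq by simp
qed

lemma has_defect_degree_iff_unique_extension:
  assumes "field R" "immediate_extension \<Gamma> R L v L' v'" "galois_extension R L L'"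
    and n: "ring.dimension R n L L'"
  shows "has_defect \<Gamma> R L v L' v' n \<longleftrightarrow> (\<exists>!V. V \<in> valuation_extensions \<Gamma> R L v L')"
proof -
  interpret R: field R by fact
  have L: "subfield L R" and L': "subfield L' R" using assms(3) by (auto simp: galois_extension_def)
  have "n > 0"
  proof (rule ccontr)
    assume "\<not> n > 0" hence "L' = {\<zero>\<^bsub>R\<^esub>}" using R.dimension_zero[OF L] n by auto
    thus False using subringE(3)[OF subfieldE(1)[OF L']] by auto
  qed
  have "has_defect \<Gamma> R L v L' v' n \<longleftrightarrow>
      (\<exists>m > 0. ring.dimension R m L L' \<and> m = n * card (valuation_extensions \<Gamma> R L v L'))"
    unfolding has_defect_def immediate_indices[OF assms(1,2)] using assms(3) by simp
  also have "\<dots> \<longleftrightarrow> n = n * card (valuation_extensions \<Gamma> R L v L')"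
    using n \<open>n > 0\<close> R.dimension_is_inj[OF L n] by metis
  also have "\<dots> \<longleftrightarrow> card (valuation_extensions \<Gamma> R L v L') = 1"
    using \<open>n > 0\<close> by auto
  also have "\<dots> \<longleftrightarrow> (\<exists>!V. V \<in> valuation_extensions \<Gamma> R L v L')"
    unfolding One_nat_def card_1_singleton_iff by auto
  finally show ?thesis .
qed


section \<open>Rational functions in two variables\<close>

text \<open>
  \<open>K(x,y)\<close> as the field of fractions of \<open>K[x][y]\<close>. Algebraic extensions of it are taken inside
  the type \<open>'k ratfun2 alg_closure\<close>. Every value group of \<open>K(x,y)\<close> is isomorphic to a
  group \<open>K(x,y)\<^sup>\<times> / O\<^sup>\<times>\<close> of cosets, so \<open>'k ratfun2 set\<close> is large enough a type for
  the values; immediate extensions need no more values.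
\<close>

type_synonym 'k ratfun2 = "'k poly poly fract"

definition const_ratfun2 :: "'k :: field \<Rightarrow> 'k ratfun2" where
  "const_ratfun2 c = Fract [:[:c:]:] 1"

end

theory Submission
  imports Defs
begin

text \<open>
  On \<open>K(\<theta>)\<close> take the valuation \<open>- deg\<close>, extended to the perfect hull. If \<open>\<theta>'\<^sup>p - \<theta>' = \<theta>\<close>, then the
  perfect hull of \<open>K(\<theta>')\<close> is an Artin--Schreier extension of that of \<open>K(\<theta>)\<close>; as both have value
  group \<open>\<int>[1/p]\<close> and residue field \<open>K\<close>, it is immediate, and the valuation extends uniquely because
  the translation \<open>\<theta>' \<mapsto> \<theta>' + 1\<close> preserves degrees. This iterates. To replace the perfect hull by
  \<open>K(x, y)\<close> with \<open>x = \<theta>\<^sub>0\<close>, let \<open>y\<close> be a limit of Laurent polynomials in \<open>x\<^bsup>1/p\<^sup>k\<^esup>\<close> that converges fast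
  enough to be transcendental. The \<open>i\<close>-th field of the tower is then \<open>K(\<theta>\<^sub>i, y)\<close>, which is again
  isomorphic to \<open>K(x, y)\<close>, the inclusion of its predecessor becoming the endomorphism
  \<open>x \<mapsto> x\<^sup>p - x, y \<mapsto> y\<close>. The value of \<open>g(\<theta>\<^sub>i, y)\<close> is the eventually constant value of
  \<open>g(\<theta>\<^sub>i, y\<^sub>k)\<close>, computed as the degree of a rational function in a \<open>p\<close>-power root of \<open>\<theta>\<^sub>i\<close>.
\<close>

section \<open>Polynomials and rational functions\<close>

subsection \<open>Ring morphisms\<close>

text \<open>One variable is not enough: a nontrivial valuation of a function field of transcendence
  degree one that is trivial on \<open>K\<close> is discrete and defectless, while an
  Artin--Schreier root of an element of value -1 has value -1/p. So the base field must already have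
  a p-divisible value group. The variable \<open>y\<close> provides this without enlarging the
  residue field: subtracting a partial sum of its series uncovers the next term, whose exponent has
  a larger power of p as denominator.

  Neither the perfect hull nor the series is ever formed. Each partial sum lives in a field
  \<open>K(U)\<close> with \<open>U\<close> a p-power root of the variable, and the Liouville gap
  makes degree and leading coefficient of \<open>g\<close> at the partial sums stabilise up to
  rescaling. The stable degree gives the value, the stable leading coefficient the residue.

  Uniqueness of the extension is the conjugacy of extensions in a Galois extension: a valuation
  preserved by a generator of the Galois group is the only one. For the cyclic group of order p it
  is shown directly, by integrality and norms.\<close>

definition ring_morphism :: "('a::comm_ring_1 \<Rightarrow> 'b::comm_ring_1) \<Rightarrow> bool" where
  "ring_morphism f \<longleftrightarrow> f 1 = 1 \<and> (\<forall>x y. f (x + y) = f x + f y) \<and> (\<forall>x y. f (x * y) = f x * f y)"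

lemma ring_morphismI:
  "f 1 = 1 \<Longrightarrow> (\<And>x y. f (x + y) = f x + f y) \<Longrightarrow> (\<And>x y. f (x * y) = f x * f y) \<Longrightarrow> ring_morphism f"
  by (simp add: ring_morphism_def)

lemma ring_morphism_comp: "ring_morphism f \<Longrightarrow> ring_morphism g \<Longrightarrow> ring_morphism (\<lambda>x. f (g x))"
  by (simp add: ring_morphism_def)

lemma ring_morphism_ident: "ring_morphism (\<lambda>x. x)"
  by (simp add: ring_morphism_def)

context
  fixes f :: "'a::comm_ring_1 \<Rightarrow> 'b::comm_ring_1"
  assumes f: "ring_morphism f"
begin

lemma morphism_one: "f 1 = 1" using f by (simp add: ring_morphism_def)
lemma morphism_add: "f (x + y) = f x + f y" using f by (simp add: ring_morphism_def)
lemma morphism_mult: "f (x * y) = f x * f y" using f by (simp add: ring_morphism_def)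
lemma morphism_zero: "f 0 = 0" using morphism_add[of 0 0] by simp
lemma morphism_minus: "f (- x) = - f x"
  using morphism_add[of x "- x"] morphism_zero by (simp add: eq_neg_iff_add_eq_0 add.commute)
lemma morphism_diff: "f (x - y) = f x - f y"
  using morphism_add[of x "- y"] morphism_minus by simp
lemma morphism_power: "f (x ^ n) = f x ^ n"
  by (induction n) (simp_all add: morphism_one morphism_mult)
lemma morphism_sum: "f (sum g A) = (\<Sum>x\<in>A. f (g x))"
  by (induction A rule: infinite_finite_induct) (simp_all add: morphism_zero morphism_add)
lemma morphism_prod: "f (prod g A) = (\<Prod>x\<in>A. f (g x))"
  by (induction A rule: infinite_finite_induct) (simp_all add: morphism_one morphism_mult)
lemma morphism_of_nat: "f (of_nat n) = of_nat n"
  by (induction n) (simp_all add: morphism_zero morphism_one morphism_add)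

lemmas morphism_simps = morphism_one morphism_add morphism_mult morphism_zero morphism_minus
  morphism_diff morphism_power morphism_sum morphism_prod morphism_of_nat

end

context
  fixes f :: "'a::field \<Rightarrow> 'b::field"
  assumes f: "ring_morphism f"
begin

lemma field_morphism_eq_0_iff: "f x = 0 \<longleftrightarrow> x = 0"
proof
  show "x = 0" if "f x = 0"
  proof (rule ccontr)
    assume "x \<noteq> 0"
    hence "1 = f (x * inverse x)" by (simp add: morphism_one[OF f])
    also have "\<dots> = 0" by (simp add: morphism_mult[OF f] that)
    finally show False by simp
  qed
qed (simp add: morphism_zero[OF f])

lemma field_morphism_inj: "inj f"
  using field_morphism_eq_0_iff by (metis injI morphism_diff[OF f] right_minus_eq)

lemma field_morphism_inverse: "f (inverse x) = inverse (f x)"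
proof (cases "x = 0")
  case False
  hence "f x * f (inverse x) = 1" by (simp flip: morphism_mult[OF f] add: morphism_one[OF f])
  thus ?thesis using inverse_unique by metis
qed (simp add: morphism_zero[OF f])

lemma field_morphism_divide: "f (x / y) = f x / f y"
  by (simp add: field_class.field_divide_inverse morphism_mult[OF f] field_morphism_inverse)

end


subsection \<open>Evaluation of polynomials\<close>

definition eval_at :: "('a::comm_ring_1 \<Rightarrow> 'b::comm_ring_1) \<Rightarrow> 'b \<Rightarrow> 'a poly \<Rightarrow> 'b" where
  "eval_at h a p = poly (map_poly h p) a"

lemma eval_at_pCons:
  assumes "ring_morphism h" shows "eval_at h a (pCons c p) = h c + a * eval_at h a p"
  by (simp add: eval_at_def map_poly_pCons morphism_zero[OF assms])

lemma eval_at_0: "eval_at h a 0 = 0"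
  by (simp add: eval_at_def)

lemma eval_at_const: "ring_morphism h \<Longrightarrow> eval_at h a [:c:] = h c"
  by (simp add: eval_at_pCons eval_at_0)

lemma eval_at_var: "ring_morphism h \<Longrightarrow> eval_at h a [:0, 1:] = a"
  by (simp add: eval_at_pCons eval_at_0 morphism_simps)

lemma eval_at_add:
  assumes "ring_morphism h" shows "eval_at h a (p + q) = eval_at h a p + eval_at h a q"
proof (induction p arbitrary: q)
  case (pCons c p)
  show ?case
    by (cases q) (simp add: eval_at_pCons assms morphism_add[OF assms] pCons.IH distrib_left)
qed (simp add: eval_at_0)

lemma eval_at_smult:
  assumes "ring_morphism h" shows "eval_at h a (smult c p) = h c * eval_at h a p"
  by (induction p) (simp_all add: eval_at_0 eval_at_pCons assms morphism_mult[OF assms] algebra_simps)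

lemma ring_morphism_eval_at:
  assumes h: "ring_morphism h" shows "ring_morphism (eval_at h a)"
proof (rule ring_morphismI)
  show "eval_at h a 1 = 1" by (metis eval_at_const h morphism_one one_pCons)
  show "eval_at h a (p * q) = eval_at h a p * eval_at h a q" for p q
  proof (induction p)
    case (pCons c p)
    thus ?case
      by (simp add: eval_at_add eval_at_pCons eval_at_smult h morphism_zero[OF h] algebra_simps)
  qed (simp add: eval_at_0)
qed (simp add: eval_at_add h)

lemma morphism_poly_eqI:
  assumes "ring_morphism f" "ring_morphism g" "\<And>c. f [:c:] = g [:c:]" "f [:0, 1:] = g [:0, 1:]"
  shows "f p = g p"
proof (induction p)
  case (pCons c p)
  have "pCons c p = [:c:] + [:0, 1:] * p" by simp
  thus ?case
    by (simp only: morphism_add[OF assms(1)] morphism_mult[OF assms(1)] morphism_add[OF assms(2)]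
        morphism_mult[OF assms(2)] assms(3,4) pCons)
qed (simp add: morphism_zero[OF assms(1)] morphism_zero[OF assms(2)])

lemma eval_at_altdef: assumes "ring_morphism h" "Polynomial.degree p \<le> n"
  shows "eval_at h a p = (\<Sum>i\<le>n. h (coeff p i) * a ^ i)"
proof -
  have *: "Polynomial.degree (map_poly h p) \<le> n"
    using map_poly_degree_leq[of h p] assms(2) by (rule order_trans)
  have "poly (map_poly h p) a = (\<Sum>i\<le>n. coeff (map_poly h p) i * a ^ i)"
    unfolding poly_altdef using * by (intro sum.mono_neutral_left) (auto simp: coeff_eq_0)
  thus ?thesis by (simp add: eval_at_def coeff_map_poly morphism_zero[OF assms(1)])
qed


subsection \<open>Fields of fractions\<close>

lemma ring_morphism_to_fract: "ring_morphism to_fract"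
  by (rule ring_morphismI) simp_all

lemmas to_fract_morphism = morphism_simps[OF ring_morphism_to_fract]

lemma Fract_conv_divide: "b \<noteq> 0 \<Longrightarrow> Fract a b = to_fract a / to_fract b"
  by (simp add: to_fract_def)

text \<open>Over a general domain there are no reduced fractions, so an arbitrary representative is
  chosen; independence of the choice always comes from \<open>numer_denom_cross\<close>.\<close>

definition numer :: "'a::idom fract \<Rightarrow> 'a" where
  "numer q = fst (SOME (a, b). b \<noteq> 0 \<and> q = Fract a b)"
definition denom :: "'a::idom fract \<Rightarrow> 'a" where
  "denom q = snd (SOME (a, b). b \<noteq> 0 \<and> q = Fract a b)"

lemma denom_nonzero: "denom q \<noteq> 0" and Fract_numer_denom: "q = Fract (numer q) (denom q)"
proof -
  obtain a b where "b \<noteq> 0" "q = Fract a b" by (cases q) auto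
  hence "case (a, b) of (a, b) \<Rightarrow> b \<noteq> 0 \<and> q = Fract a b" by simp
  from someI[of "\<lambda>z. case z of (a, b) \<Rightarrow> b \<noteq> 0 \<and> q = Fract a b", OF this]
  show "denom q \<noteq> 0" "q = Fract (numer q) (denom q)"
    unfolding numer_def denom_def case_prod_beta by (rule conjunct1, rule conjunct2)
qed

lemma fract_eq_divide: "q = to_fract (numer q) / to_fract (denom q)"
  by (rule trans[OF Fract_numer_denom Fract_conv_divide[OF denom_nonzero]])

lemma numer_denom_cross: "b \<noteq> 0 \<Longrightarrow> numer (Fract a b) * b = a * denom (Fract a b)"
  using Fract_numer_denom[of "Fract a b"] denom_nonzero[of "Fract a b"]
  by (simp only: eq_fract not_False_eq_True)

lemma numer_eq_0_iff: "numer q = 0 \<longleftrightarrow> q = 0"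
proof -
  have "to_fract (numer q) / to_fract (denom q) = 0 \<longleftrightarrow> numer q = 0"
    by (simp add: denom_nonzero)
  thus ?thesis by (simp only: fract_eq_divide[symmetric])
qed

lemma morphism_fract_eqI:
  assumes "ring_morphism f" "ring_morphism g" "\<And>a. f (to_fract a) = g (to_fract a)"
  shows "f q = (g q :: 'b::field)"
proof -
  have "f (to_fract a / to_fract b) = g (to_fract a / to_fract b)" for a b
    by (simp add: assms field_morphism_divide)
  from this[of "numer q" "denom q"] show ?thesis by (simp flip: fract_eq_divide)
qed

definition fract_lift :: "('a::idom \<Rightarrow> 'b::field) \<Rightarrow> 'a fract \<Rightarrow> 'b" where
  "fract_lift f q = f (numer q) / f (denom q)"

context
  fixes f :: "'a::idom \<Rightarrow> 'b::field"
  assumes f: "ring_morphism f" and inj: "\<And>a. f a = 0 \<Longrightarrow> a = 0"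
begin

lemma fract_lift_Fract: assumes "b \<noteq> 0" shows "fract_lift f (Fract a b) = f a / f b"
proof -
  have "f (numer (Fract a b)) * f b = f a * f (denom (Fract a b))"
    by (simp only: numer_denom_cross[OF assms] flip: morphism_mult[OF f])
  moreover have "f b \<noteq> 0" "f (denom (Fract a b)) \<noteq> 0"
    using inj[of b] inj[of "denom (Fract a b)"] assms denom_nonzero by auto
  ultimately show ?thesis by (simp add: fract_lift_def frac_eq_eq)
qed

lemma fract_lift_to_fract: "fract_lift f (to_fract a) = f a"
  by (simp add: to_fract_def fract_lift_Fract morphism_one[OF f])

lemma ring_morphism_fract_lift: "ring_morphism (fract_lift f)"
proof (rule ring_morphismI)
  show "fract_lift f 1 = 1"
    using fract_lift_to_fract[of 1] by (simp add: to_fract_morphism morphism_one[OF f])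
  fix x y :: "'a fract"
  obtain a b where x: "x = Fract a b" "b \<noteq> 0" by (cases x) auto
  obtain c e where y: "y = Fract c e" "e \<noteq> 0" by (cases y) auto
  have fbe: "f b \<noteq> 0" "f e \<noteq> 0" using inj[of b] inj[of e] x y by auto
  show "fract_lift f (x + y) = fract_lift f x + fract_lift f y"
    by (simp only: x y add_fract[OF x(2) y(2)], subst (1 2 3) fract_lift_Fract)
      (simp_all add: fbe x(2) y(2) morphism_add[OF f] morphism_mult[OF f] add_frac_eq)
  show "fract_lift f (x * y) = fract_lift f x * fract_lift f y"
    by (simp only: x y mult_fract, subst (1 2 3) fract_lift_Fract)
      (simp_all add: x(2) y(2) morphism_mult[OF f])
qed

end

lemma CHAR_fract: "CHAR('a::idom fract) = CHAR('a)"
proof -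
  have *: "of_nat n = (0 :: 'a fract) \<longleftrightarrow> CHAR('a) dvd n" for n
    using to_fract_eq_0_iff[of "of_nat n :: 'a"]
    by (simp only: to_fract_morphism(10) of_nat_eq_0_iff_char_dvd)
  show ?thesis by (rule CHAR_eqI) (simp_all only: *, simp)
qed

subsection \<open>The degree on the rational function field in one variable\<close>

definition fdeg :: "'k::field poly fract \<Rightarrow> int" where
  "fdeg q = int (Polynomial.degree (numer q)) - int (Polynomial.degree (denom q))"

text \<open>For nonzero \<open>q\<close>, the residue in \<open>K\<close> of \<open>q\<close>
  divided by the \<open>fdeg q\<close>-th power of the variable, with respect to the valuation
  \<open>- fdeg\<close>. It is tracked next to the degree in order to find the residue
  field.\<close>

definition flead :: "'k::field poly fract \<Rightarrow> 'k" where
  "flead q = Polynomial.lead_coeff (numer q) / Polynomial.lead_coeff (denom q)"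

text \<open>The value \<open>fdeg 0\<close> is junk; the predicate \<open>fdeg_le\<close> treats it as \<open>-\<infinity>\<close>.\<close>

definition fdeg_le :: "'k::field poly fract \<Rightarrow> int \<Rightarrow> bool" where
  "fdeg_le q m \<longleftrightarrow> q = 0 \<or> fdeg q \<le> m"

lemma fdeg_Fract:
  assumes "a \<noteq> 0" "b \<noteq> 0"
  shows "fdeg (Fract a b) = int (Polynomial.degree a) - int (Polynomial.degree b)"
proof -
  have eq: "numer (Fract a b) * b = a * denom (Fract a b)" using numer_denom_cross[OF assms(2)] .
  have "numer (Fract a b) \<noteq> 0" using eq assms denom_nonzero[of "Fract a b"] by auto
  hence "Polynomial.degree (numer (Fract a b)) + Polynomial.degree b =
      Polynomial.degree a + Polynomial.degree (denom (Fract a b))"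
    using arg_cong[OF eq, of Polynomial.degree] assms denom_nonzero[of "Fract a b"]
    by (simp add: degree_mult_eq)
  thus ?thesis by (simp add: fdeg_def)
qed

lemma flead_Fract:
  assumes "b \<noteq> 0"
  shows "flead (Fract a b) = Polynomial.lead_coeff a / Polynomial.lead_coeff b"
proof -
  have "Polynomial.lead_coeff (numer (Fract a b)) * Polynomial.lead_coeff b =
      Polynomial.lead_coeff a * Polynomial.lead_coeff (denom (Fract a b))"
    by (simp only: numer_denom_cross[OF assms] flip: lead_coeff_mult)
  thus ?thesis using assms denom_nonzero[of "Fract a b"] by (simp add: flead_def frac_eq_eq)
qed

lemma fract_nonzeroE:
  assumes "q \<noteq> 0" obtains a b where "q = Fract a b" "a \<noteq> 0" "b \<noteq> 0"
  using assms Fract_numer_denom[of q] denom_nonzero[of q] numer_eq_0_iff[of q] that by blast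

lemma common_denominatorE:
  obtains a c b where "q = Fract a b" "r = Fract c b" "b \<noteq> 0"
proof (rule that)
  show "q = Fract (numer q * denom r) (denom q * denom r)"
    by (subst Fract_numer_denom[of q], subst eq_fract) (simp_all add: denom_nonzero mult_ac)
  show "r = Fract (numer r * denom q) (denom q * denom r)"
    by (subst Fract_numer_denom[of r], subst eq_fract) (simp_all add: denom_nonzero mult_ac)
qed (simp add: denom_nonzero)

lemma Fract_eq_0_iff: "b \<noteq> 0 \<Longrightarrow> Fract a b = 0 \<longleftrightarrow> a = 0"
  by (simp add: Fract_conv_to_fract)

lemma fdeg_mult: assumes "q \<noteq> 0" "r \<noteq> 0" shows "fdeg (q * r) = fdeg q + fdeg r"
proof -
  obtain a b where 1: "q = Fract a b" "a \<noteq> 0" "b \<noteq> 0" using assms by (blast elim: fract_nonzeroE)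
  obtain c e where 2: "r = Fract c e" "c \<noteq> 0" "e \<noteq> 0" using assms by (blast elim: fract_nonzeroE)
  show ?thesis using 1 2 by (simp add: fdeg_Fract degree_mult_eq)
qed

lemma fdeg_one: "fdeg (1 :: 'k::field poly fract) = 0"
  using fdeg_mult[of "1 :: 'k poly fract" 1] by simp

lemma fdeg_power: "q \<noteq> 0 \<Longrightarrow> fdeg (q ^ n) = int n * fdeg q"
  by (induction n) (simp_all add: fdeg_one fdeg_mult algebra_simps)

lemma fdeg_inverse: "q \<noteq> 0 \<Longrightarrow> fdeg (inverse q) = - fdeg q"
  using fdeg_mult[of q "inverse q"] by (simp add: fdeg_one)

lemma fdeg_to_fract: "a \<noteq> 0 \<Longrightarrow> fdeg (to_fract a) = int (Polynomial.degree a)"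
  by (simp add: to_fract_def fdeg_Fract)

lemma flead_mult: "flead (q * r) = flead q * flead r"
proof -
  obtain a b where 1: "q = Fract a b" "b \<noteq> 0" by (cases q)
  obtain c e where 2: "r = Fract c e" "e \<noteq> 0" by (cases r)
  show ?thesis using 1 2 by (simp add: flead_Fract lead_coeff_mult)
qed

lemma flead_to_fract: "flead (to_fract a) = Polynomial.lead_coeff a"
  by (simp add: to_fract_def flead_Fract)

lemma flead_eq_0_iff: "flead q = 0 \<longleftrightarrow> q = 0"
  using numer_eq_0_iff[of q] denom_nonzero[of q] by (simp add: flead_def)

lemma fdeg_le_Fract:
  assumes "b \<noteq> 0"
  shows "fdeg_le (Fract a b) m \<longleftrightarrow>
    a = 0 \<or> int (Polynomial.degree a) \<le> m + int (Polynomial.degree b)"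
  using assms by (cases "a = 0") (auto simp: fdeg_le_def Fract_eq_0_iff fdeg_Fract)

lemma fdeg_le_zero: "fdeg_le 0 m"
  by (simp add: fdeg_le_def)

lemma fdeg_le_fdeg: "fdeg_le q (fdeg q)"
  by (simp add: fdeg_le_def)

lemma fdeg_le_add: assumes "fdeg_le q m" "fdeg_le r m" shows "fdeg_le (q + r) m"
proof -
  obtain a c b where eq: "q = Fract a b" "r = Fract c b" "b \<noteq> 0"
    by (rule common_denominatorE)
  have sum: "q + r = Fract (a + c) b"
    using eq by (simp add: Fract_conv_to_fract add_divide_distrib)
  show ?thesis
  proof (cases "a = 0 \<or> c = 0")
    case True
    hence "q = 0 \<or> r = 0" using eq by (simp add: Fract_eq_0_iff)
    thus ?thesis using assms by auto
  next
    case False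
    with assms show ?thesis unfolding sum unfolding eq(1,2) fdeg_le_Fract[OF eq(3)]
      using degree_add_le_max[of a c] by linarith
  qed
qed

lemma fdeg_le_mult: "fdeg_le q m \<Longrightarrow> fdeg_le r n \<Longrightarrow> fdeg_le (q * r) (m + n)"
  by (cases "q = 0 \<or> r = 0") (auto simp: fdeg_le_def fdeg_mult)

lemma fdeg_le_sum: "(\<And>i. i \<in> A \<Longrightarrow> fdeg_le (f i) m) \<Longrightarrow> fdeg_le (sum f A) m"
  by (induction A rule: infinite_finite_induct) (simp_all add: fdeg_le_zero fdeg_le_add)

lemma fdeg_le_power_zero: "fdeg_le q 0 \<Longrightarrow> fdeg_le (q ^ n) 0"
  by (cases "q = 0") (auto simp: fdeg_le_def fdeg_power power_0_left fdeg_one mult_nonneg_nonpos)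

lemma fdeg_add_small:
  assumes "q \<noteq> 0" "fdeg_le r m" "m < fdeg q"
  shows "q + r \<noteq> 0" "fdeg (q + r) = fdeg q" "flead (q + r) = flead q"
proof -
  obtain a c b where eq: "q = Fract a b" "r = Fract c b" "b \<noteq> 0"
    by (rule common_denominatorE)
  have sum: "q + r = Fract (a + c) b"
    using eq by (simp add: Fract_conv_to_fract add_divide_distrib)
  have a: "a \<noteq> 0" using assms(1) eq by (simp add: Fract_eq_0_iff)
  have "a + c \<noteq> 0 \<and> Polynomial.degree (a + c) = Polynomial.degree a \<and>
      coeff (a + c) (Polynomial.degree a) = Polynomial.lead_coeff a"
  proof (cases "c = 0")
    case False
    hence less: "Polynomial.degree c < Polynomial.degree a"
      using assms(2,3) a eq by (simp add: fdeg_le_Fract fdeg_Fract)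
    moreover from less have "a + c \<noteq> 0" by (metis add_eq_0_iff degree_minus less_irrefl)
    ultimately show ?thesis
      by (simp add: degree_add_eq_left coeff_eq_0)
  qed (simp add: a)
  thus "q + r \<noteq> 0" "fdeg (q + r) = fdeg q" "flead (q + r) = flead q"
    unfolding sum unfolding eq(1) using a eq(3) by (simp_all add: Fract_eq_0_iff fdeg_Fract flead_Fract)
qed

text \<open>Over a common denominator the top coefficients of the numerators cancel. This is the
  source of residues in \<open>K\<close>.\<close>

lemma fdeg_le_diff_same_lead:
  assumes "fdeg q = fdeg r" "flead q = flead r"
  shows "fdeg_le (q - r) (fdeg q - 1)"
proof (cases "q = 0")
  case True
  thus ?thesis using assms flead_eq_0_iff[of r] flead_eq_0_iff[of q] by (simp add: fdeg_le_zero)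
next
  case q: False
  hence r: "r \<noteq> 0" using assms flead_eq_0_iff[of r] flead_eq_0_iff[of q] by auto
  obtain a c b where eq: "q = Fract a b" "r = Fract c b" "b \<noteq> 0"
    by (rule common_denominatorE)
  have diff: "q - r = Fract (a - c) b"
    using eq by (simp add: Fract_conv_to_fract diff_divide_distrib)
  have nz: "a \<noteq> 0" "c \<noteq> 0" using q r eq by (simp_all add: Fract_eq_0_iff)
  have deg: "Polynomial.degree a = Polynomial.degree c"
    using assms(1) eq nz by (simp add: fdeg_Fract)
  have "Polynomial.lead_coeff a = Polynomial.lead_coeff c"
    using assms(2) eq by (simp add: flead_Fract)
  hence *: "coeff (a - c) (Polynomial.degree a) = 0" by (simp add: deg)
  have "a - c = 0 \<or> Polynomial.degree (a - c) < Polynomial.degree a"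
  proof (rule ccontr)
    assume "\<not> ?thesis"
    moreover have "Polynomial.degree (a - c) \<le> Polynomial.degree a"
      by (rule degree_diff_le) (simp_all add: deg)
    ultimately have "Polynomial.degree (a - c) = Polynomial.degree a" "a - c \<noteq> 0" by auto
    thus False using * by (metis leading_coeff_0_iff)
  qed
  thus ?thesis unfolding diff using eq nz by (auto simp: fdeg_le_Fract fdeg_Fract)
qed


subsection \<open>Substitution in rational functions of one variable\<close>

definition fsubst :: "'k::field poly \<Rightarrow> 'k poly fract \<Rightarrow> 'k poly fract" where
  "fsubst h = fract_lift (\<lambda>f. to_fract (pcompose f h))"

context
  fixes h :: "'k::field poly"
  assumes h: "Polynomial.degree h > 0"
begin

lemma ring_morphism_pcompose: "ring_morphism (\<lambda>f. to_fract (pcompose f h))"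
  by (rule ring_morphismI) (simp_all add: pcompose_1 pcompose_add pcompose_mult)

lemma to_fract_pcompose_eq_0: "to_fract (pcompose f h) = 0 \<Longrightarrow> f = 0"
  using h by (simp add: pcompose_eq_0_iff)

lemma ring_morphism_fsubst: "ring_morphism (fsubst h)"
  unfolding fsubst_def
  by (rule ring_morphism_fract_lift[OF ring_morphism_pcompose to_fract_pcompose_eq_0])

lemma fsubst_to_fract: "fsubst h (to_fract f) = to_fract (pcompose f h)"
  unfolding fsubst_def
  by (rule fract_lift_to_fract[OF ring_morphism_pcompose to_fract_pcompose_eq_0])

lemma fsubst_Fract: "b \<noteq> 0 \<Longrightarrow> fsubst h (Fract a b) = Fract (pcompose a h) (pcompose b h)"
  unfolding fsubst_def
  by (subst fract_lift_Fract[OF ring_morphism_pcompose to_fract_pcompose_eq_0])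
    (simp_all add: Fract_conv_to_fract)

lemma fsubst_eq_0_iff: "fsubst h q = 0 \<longleftrightarrow> q = 0"
  by (rule field_morphism_eq_0_iff[OF ring_morphism_fsubst])

lemma fdeg_fsubst: assumes "q \<noteq> 0" shows "fdeg (fsubst h q) = int (Polynomial.degree h) * fdeg q"
proof -
  obtain a b where q: "q = Fract a b" "a \<noteq> 0" "b \<noteq> 0" using assms by (blast elim: fract_nonzeroE)
  moreover from this have "pcompose a h \<noteq> 0" "pcompose b h \<noteq> 0"
    using h by (simp_all add: pcompose_eq_0_iff)
  ultimately show ?thesis by (simp add: fsubst_Fract fdeg_Fract degree_pcompose right_diff_distrib)
qed

lemma fdeg_le_fsubst: "fdeg_le q m \<Longrightarrow> fdeg_le (fsubst h q) (int (Polynomial.degree h) * m)"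
  by (cases "q = 0") (auto simp: fdeg_le_def fsubst_eq_0_iff fdeg_fsubst mult_left_mono)

lemma flead_fsubst:
  assumes "Polynomial.lead_coeff h = 1" shows "flead (fsubst h q) = flead q"
proof -
  obtain a b where q: "q = Fract a b" "b \<noteq> 0" by (cases q)
  have "pcompose b h \<noteq> 0" using q h by (simp add: pcompose_eq_0_iff)
  thus ?thesis unfolding q(1) fsubst_Fract[OF q(2)]
    using q(2) assms h by (simp add: flead_Fract lead_coeff_comp)
qed

end

lemma fsubst_fsubst:
  fixes g h :: "'k::field poly"
  assumes "Polynomial.degree g > 0" "Polynomial.degree h > 0"
  shows "fsubst h (fsubst g q) = fsubst (pcompose g h) q"
proof -
  obtain a b where q: "q = Fract a b" "b \<noteq> 0" by (cases q)
  have "pcompose b g \<noteq> 0" using q assms by (simp add: pcompose_eq_0_iff)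
  moreover have "Polynomial.degree (pcompose g h) > 0"
    using assms by (simp add: degree_pcompose)
  ultimately show ?thesis using q assms by (simp add: fsubst_Fract pcompose_assoc)
qed

lemma fsubst_var: "fsubst [:0, 1:] q = (q :: 'k::field poly fract)"
proof -
  obtain a b where q: "q = Fract a b" "b \<noteq> 0" by (cases q)
  thus ?thesis by (simp add: fsubst_Fract pcompose_idR)
qed

section \<open>The approximating Laurent polynomials\<close>

locale char_p =
  fixes p :: nat and ty :: "'k::field itself"
  assumes char_p: "CHAR('k) = p" and p_pos: "p > 0"
begin

lemma prime_p: "Factorial_Ring.prime p"
  using prime_CHAR_semidom[where 'a = 'k] char_p p_pos by simp

lemma p_gt_1: "p > 1"
  using prime_p by (rule prime_gt_1_nat)

lemma frobenius_add:
  fixes a b :: "'b::comm_ring_1" assumes "CHAR('b) = p"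
  shows "(a + b) ^ (p ^ m) = a ^ (p ^ m) + b ^ (p ^ m)"
  using freshmans_dream'[of "p ^ m" m a b] assms prime_p by simp

lemma frobenius_diff:
  fixes a b :: "'b::comm_ring_1" assumes "CHAR('b) = p"
  shows "(a - b) ^ (p ^ m) = a ^ (p ^ m) - b ^ (p ^ m)"
  using frobenius_add[OF assms, of "a - b" b m] by simp

lemma CHAR_poly: "CHAR('k poly) = p"
  by (simp add: char_p)

lemma CHAR_poly_fract: "CHAR('k poly fract) = p"
  by (simp add: CHAR_fract char_p)

definition pmon :: "nat \<Rightarrow> 'k poly" where "pmon m = monom 1 (p ^ m)"

definition as_poly :: "'k poly" where "as_poly = monom 1 p - [:0, 1:]"

text \<open>Expresses \<theta>_0 through \<theta>_i: each step inserts \<theta>_i =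
  \<open>as_poly\<close> at \<theta>_(i+1).\<close>

primrec hp :: "nat \<Rightarrow> 'k poly" where
  "hp 0 = [:0, 1:]"
| "hp (Suc i) = pcompose (hp i) as_poly"

lemma pcompose_power: "pcompose (f ^ n) g = pcompose f g ^ n" for f g :: "'k poly"
  by (induction n) (simp_all add: pcompose_1 pcompose_mult)

lemma pcompose_pmon: "pcompose (pmon m) f = f ^ (p ^ m)"
  by (simp add: pmon_def monom_altdef pcompose_power pcompose_pCons)

lemma var_power_pmon: "[:0, 1:] ^ (p ^ m) = pmon m"
  by (simp add: pmon_def monom_altdef)

lemma degree_pmon: "Polynomial.degree (pmon m) = p ^ m"
  by (simp add: pmon_def degree_monom_eq)

lemma degree_pmon_pos: "Polynomial.degree (pmon m) > 0"
  using p_pos by (simp add: degree_pmon)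

lemma lead_pmon: "Polynomial.lead_coeff (pmon m) = 1"
  by (simp add: pmon_def degree_monom_eq)

lemma pmon_add: "pcompose (pmon m) (pmon n) = pmon (m + n)"
  by (simp add: pcompose_pmon) (simp add: pmon_def monom_power power_add mult.commute)

lemma degree_as_poly: "Polynomial.degree as_poly = p"
  and lead_as_poly: "Polynomial.lead_coeff as_poly = 1"
proof -
  have "Polynomial.degree (monom 1 p + - [:0, 1 :: 'k:]) = Polynomial.degree (monom (1 :: 'k) p)"
    using p_gt_1 by (intro degree_add_eq_left) (simp add: degree_monom_eq)
  thus *: "Polynomial.degree as_poly = p"
    unfolding as_poly_def diff_conv_add_uminus using degree_monom_eq[of "1 :: 'k" p] by simp
  have "coeff [:0, 1 :: 'k:] p = 0" using p_gt_1 by (intro coeff_eq_0) simp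
  thus "Polynomial.lead_coeff as_poly = 1" unfolding * by (simp add: as_poly_def)
qed

lemma degree_as_poly_pos: "Polynomial.degree as_poly > 0"
  using p_pos by (simp add: degree_as_poly)

lemma degree_hp: "Polynomial.degree (hp i) = p ^ i"
  by (induction i) (simp_all add: degree_pcompose degree_as_poly)

lemma degree_hp_pos: "Polynomial.degree (hp i) > 0"
  using p_pos by (simp add: degree_hp)

text \<open>Both sides are the p^m-th power of \<open>as_poly\<close>, whose coefficients lie in the
  prime field. Hence Artin--Schreier steps commute with passing to p-power roots.\<close>

lemma as_poly_pmon: "pcompose as_poly (pmon m) = pcompose (pmon m) as_poly"
proof -
  have "pcompose (monom 1 p) (pmon m) = pcompose (pmon m) (monom 1 p)"
    using pmon_add[of 1 m] pmon_add[of m 1] by (simp add: pmon_def add.commute)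
  hence "pcompose as_poly (pmon m) = monom 1 p ^ (p ^ m) - [:0, 1:] ^ (p ^ m)"
    by (simp add: as_poly_def pcompose_diff pcompose_pmon var_power_pmon pcompose_pCons)
  also have "\<dots> = as_poly ^ (p ^ m)"
    by (simp add: as_poly_def frobenius_diff[OF CHAR_poly])
  finally show ?thesis by (simp add: pcompose_pmon)
qed

lemma hp_pmon: "pcompose (hp i) (pmon m) = pcompose (pmon m) (hp i)"
proof (induction i)
  case (Suc i)
  have "pcompose (hp (Suc i)) (pmon m) = pcompose (pcompose (hp i) (pmon m)) as_poly"
    by (simp add: as_poly_pmon flip: pcompose_assoc)
  thus ?case by (simp add: Suc pcompose_assoc)
qed (simp add: pcompose_idR pcompose_pCons)

lemma as_poly_shift: "pcompose as_poly [:1, 1:] = as_poly"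
proof -
  have "pcompose (monom 1 p) [:1, 1:] = ([:1:] + [:0, 1 :: 'k:]) ^ (p ^ 1)"
    using pcompose_pmon[of 1 "[:1, 1:]"] by (simp add: pmon_def)
  also have "\<dots> = [:1:] + monom 1 p"
    using var_power_pmon[of 1]
    by (subst frobenius_add[OF CHAR_poly]) (simp add: pmon_def flip: one_pCons)
  finally show ?thesis by (simp add: as_poly_def pcompose_diff pcompose_pCons)
qed

lemma pmon_shift: "pcompose (pmon m) [:1, 1:] = [:1:] + pmon m"
proof -
  have "pcompose (pmon m) [:1, 1:] = ([:1:] + [:0, 1 :: 'k:]) ^ (p ^ m)"
    by (simp add: pcompose_pmon)
  also have "\<dots> = [:1:] + pmon m"
    by (simp only: frobenius_add[OF CHAR_poly] var_power_pmon poly_const_pow power_one)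
  finally show ?thesis .
qed

abbreviation fvar :: "'k poly fract" where "fvar \<equiv> to_fract [:0, 1:]"

text \<open>Rewrites a rational function in terms of a p^m-th root of its variable. It fixes the
  coefficients, so it differs in general from the p^m-th power map.\<close>

abbreviation frob :: "nat \<Rightarrow> 'k poly fract \<Rightarrow> 'k poly fract" where "frob m \<equiv> fsubst (pmon m)"

lemmas frob_morphism = ring_morphism_fsubst[OF degree_pmon_pos]
lemmas frob_simps = morphism_simps[OF frob_morphism] field_morphism_inverse[OF frob_morphism]

lemma frob_frob: "frob m (frob n q) = frob (m + n) q"
  by (simp add: fsubst_fsubst degree_pmon_pos pmon_add add.commute)

lemma frob_fvar: "frob m fvar = fvar ^ (p ^ m)"
proof -
  have "pcompose [:0, 1:] (pmon m) = [:0, 1:] ^ (p ^ m)"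
    by (simp add: pcompose_pCons var_power_pmon)
  thus ?thesis by (simp only: fsubst_to_fract[OF degree_pmon_pos] to_fract_morphism)
qed

text \<open>
  The exponents grow so fast that the limit of the approximants below is transcendental by
  Liouville's argument. That the gaps between the denominators \<open>scale k\<close> are unbounded makes the
  value group easy to compute, and \<open>expo (Suc k)\<close> is prime to \<open>p\<close>.
\<close>

definition scale :: "nat \<Rightarrow> nat" where "scale k = p ^ (k * k)"

primrec expo :: "nat \<Rightarrow> nat" where
  "expo 0 = 1"
| "expo (Suc k) = 1 + p * Suc k * (scale (Suc k) + p ^ (2 * k + 1) * expo k)"

text \<open>In the variable \<open>U\<close> = x^(1/\<open>scale k\<close>) this is the partial sum
  y_k of the terms x^(-\<open>expo j\<close>/\<open>scale j\<close>) for j \<le> k. Since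
  \<open>scale (Suc k)\<close> is p^(2k+1) times \<open>scale k\<close>, the old sum is rewritten by
  \<open>frob (2 * k + 1)\<close> before the new term is added.\<close>

primrec appr :: "nat \<Rightarrow> 'k poly fract" where
  "appr 0 = inverse fvar ^ expo 0"
| "appr (Suc k) = frob (2 * k + 1) (appr k) + inverse fvar ^ expo (Suc k)"

text \<open>
  The evaluation at \<open>X = \<theta>\<^sub>i\<close> and \<open>Y = y\<^sub>k\<close>, written in \<open>U\<close> with \<open>\<theta>\<^sub>i = U\<^sup>q\<close> for \<open>q = scale k\<close>. Since
  \<open>\<theta>\<^sub>0\<close> is \<open>hp i\<close> evaluated at \<open>\<theta>\<^sub>i\<close> and \<open>hp i\<close> has coefficients in the prime field, the \<open>q\<close>-th root of
  \<open>\<theta>\<^sub>0\<close> is \<open>hp i\<close> evaluated at \<open>U\<close>.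
\<close>

definition phi :: "nat \<Rightarrow> nat \<Rightarrow> 'k poly poly \<Rightarrow> 'k poly fract" where
  "phi i k = eval_at (\<lambda>f. to_fract (pcompose f (pmon (k * k)))) (fsubst (hp i) (appr k))"

lemma scale_Suc: "scale (Suc k) = p ^ (2 * k + 1) * scale k"
proof -
  have "Suc k * Suc k = (2 * k + 1) + k * k" by simp
  thus ?thesis by (simp only: scale_def power_add)
qed

lemma scale_pos: "scale k > 0"
  using p_pos by (simp add: scale_def)

lemma fdeg_inverse_fvar_power: "fdeg (inverse fvar ^ n) = - int n"
  by (simp add: fdeg_power fdeg_inverse fdeg_to_fract)

lemma fdeg_le_inverse_fvar_power: "fdeg_le (inverse fvar ^ n) 0"
  by (simp only: fdeg_le_def fdeg_inverse_fvar_power) simp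

lemma fdeg_le_appr: "fdeg_le (appr k) 0"
proof (induction k)
  case 0
  show ?case by (simp add: fdeg_le_def fdeg_inverse fdeg_to_fract)
next
  case (Suc k)
  have "fdeg_le (frob (2 * k + 1) (appr k)) 0"
    using fdeg_le_fsubst[OF degree_pmon_pos Suc] by simp
  thus ?case by (simp only: appr.simps fdeg_le_add fdeg_le_inverse_fvar_power)
qed

lemma expo_mono: "p ^ (2 * k + 1) * expo k < expo (Suc k)"
proof -
  have "1 * (p ^ (2 * k + 1) * expo k) \<le> p * Suc k * (scale (Suc k) + p ^ (2 * k + 1) * expo k)"
    using p_pos by (intro mult_le_mono) auto
  thus ?thesis by simp
qed

text \<open>The pole orders of the terms, measured in the same root, increase by
  \<open>expo_mono\<close>, so the last one clears all denominators.\<close>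

lemma fvar_expo_appr: "fvar ^ expo k * appr k \<in> range to_fract"
proof (induction k)
  case 0
  have "fvar ^ expo 0 * appr 0 = to_fract 1" by simp
  thus ?case by blast
next
  case (Suc k)
  define m where "m = 2 * k + 1"
  obtain f where f: "fvar ^ expo k * appr k = to_fract f" using Suc by blast
  define e where "e = expo (Suc k) - p ^ m * expo k"
  have e: "expo (Suc k) = e + p ^ m * expo k"
    using expo_mono[of k] by (simp only: m_def e_def)
  have "fvar ^ expo (Suc k) * frob m (appr k) =
      fvar ^ e * ((fvar ^ (p ^ m)) ^ expo k * frob m (appr k))"
    by (simp only: e power_add power_mult mult.assoc)
  also have "(fvar ^ (p ^ m)) ^ expo k * frob m (appr k) = frob m (fvar ^ expo k * appr k)"
    by (simp only: frob_simps frob_fvar)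
  also have "\<dots> = to_fract (pcompose f (pmon m))"
    by (simp only: f fsubst_to_fract[OF degree_pmon_pos])
  finally have *: "fvar ^ expo (Suc k) * frob m (appr k) =
      to_fract ([:0, 1:] ^ e * pcompose f (pmon m))"
    by (simp only: to_fract_morphism)
  have "fvar ^ expo (Suc k) * inverse fvar ^ expo (Suc k) = (fvar * inverse fvar) ^ expo (Suc k)"
    by (simp only: power_mult_distrib)
  also have "\<dots> = to_fract 1" by simp
  finally have "fvar ^ expo (Suc k) * appr (Suc k) =
      to_fract ([:0, 1:] ^ e * pcompose f (pmon m) + 1)"
    using * by (simp only: appr.simps m_def distrib_left to_fract_morphism)
  thus ?case by blast
qed

text \<open>All terms of y_k have coefficient 1, so here the power map and the substitution do
  agree.\<close>

lemma appr_frobenius: "appr k ^ (p ^ m) = frob m (appr k)"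
proof (induction k)
  case 0
  show ?case by (simp add: frob_simps frob_fvar power_inverse)
next
  case (Suc k)
  have "frob (2 * k + 1) (appr k) ^ (p ^ m) = frob (2 * k + 1) (appr k ^ (p ^ m))"
    by (simp only: frob_simps)
  also have "\<dots> = frob m (frob (2 * k + 1) (appr k))"
    by (simp only: Suc frob_frob add.commute)
  finally show ?case
    by (simp only: appr.simps frobenius_add[OF CHAR_poly_fract] frob_simps frob_fvar power_inverse
        mult.commute flip: power_mult)
qed

end

lemma range_to_fract_closed:
  "x \<in> range to_fract \<Longrightarrow> y \<in> range to_fract \<Longrightarrow> x + y \<in> range to_fract"
  "x \<in> range to_fract \<Longrightarrow> y \<in> range to_fract \<Longrightarrow> x * y \<in> range to_fract"
  by (auto simp flip: to_fract_add to_fract_mult)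

lemma range_to_fract_power: "x \<in> range to_fract \<Longrightarrow> x ^ n \<in> range to_fract"
  by (auto simp flip: to_fract_morphism(7))

lemma range_to_fract_sum:
  "(\<And>i. i \<in> A \<Longrightarrow> f i \<in> range to_fract) \<Longrightarrow> sum f A \<in> range to_fract"
proof (induction A rule: infinite_finite_induct)
  case (insert x A)
  thus ?case by (simp add: range_to_fract_closed)
qed (auto intro: image_eqI[of _ _ 0])

context char_p
begin

abbreviation lim_appr :: "nat \<Rightarrow> nat \<Rightarrow> 'k poly fract" where
  "lim_appr i k \<equiv> fsubst (hp i) (appr k)"

lemmas hp_morphism = ring_morphism_fsubst[OF degree_hp_pos]
lemmas hp_simps = morphism_simps[OF hp_morphism] field_morphism_inverse[OF hp_morphism]
lemmas pmon_morphism = ring_morphism_pcompose[OF degree_pmon_pos]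

lemma ring_morphism_phi: "ring_morphism (phi i k)"
  unfolding phi_def by (rule ring_morphism_eval_at[OF pmon_morphism])

lemmas phi_simps = morphism_simps[OF ring_morphism_phi]

lemma frob_hp: "frob m (fsubst (hp i) q) = fsubst (hp i) (frob m q)"
  by (simp add: fsubst_fsubst degree_pmon_pos degree_hp_pos hp_pmon)

lemma fsubst_hp_fvar: "fsubst (hp i) fvar = to_fract (hp i)"
  by (simp add: fsubst_to_fract degree_hp_pos pcompose_pCons)

lemma hp_nonzero: "hp i \<noteq> 0"
  using degree_hp_pos[of i] by auto

lemma fdeg_to_fract_hp: "fdeg (to_fract (hp i)) = int (p ^ i)"
  by (simp add: fdeg_to_fract hp_nonzero degree_hp)

lemma lim_appr_Suc:
  "lim_appr i (Suc k) = frob (2 * k + 1) (lim_appr i k) + inverse (to_fract (hp i)) ^ expo (Suc k)"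
  by (simp only: appr.simps hp_simps frob_hp fsubst_hp_fvar)

lemma fdeg_le_lim_appr: "fdeg_le (lim_appr i k) 0"
  using fdeg_le_fsubst[OF degree_hp_pos fdeg_le_appr] by simp

lemma hp_expo_lim_appr: "to_fract (hp i) ^ expo k * lim_appr i k \<in> range to_fract"
proof -
  obtain f where "fvar ^ expo k * appr k = to_fract f" using fvar_expo_appr[of k] by blast
  hence "fsubst (hp i) (fvar ^ expo k * appr k) = to_fract (pcompose f (hp i))"
    by (simp only: fsubst_to_fract[OF degree_hp_pos])
  thus ?thesis by (simp only: hp_simps fsubst_hp_fvar) blast
qed

section \<open>Liouville's estimate and the stability of degrees\<close>

definition bounded_poly :: "nat \<Rightarrow> 'k poly poly \<Rightarrow> bool" where
  "bounded_poly n g \<longleftrightarrow>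
     Polynomial.degree g \<le> n \<and> (\<forall>j. Polynomial.degree (coeff g j) \<le> n)"

lemma ex_bounded_poly: "\<exists>n. bounded_poly n g"
proof -
  define n where "n = Polynomial.degree g + (\<Sum>j\<le>Polynomial.degree g. Polynomial.degree (coeff g j))"
  have "Polynomial.degree (coeff g j) \<le> n" for j
  proof (cases "j \<le> Polynomial.degree g")
    case True
    thus ?thesis unfolding n_def by (intro trans_le_add2 member_le_sum) auto
  qed (simp add: coeff_eq_0)
  thus ?thesis unfolding bounded_poly_def n_def by (intro exI[of _ n]) (auto simp: n_def)
qed

lemma phi_sum:
  assumes "bounded_poly n g"
  shows "phi i k g =
    (\<Sum>j\<le>n. to_fract (pcompose (coeff g j) (pmon (k * k))) * lim_appr i k ^ j)"
  unfolding phi_def using assms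
  by (intro eval_at_altdef[OF pmon_morphism]) (simp add: bounded_poly_def)

text \<open>The lower bound of Liouville's argument: multiplied by \<open>hp i\<close> to the power
  \<open>expo k * n\<close>, the value of \<open>g\<close> becomes a nonzero polynomial, whose
  degree is at least 0.\<close>

lemma fdeg_phi_ge:
  assumes "bounded_poly n g" "phi i k g \<noteq> 0"
  shows "fdeg (phi i k g) \<ge> - int (p ^ i * expo k * n)"
proof -
  let ?A = "to_fract (hp i)"
  have A: "?A \<noteq> 0" using hp_nonzero by simp
  have "?A ^ (expo k * n) * phi i k g = (\<Sum>j\<le>n. to_fract (pcompose (coeff g j) (pmon (k * k))) *
      (?A ^ (expo k * (n - j)) * (?A ^ expo k * lim_appr i k) ^ j))"
    unfolding phi_sum[OF assms(1)] sum_distrib_left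
  proof (rule sum.cong)
    fix j assume "j \<in> {..n}"
    hence n: "expo k * n = expo k * (n - j) + expo k * j" by (simp flip: distrib_left)
    thus "?A ^ (expo k * n) * (to_fract (pcompose (coeff g j) (pmon (k * k))) * lim_appr i k ^ j) =
        to_fract (pcompose (coeff g j) (pmon (k * k))) *
          (?A ^ (expo k * (n - j)) * (?A ^ expo k * lim_appr i k) ^ j)"
      unfolding n by (simp only: power_add power_mult_distrib flip: power_mult) (simp only: mult_ac)
  qed simp
  also have "\<dots> \<in> range to_fract"
    by (intro range_to_fract_sum range_to_fract_closed(2) range_to_fract_power hp_expo_lim_appr) auto
  finally obtain f where f: "?A ^ (expo k * n) * phi i k g = to_fract f" by blast
  hence "to_fract f \<noteq> 0" using A assms(2) by (metis mult_eq_0_iff power_not_zero)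
  hence "fdeg (?A ^ (expo k * n) * phi i k g) \<ge> 0"
    unfolding f by (simp add: fdeg_to_fract)
  moreover have "fdeg (?A ^ (expo k * n) * phi i k g) = int (p ^ i * expo k * n) + fdeg (phi i k g)"
    using A assms(2) by (simp add: fdeg_mult fdeg_power fdeg_to_fract_hp del: to_fract_eq_0_iff)
  ultimately show ?thesis by linarith
qed

text \<open>The factor \<open>x - y\<close> splits off, and the cofactor has degree at most
  0.\<close>

lemma fdeg_le_power_diff:
  assumes "fdeg_le x 0" "fdeg_le y 0" "fdeg_le (x - y) m"
  shows "fdeg_le (x ^ n - y ^ n) m"
proof -
  have "x ^ n - y ^ n = (x - y) * (\<Sum>i<n. y ^ (n - Suc i) * x ^ i)"
    by (rule power_diff_sumr2)
  moreover have "fdeg_le (y ^ (n - Suc i) * x ^ i) (0 + 0)" for i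
    by (intro fdeg_le_mult fdeg_le_power_zero assms)
  hence "fdeg_le (\<Sum>i<n. y ^ (n - Suc i) * x ^ i) 0"
    by (intro fdeg_le_sum) simp
  ultimately show ?thesis using fdeg_le_mult[OF assms(3)] by fastforce
qed

lemma fdeg_le_to_fract_pcompose_pmon:
  "Polynomial.degree f \<le> n \<Longrightarrow> fdeg_le (to_fract (pcompose f (pmon m))) (int (n * p ^ m))"
  by (cases "f = 0") (auto simp: fdeg_le_def fdeg_to_fract pcompose_eq_0_iff degree_pmon_pos
      degree_pcompose degree_pmon simp flip: of_nat_mult of_nat_power)

text \<open>The upper bound of Liouville's argument: coefficients contribute at most
  \<open>n * scale (Suc k)\<close>, and every difference of powers contains the one new term of the
  series, of degree \<open>- (p ^ i * expo (Suc k))\<close>.\<close>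

lemma fdeg_le_phi_Suc_diff:
  assumes "bounded_poly n g"
  shows "fdeg_le (phi i (Suc k) g - frob (2 * k + 1) (phi i k g))
    (int (n * scale (Suc k)) - int (p ^ i * expo (Suc k)))"
proof -
  let ?c = "\<lambda>j. to_fract (pcompose (coeff g j) (pmon (Suc k * Suc k)))"
  let ?y = "frob (2 * k + 1) (lim_appr i k)"
  have "frob (2 * k + 1) (to_fract (pcompose f (pmon (k * k)))) =
      to_fract (pcompose f (pmon (Suc k * Suc k)))" for f
  proof -
    have "pcompose (pcompose f (pmon (k * k))) (pmon (2 * k + 1)) =
        pcompose f (pmon (k * k + (2 * k + 1)))"
      by (simp only: pmon_add flip: pcompose_assoc)
    also have "k * k + (2 * k + 1) = Suc k * Suc k" by simp
    finally show ?thesis by (simp only: fsubst_to_fract[OF degree_pmon_pos])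
  qed
  hence "frob (2 * k + 1) (phi i k g) = (\<Sum>j\<le>n. ?c j * ?y ^ j)"
    by (simp only: phi_sum[OF assms] frob_simps)
  hence "phi i (Suc k) g - frob (2 * k + 1) (phi i k g) =
      (\<Sum>j\<le>n. ?c j * (lim_appr i (Suc k) ^ j - ?y ^ j))"
    by (simp only: phi_sum[OF assms] right_diff_distrib sum_subtractf)
  moreover have "fdeg_le (lim_appr i (Suc k) - ?y) (- int (p ^ i * expo (Suc k)))"
  proof -
    have "lim_appr i (Suc k) - ?y = inverse (to_fract (hp i)) ^ expo (Suc k)"
      by (simp only: lim_appr_Suc add_diff_cancel_left')
    moreover have "fdeg (inverse (to_fract (hp i)) ^ expo (Suc k)) = - int (p ^ i * expo (Suc k))"
      using hp_nonzero by (subst fdeg_power) (simp_all add: fdeg_inverse fdeg_to_fract_hp del: expo.simps)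
    ultimately show ?thesis using fdeg_le_fdeg by metis
  qed
  hence "fdeg_le (lim_appr i (Suc k) ^ j - ?y ^ j) (- int (p ^ i * expo (Suc k)))" for j
    using fdeg_le_fsubst[OF degree_pmon_pos fdeg_le_lim_appr]
    by (intro fdeg_le_power_diff fdeg_le_lim_appr) simp_all
  hence "fdeg_le (?c j * (lim_appr i (Suc k) ^ j - ?y ^ j))
      (int (n * p ^ (Suc k * Suc k)) + - int (p ^ i * expo (Suc k)))" for j
    using assms unfolding bounded_poly_def by (intro fdeg_le_mult fdeg_le_to_fract_pcompose_pmon) auto
  ultimately show ?thesis
    unfolding scale_def by (simp only: fdeg_le_sum diff_conv_add_uminus)
qed

text \<open>This inequality dictates the recursion for \<open>expo\<close>: the factor
  \<open>Suc k\<close> absorbs \<open>n\<close>, and the two summands in its bracket absorb the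
  degrees of the coefficients and the previous pole order.\<close>

lemma expo_gap:
  assumes "n \<le> Suc k"
  shows "int (n * scale (Suc k)) - int (p ^ i * expo (Suc k)) <
    int (p ^ (2 * k + 1)) * - int (p ^ i * expo k * n)"
proof -
  define s where "s = scale (Suc k)"
  define t where "t = p ^ (2 * k + 1) * expo k"
  have "n * (s + t) \<le> p * Suc k * (s + t)"
    using assms p_pos mult_le_mono[of 1 p n "Suc k"] by (intro mult_le_mono) auto
  also have "\<dots> < expo (Suc k)"
    unfolding expo.simps s_def t_def by (rule less_add_same_cancel2[THEN iffD2]) simp
  finally have less: "n * (s + t) < expo (Suc k)" .
  have "n * s + p ^ i * (n * t) \<le> p ^ i * (n * (s + t))"
    using p_pos by (simp add: distrib_left)
  also have "\<dots> < p ^ i * expo (Suc k)"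
    using p_pos less by (simp only: mult_less_cancel1 zero_less_power)
  finally have "n * s + p ^ (2 * k + 1) * (p ^ i * expo k * n) < p ^ i * expo (Suc k)"
    by (simp only: t_def mult_ac)
  hence "int (n * s) + int (p ^ (2 * k + 1)) * int (p ^ i * expo k * n) < int (p ^ i * expo (Suc k))"
    by (simp only: flip: of_nat_mult of_nat_add)
  thus ?thesis by (simp only: s_def mult_minus_right)
qed

text \<open>By \<open>expo_gap\<close> the change from y_k to y_(k+1) stays below the least degree
  that the old value can have, so only the rescaling by \<open>frob\<close> is seen.\<close>

lemma phi_stable:
  assumes "bounded_poly n g" "n \<le> Suc k" "phi i k g \<noteq> 0"
  shows "phi i (Suc k) g \<noteq> 0" "fdeg (phi i (Suc k) g) = int (p ^ (2 * k + 1)) * fdeg (phi i k g)"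
    "flead (phi i (Suc k) g) = flead (phi i k g)"
proof -
  let ?q = "frob (2 * k + 1) (phi i k g)"
  have nz: "?q \<noteq> 0" using assms(3) by (simp add: fsubst_eq_0_iff degree_pmon_pos)
  have deg: "fdeg ?q = int (p ^ (2 * k + 1)) * fdeg (phi i k g)"
    by (simp only: fdeg_fsubst[OF degree_pmon_pos assms(3)] degree_pmon)
  have "int (p ^ (2 * k + 1)) * - int (p ^ i * expo k * n) \<le> fdeg ?q"
    unfolding deg using fdeg_phi_ge[OF assms(1,3)] by (rule mult_left_mono) simp
  with expo_gap[OF assms(2), of i]
  have less: "int (n * scale (Suc k)) - int (p ^ i * expo (Suc k)) < fdeg ?q" by linarith
  have eq: "phi i (Suc k) g = ?q + (phi i (Suc k) g - ?q)" by simp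
  note * = fdeg_add_small[OF nz fdeg_le_phi_Suc_diff[OF assms(1)] less, folded eq]
  show "phi i (Suc k) g \<noteq> 0" "fdeg (phi i (Suc k) g) = int (p ^ (2 * k + 1)) * fdeg (phi i k g)"
    "flead (phi i (Suc k) g) = flead (phi i k g)"
    using * by (simp_all only: deg flead_fsubst[OF degree_pmon_pos lead_pmon] not_False_eq_True)
qed

text \<open>The exponents \<open>expo k\<close> / \<open>scale k\<close> of the series never
  decrease; here they are compared in units of 1/\<open>scale l\<close>.\<close>

lemma expo_scale_mono: "expo k * p ^ (l * l - k * k) \<le> expo l" if "k \<le> l"
  using that
proof (induction l rule: dec_induct)
  case (step l)
  have "Suc l * Suc l - k * k = (2 * l + 1) + (l * l - k * k)"
    using mult_le_mono[OF step(1) step(1)] by simp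
  hence "expo k * p ^ (Suc l * Suc l - k * k) = p ^ (2 * l + 1) * (expo k * p ^ (l * l - k * k))"
    by (simp only: power_add mult_ac)
  also have "\<dots> \<le> p ^ (2 * l + 1) * expo l" using step by simp
  also have "\<dots> \<le> expo (Suc l)" using expo_mono[of l] by simp
  finally show ?case .
qed simp

text \<open>The difference y_l - y_k consists of the terms with index k+1 to l, and the first of
  them dominates since the exponents increase strictly.\<close>

lemma lim_appr_diff:
  assumes "k < l"
  shows "lim_appr i l - frob (l * l - k * k) (lim_appr i k) \<noteq> 0"
    "fdeg (lim_appr i l - frob (l * l - k * k) (lim_appr i k)) =
      - int (p ^ i * (expo (Suc k) * p ^ (l * l - Suc k * Suc k)))"
proof -
  have pow: "inverse (to_fract (hp i)) ^ n \<noteq> 0"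
    "fdeg (inverse (to_fract (hp i)) ^ n) = - int (p ^ i * n)" for n
    using hp_nonzero by (simp_all add: fdeg_power fdeg_inverse fdeg_to_fract_hp)
  have "lim_appr i l - frob (l * l - k * k) (lim_appr i k) \<noteq> 0 \<and>
    fdeg (lim_appr i l - frob (l * l - k * k) (lim_appr i k)) =
      - int (p ^ i * (expo (Suc k) * p ^ (l * l - Suc k * Suc k)))"
    using Suc_leI[OF assms]
  proof (induction l rule: dec_induct)
    case base
    have "Suc k * Suc k - k * k = 2 * k + 1" by simp
    hence eq: "lim_appr i (Suc k) - frob (Suc k * Suc k - k * k) (lim_appr i k) =
        inverse (to_fract (hp i)) ^ expo (Suc k)"
      by (simp only: lim_appr_Suc add_diff_cancel_left')
    show ?case unfolding eq using pow by (simp del: expo.simps mult_Suc mult_Suc_right)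
  next
    case (step l)
    let ?d = "lim_appr i l - frob (l * l - k * k) (lim_appr i k)"
    let ?e = "expo (Suc k) * p ^ (l * l - Suc k * Suc k)"
    have "k * k \<le> l * l" "Suc k * Suc k \<le> l * l"
      using step(1) mult_le_mono[of k l k l] mult_le_mono[of "Suc k" l "Suc k" l] by simp_all
    hence sq: "Suc l * Suc l - k * k = (2 * l + 1) + (l * l - k * k)"
      "Suc l * Suc l - Suc k * Suc k = (2 * l + 1) + (l * l - Suc k * Suc k)" by simp_all
    have d: "?d \<noteq> 0" "fdeg ?d = - int (p ^ i * ?e)" using step.IH by simp_all
    have eq: "lim_appr i (Suc l) - frob (Suc l * Suc l - k * k) (lim_appr i k) =
        frob (2 * l + 1) ?d + inverse (to_fract (hp i)) ^ expo (Suc l)"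
      by (simp only: sq lim_appr_Suc frob_simps frob_frob) simp
    have deg: "fdeg (frob (2 * l + 1) ?d) = - int (p ^ i * (p ^ (2 * l + 1) * ?e))"
      by (simp only: fdeg_fsubst[OF degree_pmon_pos d(1)] d(2) degree_pmon)
        (simp del: expo.simps mult_Suc mult_Suc_right add: mult_ac)
    have "p ^ (2 * l + 1) * ?e \<le> p ^ (2 * l + 1) * expo l"
      using expo_scale_mono[OF step(1)] by (intro mult_le_mono le_refl)
    also have "\<dots> < expo (Suc l)" by (rule expo_mono)
    finally have "p ^ i * (p ^ (2 * l + 1) * ?e) < p ^ i * expo (Suc l)"
      using p_pos by (simp only: mult_less_cancel1 zero_less_power)
    hence less: "- int (p ^ i * expo (Suc l)) < fdeg (frob (2 * l + 1) ?d)"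
      unfolding deg by (simp only: neg_less_iff_less of_nat_less_iff)
    have nz: "frob (2 * l + 1) ?d \<noteq> 0"
      using d by (simp only: fsubst_eq_0_iff[OF degree_pmon_pos] not_False_eq_True)
    have le: "fdeg_le (inverse (to_fract (hp i)) ^ expo (Suc l)) (- int (p ^ i * expo (Suc l)))"
      unfolding pow(2)[symmetric] by (rule fdeg_le_fdeg)
    show ?case unfolding eq using fdeg_add_small(1,2)[OF nz le less]
      unfolding deg sq by (simp only: power_add mult_ac not_False_eq_True simp_thms)
  qed
  thus "lim_appr i l - frob (l * l - k * k) (lim_appr i k) \<noteq> 0"
    "fdeg (lim_appr i l - frob (l * l - k * k) (lim_appr i k)) =
      - int (p ^ i * (expo (Suc k) * p ^ (l * l - Suc k * Suc k)))" by simp_all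
qed

end

section \<open>Nonvanishing at the partial sums and the valuation on polynomials in two
  variables\<close>

context char_p
begin

text \<open>Otherwise the distinct elements y_n, ..., y_N would all be roots of \<open>g\<close>,
  viewed as a polynomial in the second variable: more roots than its degree allows.\<close>

lemma phi_nonvanishing:
  assumes "g \<noteq> 0"
  shows "\<exists>k\<ge>n. phi i k g \<noteq> 0"
proof (rule ccontr)
  assume "\<not> ?thesis"
  hence zero: "phi i k g = 0" if "k \<ge> n" for k using that by blast
  \<comment> \<open>The interval from \<open>n\<close> to \<open>N\<close> has one more member than
    the degree of \<open>g\<close>. All y_k in it are rewritten as \<open>r k\<close> in the root
    belonging to level \<open>N\<close>, so that they lie in one field.\<close>
  define N where "N = n + Polynomial.degree g"
  define c where "c = (\<lambda>f :: 'k poly. to_fract (pcompose f (pmon (N * N))))"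
  define r where "r = (\<lambda>k. frob (N * N - k * k) (lim_appr i k))"
  have c0: "c f = 0 \<longleftrightarrow> f = 0" for f
    by (auto simp: c_def pcompose_eq_0_iff degree_pmon_pos)
  have c: "ring_morphism c" unfolding c_def by (rule pmon_morphism)
  have nz: "map_poly c g \<noteq> 0" using assms by (simp add: map_poly_eq_0_iff c0)
  have "poly (map_poly c g) (r k) = 0" if k: "k \<in> {n..N}" for k
  proof -
    have sq: "k * k + (N * N - k * k) = N * N" using k mult_le_mono[of k N k N] by simp
    let ?F = "\<lambda>h. frob (N * N - k * k) (eval_at (\<lambda>f. to_fract (pcompose f (pmon (k * k)))) (lim_appr i k) h)"
    have F: "ring_morphism ?F"
      by (rule ring_morphism_comp[OF frob_morphism ring_morphism_eval_at[OF pmon_morphism]])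
    have "?F [:f:] = eval_at c (r k) [:f:]" for f
      by (simp only: eval_at_const[OF pmon_morphism] eval_at_const[OF c])
        (simp only: c_def fsubst_to_fract[OF degree_pmon_pos] pmon_add sq flip: pcompose_assoc)
    moreover have "?F [:0, 1:] = eval_at c (r k) [:0, 1:]"
      by (simp only: eval_at_var[OF pmon_morphism] eval_at_var[OF c] r_def)
    ultimately have "?F g = eval_at c (r k) g"
      by (rule morphism_poly_eqI[OF F ring_morphism_eval_at[OF c]])
    moreover have "?F g = frob (N * N - k * k) (phi i k g)" by (simp only: phi_def)
    ultimately show ?thesis using zero[of k] k by (simp add: eval_at_def frob_simps)
  qed
  hence sub: "r ` {n..N} \<subseteq> {x. poly (map_poly c g) x = 0}" by blast
  have "r k \<noteq> r l" if kl: "k < l" "l \<le> N" for k l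
  proof -
    have "k * k \<le> l * l" "l * l \<le> N * N"
      using kl mult_le_mono[of k l k l] mult_le_mono[of l N l N] by simp_all
    hence "N * N - k * k = (N * N - l * l) + (l * l - k * k)" by simp
    hence "r l - r k = frob (N * N - l * l) (lim_appr i l - frob (l * l - k * k) (lim_appr i k))"
      by (simp only: r_def frob_simps frob_frob)
    moreover have "\<dots> \<noteq> 0"
      using lim_appr_diff(1)[OF kl(1), of i]
      by (simp only: fsubst_eq_0_iff[OF degree_pmon_pos] not_False_eq_True)
    ultimately show ?thesis by auto
  qed
  hence inj: "inj_on r {n..N}" by (intro linorder_inj_onI') auto
  have "card (r ` {n..N}) \<le> card {x. poly (map_poly c g) x = 0}"
    by (rule card_mono[OF poly_roots_finite[OF nz] sub])
  also have "\<dots> \<le> Polynomial.degree (map_poly c g)" by (rule card_poly_roots_bound[OF nz])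
  also have "\<dots> \<le> Polynomial.degree g" by (rule map_poly_degree_leq)
  finally show False using card_image[OF inj] by (simp add: N_def)
qed

text \<open>The degree of \<theta>_0 = x in the root \<open>U\<close> in use at level
  \<open>i\<close> and stage \<open>k\<close>. Dividing by it makes stages comparable and gives x
  the value -1 at every level.\<close>

definition wt :: "nat \<Rightarrow> nat \<Rightarrow> rat" where "wt i k = of_nat (p ^ i * scale k)"

lemma wt_pos: "wt i k > 0"
  using scale_pos[of k] p_pos by (simp add: wt_def)

lemma wt_Suc: "wt i (Suc k) = of_nat (p ^ (2 * k + 1)) * wt i k"
  by (simp only: wt_def scale_Suc of_nat_mult mult_ac)

lemma phi_eventually:
  assumes "g \<noteq> 0"
  shows "\<exists>c l. \<forall>\<^sub>F k in sequentially. phi i k g \<noteq> 0 \<and> flead (phi i k g) = l \<and>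
    rat_of_int (fdeg (phi i k g)) = - c * wt i k"
proof -
  obtain n where n: "bounded_poly n g" using ex_bounded_poly by blast
  obtain K where K: "K \<ge> n" "phi i K g \<noteq> 0" using phi_nonvanishing[OF assms] by blast
  define c where "c = - rat_of_int (fdeg (phi i K g)) / wt i K"
  have pos: "wt i k \<noteq> 0" for k using wt_pos[of i k] by simp
  have "phi i k g \<noteq> 0 \<and> flead (phi i k g) = flead (phi i K g) \<and>
      rat_of_int (fdeg (phi i k g)) = - c * wt i k" if "k \<ge> K" for k
    using that
  proof (induction k rule: dec_induct)
    case base
    show ?case using K pos[of K] by (simp add: c_def)
  next
    case (step k)
    have "n \<le> Suc k" using step K by simp
    note * = phi_stable[OF n this, of i]
    have "rat_of_int (fdeg (phi i (Suc k) g)) = of_nat (p ^ (2 * k + 1)) * rat_of_int (fdeg (phi i k g))"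
      using *(2) step.IH by simp
    also have "\<dots> = - c * wt i (Suc k)"
      using step.IH by (simp add: wt_Suc)
    finally show ?case using step.IH * by simp
  qed
  thus ?thesis unfolding eventually_sequentially by blast
qed

text \<open>The limit of the normalised degrees with reversed sign. \<open>phi_eventually\<close>
  gives existence, and \<open>pval_eqI\<close> shows that the choice is forced.\<close>

definition pval :: "nat \<Rightarrow> 'k poly poly \<Rightarrow> rat" where
  "pval i g = (SOME c. \<forall>\<^sub>F k in sequentially.
     phi i k g \<noteq> 0 \<and> rat_of_int (fdeg (phi i k g)) = - c * wt i k)"

lemma eventually_pval:
  assumes "g \<noteq> 0"
  shows "\<forall>\<^sub>F k in sequentially.
     phi i k g \<noteq> 0 \<and> rat_of_int (fdeg (phi i k g)) = - pval i g * wt i k"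
  unfolding pval_def
proof (rule someI_ex)
  from phi_eventually[OF assms, of i] obtain c l where "\<forall>\<^sub>F k in sequentially.
    phi i k g \<noteq> 0 \<and> flead (phi i k g) = l \<and>
    rat_of_int (fdeg (phi i k g)) = - c * wt i k" by blast
  thus "\<exists>c. \<forall>\<^sub>F k in sequentially.
     phi i k g \<noteq> 0 \<and> rat_of_int (fdeg (phi i k g)) = - c * wt i k"
    by (intro exI[of _ c]) (auto elim: eventually_mono)
qed

lemma pval_eqI:
  assumes "g \<noteq> 0" "\<forall>\<^sub>F k in sequentially. rat_of_int (fdeg (phi i k g)) = - c * wt i k"
  shows "pval i g = c"
proof -
  have "\<forall>\<^sub>F k in sequentially. pval i g = c"
    using eventually_conj[OF eventually_pval[OF assms(1), of i] assms(2)]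
  proof (rule eventually_mono)
    show "pval i g = c" if "(phi i k g \<noteq> 0 \<and>
        rat_of_int (fdeg (phi i k g)) = - pval i g * wt i k) \<and>
        rat_of_int (fdeg (phi i k g)) = - c * wt i k" for k
      using that wt_pos[of i k] by auto
  qed
  thus ?thesis by simp
qed

lemma pval_mult:
  assumes "f \<noteq> 0" "g \<noteq> 0" shows "pval i (f * g) = pval i f + pval i g"
proof (rule pval_eqI)
  show "\<forall>\<^sub>F k in sequentially. rat_of_int (fdeg (phi i k (f * g))) =
      - (pval i f + pval i g) * wt i k"
    using eventually_pval[OF assms(1), of i] eventually_pval[OF assms(2), of i]
    by eventually_elim (simp add: phi_simps fdeg_mult algebra_simps)
qed (use assms in simp)

lemma pval_add:
  assumes "f \<noteq> 0" "g \<noteq> 0" "f + g \<noteq> 0" shows "min (pval i f) (pval i g) \<le> pval i (f + g)"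
proof -
  have "\<forall>\<^sub>F k in sequentially. min (pval i f) (pval i g) \<le> pval i (f + g)"
    using eventually_pval[OF assms(1), of i] eventually_pval[OF assms(2), of i]
      eventually_pval[OF assms(3), of i]
  proof eventually_elim
    case (elim k)
    define s where "s = wt i k"
    have s: "s > 0" unfolding s_def by (rule wt_pos)
    define m where "m = max (fdeg (phi i k f)) (fdeg (phi i k g))"
    have "fdeg_le (phi i k f + phi i k g) m"
      by (intro fdeg_le_add) (simp_all add: fdeg_le_def m_def)
    hence "fdeg (phi i k (f + g)) \<le> m"
      using elim by (simp add: fdeg_le_def phi_simps)
    hence "rat_of_int (fdeg (phi i k (f + g))) \<le>
        max (rat_of_int (fdeg (phi i k f))) (rat_of_int (fdeg (phi i k g)))"
      by (simp add: m_def le_max_iff_disj)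
    hence "pval i f * s \<le> pval i (f + g) * s \<or> pval i g * s \<le> pval i (f + g) * s"
      using elim unfolding s_def by (auto simp: le_max_iff_disj)
    thus ?case using s by auto
  qed
  thus ?thesis by simp
qed

lemma phi_const: "phi i k [:[:c:]:] = to_fract [:c:]"
  by (simp add: phi_def eval_at_const[OF pmon_morphism])

lemma pval_const: "c \<noteq> 0 \<Longrightarrow> pval i [:[:c:]:] = 0"
  by (rule pval_eqI) (simp_all add: phi_const fdeg_to_fract)

text \<open>With equal values, the degrees of \<open>f\<close> and \<open>g\<close> agree at every
  late stage, and their leading coefficients no longer depend on the stage; one constant therefore
  cancels the leading terms at all late stages.\<close>

lemma pval_residue:
  assumes "f \<noteq> 0" "g \<noteq> 0" "pval i f = pval i g"
  shows "\<exists>c. c \<noteq> 0 \<and> (f - [:[:c:]:] * g = 0 \<or> pval i g < pval i (f - [:[:c:]:] * g))"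
proof -
  obtain a lf where f: "\<forall>\<^sub>F k in sequentially. phi i k f \<noteq> 0 \<and> flead (phi i k f) = lf \<and>
    rat_of_int (fdeg (phi i k f)) = - a * wt i k"
    using phi_eventually[OF assms(1)] by blast
  obtain b lg where g: "\<forall>\<^sub>F k in sequentially. phi i k g \<noteq> 0 \<and> flead (phi i k g) = lg \<and>
    rat_of_int (fdeg (phi i k g)) = - b * wt i k"
    using phi_eventually[OF assms(2)] by blast
  have "\<forall>\<^sub>F k in sequentially. lf \<noteq> 0 \<and> lg \<noteq> 0"
    using f g by eventually_elim (use flead_eq_0_iff in blast)
  hence l: "lf \<noteq> 0" "lg \<noteq> 0" by simp_all
  define c where "c = lf / lg"
  have c: "c \<noteq> 0" using l by (simp add: c_def)
  have "pval i g < pval i (f - [:[:c:]:] * g)" if nz: "f - [:[:c:]:] * g \<noteq> 0"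
  proof -
    have "\<forall>\<^sub>F k in sequentially. pval i g < pval i (f - [:[:c:]:] * g)"
      using f g eventually_pval[OF assms(1), of i] eventually_pval[OF assms(2), of i]
        eventually_pval[OF nz, of i]
    proof eventually_elim
      case (elim k)
      define s where "s = wt i k"
      have s: "s > 0" unfolding s_def by (rule wt_pos)
      have *: "phi i k (f - [:[:c:]:] * g) = phi i k f - to_fract [:c:] * phi i k g"
        by (simp only: phi_simps phi_const)
      have "rat_of_int (fdeg (phi i k f)) = rat_of_int (fdeg (phi i k g))"
        using elim assms(3) by simp
      hence deg: "fdeg (phi i k f) = fdeg (phi i k g)" by simp
      have "fdeg (to_fract [:c:] * phi i k g) = fdeg (phi i k f)"
        using elim c deg by (subst fdeg_mult) (simp_all add: fdeg_to_fract)
      moreover have "flead (to_fract [:c:] * phi i k g) = flead (phi i k f)"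
        using elim l by (simp add: flead_mult flead_to_fract c_def)
      ultimately have "fdeg_le (phi i k (f - [:[:c:]:] * g)) (fdeg (phi i k g) - 1)"
        using fdeg_le_diff_same_lead[of "phi i k f" "to_fract [:c:] * phi i k g"]
        unfolding * deg by simp
      hence "fdeg (phi i k (f - [:[:c:]:] * g)) < fdeg (phi i k g)"
        using elim by (simp add: fdeg_le_def)
      hence "rat_of_int (fdeg (phi i k (f - [:[:c:]:] * g))) < rat_of_int (fdeg (phi i k g))"
        by (simp only: of_int_less_iff)
      hence "pval i g * s < pval i (f - [:[:c:]:] * g) * s"
        using elim(3-5) unfolding s_def by simp
      thus ?case using s by simp
    qed
    thus ?thesis by simp
  qed
  thus ?thesis using c by blast
qed

text \<open>A single late stage suffices: the degree is an integer, and \<open>wt i k\<close> is the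
  power of p with exponent i + k * k.\<close>

lemma pval_denominator:
  assumes "g \<noteq> 0" shows "\<exists>m n. pval i g = of_int m / of_nat (p ^ n)"
proof -
  obtain k where k: "rat_of_int (fdeg (phi i k g)) = - pval i g * wt i k"
    using eventually_happens[OF eventually_pval[OF assms, of i]] by auto
  have "pval i g = of_int (- fdeg (phi i k g)) / of_nat (p ^ (i + k * k))"
  proof -
    have "wt i k = of_nat (p ^ (i + k * k))" by (simp add: wt_def scale_def power_add)
    thus ?thesis using k wt_pos[of i k] by (simp add: field_simps del: of_nat_power)
  qed
  thus ?thesis by blast
qed

lemma pval_var: "pval 0 [:[:0, 1:]:] = - 1"
proof (rule pval_eqI)
  have "phi 0 k [:[:0, 1:]:] = to_fract (pmon (k * k))" for k
    by (simp add: phi_def eval_at_const[OF pmon_morphism] pcompose_pCons)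
  moreover have "pmon m \<noteq> 0" for m using degree_pmon_pos[of m] by auto
  ultimately show "\<forall>\<^sub>F k in sequentially. rat_of_int (fdeg (phi 0 k [:[:0, 1:]:])) =
      - (- 1) * wt 0 k"
    by (simp add: fdeg_to_fract degree_pmon scale_def wt_def)
qed simp


end

lemma ring_morphism_map_poly:
  assumes h: "ring_morphism h" shows "ring_morphism (map_poly h)"
proof (rule ring_morphismI)
  note hs = morphism_simps[OF h] coeff_map_poly[of h, OF morphism_zero[OF h]]
  show "map_poly h 1 = 1" by (simp add: hs)
  show "map_poly h (x + y) = map_poly h x + map_poly h y" for x y
    by (rule poly_eqI) (simp add: hs)
  show "map_poly h (x * y) = map_poly h x * map_poly h y" for x y
    by (rule poly_eqI) (simp add: hs coeff_mult)
qed

section \<open>Rational-valued valuations on fields of fractions\<close>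

definition fract_val :: "('a::idom \<Rightarrow> rat) \<Rightarrow> 'a fract \<Rightarrow> rat" where
  "fract_val v q = v (numer q) - v (denom q)"

context
  fixes v :: "'a::idom \<Rightarrow> rat"
  assumes mult: "\<And>a b. a \<noteq> 0 \<Longrightarrow> b \<noteq> 0 \<Longrightarrow> v (a * b) = v a + v b"
    and add: "\<And>a b. a \<noteq> 0 \<Longrightarrow> b \<noteq> 0 \<Longrightarrow> a + b \<noteq> 0 \<Longrightarrow> min (v a) (v b) \<le> v (a + b)"
begin

lemma fract_val_Fract:
  assumes "a \<noteq> 0" "b \<noteq> 0" shows "fract_val v (Fract a b) = v a - v b"
proof -
  have n: "numer (Fract a b) \<noteq> 0" using assms by (simp add: numer_eq_0_iff Fract_conv_to_fract)
  have "v (numer (Fract a b)) + v b = v a + v (denom (Fract a b))"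
    using arg_cong[OF numer_denom_cross[OF assms(2), of a], of v] mult[OF n assms(2)]
      mult[OF assms(1) denom_nonzero[of "Fract a b"]] by linarith
  thus ?thesis by (simp add: fract_val_def)
qed

lemma fract_val_mult:
  assumes "q \<noteq> 0" "r \<noteq> 0" shows "fract_val v (q * r) = fract_val v q + fract_val v r"
proof -
  obtain a b where 1: "q = Fract a b" "a \<noteq> 0" "b \<noteq> 0" using assms by (blast elim: fract_nonzeroE)
  obtain c e where 2: "r = Fract c e" "c \<noteq> 0" "e \<noteq> 0" using assms by (blast elim: fract_nonzeroE)
  show ?thesis using 1 2 by (simp add: fract_val_Fract mult)
qed

lemma fract_val_add:
  assumes "q \<noteq> 0" "r \<noteq> 0" "q + r \<noteq> 0"
  shows "min (fract_val v q) (fract_val v r) \<le> fract_val v (q + r)"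
proof -
  obtain a c b where eq: "q = Fract a b" "r = Fract c b" "b \<noteq> 0" by (rule common_denominatorE)
  have sum: "q + r = Fract (a + c) b"
    using eq by (simp add: Fract_conv_to_fract add_divide_distrib)
  have "a \<noteq> 0" "c \<noteq> 0" "a + c \<noteq> 0"
    using assms unfolding sum unfolding eq by (auto simp: Fract_eq_0_iff eq(3))
  thus ?thesis unfolding sum unfolding eq using add[of a c]
    by (auto simp: fract_val_Fract eq(3) min_le_iff_disj)
qed

lemma fract_val_to_fract: "a \<noteq> 0 \<Longrightarrow> fract_val v (to_fract a) = v a"
  using mult[of 1 1] by (simp add: to_fract_def fract_val_Fract)

end


section \<open>Values with large p-power denominators\<close>

context char_p
begin

lemma expo_coprime: "coprime (expo (Suc k)) p"
proof -
  have "expo (Suc k) = 1 + p * (Suc k * (scale (Suc k) + p ^ (2 * k + 1) * expo k))"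
    by (simp only: expo.simps mult.assoc)
  thus ?thesis by (intro coprimeI) (metis dvd_add_left_iff dvd_mult2)
qed

text \<open>The element is x^n (y - y_j)^q with n = \<open>expo j\<close> and q =
  \<open>scale j\<close>. Its value is -n plus q times the exponent \<open>expo (Suc j)\<close> /
  \<open>scale (Suc j)\<close> of the first term missing in y_j.\<close>

lemma ex_pval_denominator:
  "\<exists>g. g \<noteq> 0 \<and> pval 0 g = of_nat (expo (Suc j)) / of_nat (p ^ (2 * j + 1)) - of_nat (expo j)"
proof -
  obtain f where f: "fvar ^ expo j * appr j = to_fract f" using fvar_expo_appr[of j] by blast
  define n where "n = expo j"
  \<comment> \<open>The q-th power of y_j is \<open>appr j\<close> with x itself as variable, so x^n
    clears its denominators and \<open>f\<close> is the resulting polynomial in x. Thus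
    \<open>g\<close> is a genuine polynomial in x and y.\<close>
  define g where "g = [:[:0, 1:] ^ n:] * [:0, 1:] ^ (p ^ (j * j)) - [:f:]"
  have deg: "phi 0 l g \<noteq> 0 \<and> fdeg (phi 0 l g) =
      int (p ^ (l * l) * n) - int (p ^ (j * j) * (expo (Suc j) * p ^ (l * l - Suc j * Suc j)))"
    if l: "j < l" for l
  proof -
    let ?d = "lim_appr 0 l - frob (l * l - j * j) (lim_appr 0 j)"
    have [simp]: "lim_appr 0 k = appr k" for k by (simp add: fsubst_var)
    have sq: "l * l = (l * l - j * j) + j * j" using l mult_le_mono[of j l j l] by simp
    have const: "phi 0 l [:a:] = frob (l * l) (to_fract a)" for a
      by (simp only: phi_def eval_at_const[OF pmon_morphism] fsubst_to_fract[OF degree_pmon_pos])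
    have "frob (l * l) (appr j) = frob (l * l - j * j) (frob (j * j) (appr j))"
      by (simp only: frob_frob flip: sq)
    also have "\<dots> = frob (l * l - j * j) (appr j) ^ (p ^ (j * j))"
      by (simp only: frob_simps flip: appr_frobenius)
    finally have fr: "frob (l * l) (appr j) = frob (l * l - j * j) (appr j) ^ (p ^ (j * j))" .
    have "phi 0 l g = frob (l * l) (fvar ^ n) * appr l ^ (p ^ (j * j)) - frob (l * l) (fvar ^ n * appr j)"
      unfolding g_def
      by (simp only: phi_simps const f[folded n_def, symmetric] to_fract_morphism)
        (simp add: phi_def eval_at_var[OF pmon_morphism] fsubst_var)
    also have "\<dots> = (fvar ^ (p ^ (l * l))) ^ n * ?d ^ (p ^ (j * j))"
      by (simp add: frob_simps frob_fvar fr fsubst_var frobenius_diff[OF CHAR_poly_fract] right_diff_distrib)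
    finally have eq: "phi 0 l g = (fvar ^ (p ^ (l * l))) ^ n * ?d ^ (p ^ (j * j))" .
    have d: "?d \<noteq> 0" "fdeg ?d = - int (p ^ 0 * (expo (Suc j) * p ^ (l * l - Suc j * Suc j)))"
      using lim_appr_diff[OF l, of 0] by blast+
    have 1: "(fvar ^ (p ^ (l * l))) ^ n \<noteq> 0" "fdeg ((fvar ^ (p ^ (l * l))) ^ n) = int (p ^ (l * l) * n)"
      by (simp_all add: fdeg_power fdeg_to_fract)
    have 2: "?d ^ (p ^ (j * j)) \<noteq> 0" "fdeg (?d ^ (p ^ (j * j))) =
        - int (p ^ (j * j) * (expo (Suc j) * p ^ (l * l - Suc j * Suc j)))"
      using d(1) by (simp, subst fdeg_power[OF d(1)]) (simp only: d(2), simp del: expo.simps)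
    show ?thesis unfolding eq using 1 2 by (simp only: fdeg_mult[OF 1(1) 2(1)]) simp
  qed
  have nz: "g \<noteq> 0" using deg[of "Suc j"] phi_simps(4) by auto
  moreover have "pval 0 g = of_nat (expo (Suc j)) / of_nat (p ^ (2 * j + 1)) - of_nat (expo j)"
  proof (rule pval_eqI[OF nz], unfold eventually_sequentially, intro exI[of _ "Suc j"] allI impI)
    fix l assume l: "Suc j \<le> l"
    have "l * l = (j * j + (l * l - Suc j * Suc j)) + (2 * j + 1)"
      using mult_le_mono[OF l l] by simp
    hence "wt 0 l = rat_of_nat (p ^ (j * j) * p ^ (l * l - Suc j * Suc j)) * of_nat (p ^ (2 * j + 1))"
      unfolding wt_def scale_def by (metis (no_types) mult_1 of_nat_mult power_0 power_add)
    hence eq: "rat_of_nat (p ^ (j * j) * p ^ (l * l - Suc j * Suc j)) = wt 0 l / of_nat (p ^ (2 * j + 1))"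
      using p_pos by simp
    have "rat_of_int (fdeg (phi 0 l g)) = wt 0 l * of_nat n -
        rat_of_nat (p ^ (j * j) * p ^ (l * l - Suc j * Suc j)) * of_nat (expo (Suc j))"
      using deg[of l] l by (simp add: wt_def scale_def del: expo.simps mult_Suc mult_Suc_right)
    thus "rat_of_int (fdeg (phi 0 l g)) =
        - (of_nat (expo (Suc j)) / of_nat (p ^ (2 * j + 1)) - of_nat (expo j)) * wt 0 l"
      unfolding eq n_def by (simp add: algebra_simps del: expo.simps)
  qed
  ultimately show ?thesis by blast
qed


subsection \<open>Substitution in the first variable\<close>

definition xsubst :: "'k poly \<Rightarrow> 'k poly poly \<Rightarrow> 'k poly poly" where
  "xsubst u = map_poly (\<lambda>f. pcompose f u)"

lemma pcompose_morphism: "ring_morphism (\<lambda>f. pcompose f u)" for u :: "'k poly"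
  by (rule ring_morphismI) (simp_all add: pcompose_1 pcompose_add pcompose_mult)

lemma ring_morphism_xsubst: "ring_morphism (xsubst u)"
  unfolding xsubst_def by (rule ring_morphism_map_poly[OF pcompose_morphism])

lemmas xsubst_simps = morphism_simps[OF ring_morphism_xsubst]

lemma coeff_xsubst: "coeff (xsubst u g) j = pcompose (coeff g j) u"
  by (simp add: xsubst_def coeff_map_poly)

lemma xsubst_const: "xsubst u [:f:] = [:pcompose f u:]"
  by (simp add: xsubst_def map_poly_pCons)

lemma xsubst_var: "xsubst u [:0, 1:] = [:0, 1:]"
  by (simp add: xsubst_def map_poly_pCons pcompose_1)

lemma xsubst_eq_0_iff: "Polynomial.degree u > 0 \<Longrightarrow> xsubst u g = 0 \<longleftrightarrow> g = 0"
  by (simp add: xsubst_def map_poly_eq_0_iff pcompose_eq_0_iff)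

lemma xsubst_xsubst: "xsubst u (xsubst w g) = xsubst (pcompose w u) g"
  by (rule poly_eqI) (simp add: coeff_xsubst pcompose_assoc)

text \<open>Both sides evaluate at \<theta>_i, once after writing it through \<theta>_(i+1). The
  same relation holds between the p-power roots because \<open>as_poly\<close> commutes with
  \<open>pmon\<close>.\<close>

lemma phi_xsubst_as_poly: "phi (Suc i) k (xsubst as_poly g) = fsubst as_poly (phi i k g)"
proof (rule morphism_poly_eqI)
  show "ring_morphism (\<lambda>g. phi (Suc i) k (xsubst as_poly g))"
    by (rule ring_morphism_comp[OF ring_morphism_phi ring_morphism_xsubst])
  show "ring_morphism (\<lambda>g. fsubst as_poly (phi i k g))"
    by (rule ring_morphism_comp[OF ring_morphism_fsubst[OF degree_as_poly_pos] ring_morphism_phi])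
  show "phi (Suc i) k (xsubst as_poly [:f:]) = fsubst as_poly (phi i k [:f:])" for f
    by (simp only: xsubst_const phi_def eval_at_const[OF pmon_morphism]
        fsubst_to_fract[OF degree_as_poly_pos] as_poly_pmon flip: pcompose_assoc)
  show "phi (Suc i) k (xsubst as_poly [:0, 1:]) = fsubst as_poly (phi i k [:0, 1:])"
    by (simp only: xsubst_var phi_def eval_at_var[OF pmon_morphism] hp.simps
        fsubst_fsubst[OF degree_hp_pos degree_as_poly_pos])
qed

text \<open>Translating \<theta>_(i+1) by 1 fixes \<theta>_i and hence y; on p-power roots it is
  again translation by 1. At level 0 the partial sums themselves would change, hence
  \<open>Suc i\<close>.\<close>

lemma phi_xsubst_shift: "phi (Suc i) k (xsubst [:1, 1:] g) = fsubst [:1, 1:] (phi (Suc i) k g)"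
proof (rule morphism_poly_eqI)
  have deg: "Polynomial.degree [:1, 1 :: 'k:] > 0" by simp
  show "ring_morphism (\<lambda>g. phi (Suc i) k (xsubst [:1, 1:] g))"
    by (rule ring_morphism_comp[OF ring_morphism_phi ring_morphism_xsubst])
  show "ring_morphism (\<lambda>g. fsubst [:1, 1:] (phi (Suc i) k g))"
    by (rule ring_morphism_comp[OF ring_morphism_fsubst[OF deg] ring_morphism_phi])
  have "pcompose [:1, 1:] (pmon m) = pcompose (pmon m) [:1, 1:]" for m
    by (simp add: pmon_shift pcompose_pCons)
  thus "phi (Suc i) k (xsubst [:1, 1:] [:f:]) = fsubst [:1, 1:] (phi (Suc i) k [:f:])" for f
    by (simp only: xsubst_const phi_def eval_at_const[OF pmon_morphism]
        fsubst_to_fract[OF deg] flip: pcompose_assoc)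
  show "phi (Suc i) k (xsubst [:1, 1:] [:0, 1:]) = fsubst [:1, 1:] (phi (Suc i) k [:0, 1:])"
    by (simp only: xsubst_var phi_def eval_at_var[OF pmon_morphism] hp.simps
        fsubst_fsubst[OF degree_hp_pos[of "Suc i", unfolded hp.simps] deg] as_poly_shift
        flip: pcompose_assoc)
qed

text \<open>The substitution multiplies degrees by p, and so does the passage from
  \<open>wt i\<close> to \<open>wt (Suc i)\<close>. This makes the valuations compatible along the
  tower.\<close>

lemma pval_xsubst_as_poly: assumes "g \<noteq> 0" shows "pval (Suc i) (xsubst as_poly g) = pval i g"
proof (rule pval_eqI)
  show "xsubst as_poly g \<noteq> 0" using assms by (simp add: xsubst_eq_0_iff degree_as_poly_pos)
  show "\<forall>\<^sub>F k in sequentially. rat_of_int (fdeg (phi (Suc i) k (xsubst as_poly g))) =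
      - pval i g * wt (Suc i) k"
    using eventually_pval[OF assms, of i]
  proof eventually_elim
    case (elim k)
    hence "fdeg (phi (Suc i) k (xsubst as_poly g)) = int p * fdeg (phi i k g)"
      by (simp add: phi_xsubst_as_poly fdeg_fsubst degree_as_poly p_pos)
    thus ?case using elim by (simp add: wt_def)
  qed
qed

lemma pval_xsubst_shift:
  assumes "g \<noteq> 0" shows "pval (Suc i) (xsubst [:1, 1:] g) = pval (Suc i) g"
proof (rule pval_eqI)
  show "xsubst [:1, 1:] g \<noteq> 0" using assms by (simp add: xsubst_eq_0_iff)
  show "\<forall>\<^sub>F k in sequentially. rat_of_int (fdeg (phi (Suc i) k (xsubst [:1, 1:] g))) =
      - pval (Suc i) g * wt (Suc i) k"
    using eventually_pval[OF assms, of "Suc i"]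
    by eventually_elim (simp add: phi_xsubst_shift fdeg_fsubst)
qed


subsection \<open>Invariants of the translation\<close>

lemma of_nat_frobenius: "of_nat j ^ p = (of_nat j :: 'k)"
proof (induction j)
  case (Suc j)
  thus ?case using frobenius_add[OF char_p, of "1" "of_nat j" 1] by simp
qed (use p_pos in simp)

lemma of_nat_inj: "inj_on (of_nat :: nat \<Rightarrow> 'k) {..<p}"
proof (rule linorder_inj_onI')
  fix i j assume "i \<in> {..<p}" "j \<in> {..<p}" "i < j"
  hence "\<not> p dvd j - i" by (auto dest: dvd_imp_le)
  hence "of_nat (j - i) \<noteq> (0 :: 'k)" by (simp add: of_nat_eq_0_iff_char_dvd char_p)
  thus "of_nat i \<noteq> (of_nat j :: 'k)" using \<open>i < j\<close> by (simp add: of_nat_diff)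
qed

text \<open>Invariance makes \<open>f - f(0)\<close> vanish on the prime field, which consists of
  roots of \<open>as_poly\<close>. The remainder modulo \<open>as_poly\<close> has degree below p
  but p roots, so it is zero; the quotient is again invariant and of smaller degree.\<close>

lemma shift_invariant_poly:
  fixes f :: "'k poly"
  assumes "pcompose f [:1, 1:] = f" shows "\<exists>g. f = pcompose g as_poly"
  using assms
proof (induction "Polynomial.degree f" arbitrary: f rule: less_induct)
  case less
  define h where "h = f - [:poly f 0:]"
  define q where "q = h div as_poly"
  define r where "r = h mod as_poly"
  have h: "h = as_poly * q + r" by (simp add: q_def r_def)
  have as_nz: "as_poly \<noteq> 0" using degree_as_poly_pos by auto
  have per: "poly f (x + 1) = poly f x" for x
    using arg_cong[OF less.prems, of "\<lambda>f. poly f x"] by (simp add: poly_pcompose add.commute)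
  have "poly f (of_nat j) = poly f 0" for j
    by (induction j) (simp_all add: per add.commute[of 1])
  moreover have "poly as_poly (of_nat j) = 0" for j
    by (simp add: as_poly_def poly_monom of_nat_frobenius)
  ultimately have "poly r (of_nat j) = 0" for j
    using arg_cong[OF h, of "\<lambda>f. poly f (of_nat j)"] by (simp add: h_def)
  hence sub: "of_nat ` {..<p} \<subseteq> {x. poly r x = 0}" by auto
  have "r = 0"
  proof (rule ccontr)
    assume r: "r \<noteq> 0"
    have "p = card (of_nat ` {..<p} :: 'k set)" using card_image[OF of_nat_inj] by simp
    also have "\<dots> \<le> card {x. poly r x = 0}" by (rule card_mono[OF poly_roots_finite[OF r] sub])
    also have "\<dots> \<le> Polynomial.degree r" by (rule card_poly_roots_bound[OF r])
    also have "\<dots> < p"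
      using degree_mod_less'[OF as_nz, of h] r p_pos by (auto simp: r_def degree_as_poly)
    finally show False by simp
  qed
  hence h: "h = as_poly * q" using h by simp
  show ?case
  proof (cases "q = 0")
    case True
    hence "f = [:poly f 0:]" using h by (simp add: h_def)
    hence "f = pcompose [:poly f 0:] as_poly" by (metis pcompose_const)
    thus ?thesis by blast
  next
    case False
    have "pcompose h [:1, 1:] = h" using less.prems by (simp add: h_def pcompose_diff)
    hence "as_poly * pcompose q [:1, 1:] = as_poly * q"
      unfolding h by (simp add: pcompose_mult as_poly_shift)
    hence "pcompose q [:1, 1:] = q" using as_nz by simp
    moreover have "Polynomial.degree h \<le> Polynomial.degree f"
      unfolding h_def by (rule degree_diff_le) simp_all
    hence "Polynomial.degree q < Polynomial.degree f"
      using False as_nz degree_as_poly_pos by (simp add: h degree_mult_eq)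
    ultimately obtain g where "q = pcompose g as_poly" using less.hyps by blast
    hence "f = pcompose ([:poly f 0:] + [:0, 1:] * g) as_poly"
      using h by (simp add: h_def pcompose_add pcompose_mult pcompose_pCons algebra_simps)
    thus ?thesis by blast
  qed
qed

lemma shift_invariant_poly2:
  assumes "xsubst [:1, 1:] g = g" shows "\<exists>f. g = xsubst as_poly f"
proof -
  have "pcompose (coeff g j) [:1, 1:] = coeff g j" for j
    using assms coeff_xsubst by metis
  hence "\<exists>f. coeff g j = pcompose f as_poly" for j by (rule shift_invariant_poly)
  then obtain F where F: "\<And>j. coeff g j = pcompose (F j) as_poly" by metis
  have "g = xsubst as_poly (\<Sum>j\<le>Polynomial.degree g. monom (F j) j)"
  proof (rule poly_eqI)
    fix n
    have "(\<Sum>j\<le>Polynomial.degree g. coeff (monom (F j) j) n) =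
        (if n \<le> Polynomial.degree g then F n else 0)"
      by (simp add: if_distrib cong: if_cong)
    thus "coeff g n = coeff (xsubst as_poly (\<Sum>j\<le>Polynomial.degree g. monom (F j) j)) n"
      by (simp add: coeff_xsubst coeff_sum flip: F) (simp add: coeff_eq_0)
  qed
  thus ?thesis by blast
qed

lemma xsubst_shift_power: "(xsubst [:1, 1:] ^^ j) g = xsubst [:of_nat j, 1:] g"
proof (induction j)
  case 0
  show ?case by (rule poly_eqI) (simp add: coeff_xsubst)
next
  case (Suc j)
  have "pcompose [:of_nat j, 1:] [:1, 1:] = [:of_nat (Suc j), 1 :: 'k:]"
    by (simp add: pcompose_pCons add.commute)
  thus ?case by (simp add: Suc xsubst_xsubst)
qed

text \<open>The multiple is the norm, the product of the p translates of \<open>b\<close>. It allows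
  denominators to be made invariant.\<close>

lemma ex_invariant_multiple:
  assumes "b \<noteq> 0" shows "\<exists>c e. e \<noteq> 0 \<and> b * c = xsubst as_poly e"
proof -
  define s where "s = (\<lambda>j :: nat. (xsubst [:1, 1:] ^^ j) b)"
  define B where "B = (\<Prod>j<p. s j)"
  have s0: "s 0 = b" and sp: "s p = b"
    using char_p of_nat_CHAR[where 'a = 'k] xsubst_shift_power[of 0 b]
    by (simp_all add: s_def xsubst_shift_power)
  have "xsubst [:1, 1:] B = (\<Prod>j<p. s (Suc j))" by (simp add: B_def s_def xsubst_simps)
  \<comment> \<open>The translation permutes the factors cyclically: \<open>s p\<close> equals
    \<open>s 0\<close>, and this factor cancels.\<close>
  moreover have "s 0 * (\<Prod>j<p. s (Suc j)) = (\<Prod>j<p. s j) * s p"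
    by (metis prod.lessThan_Suc prod.lessThan_Suc_shift)
  hence "(\<Prod>j<p. s (Suc j)) = B" using assms by (simp add: s0 sp B_def)
  ultimately obtain e where e: "B = xsubst as_poly e" using shift_invariant_poly2 by metis
  have "s j \<noteq> 0" for j by (simp add: s_def xsubst_shift_power xsubst_eq_0_iff assms)
  hence "B \<noteq> 0" by (simp add: B_def)
  hence "e \<noteq> 0" using e by (auto simp: xsubst_simps)
  moreover have "B = b * (\<Prod>j\<in>{..<p} - {0}. s j)"
    unfolding B_def using p_pos by (subst prod.remove[of _ 0]) (simp_all add: s0)
  ultimately show ?thesis using e by metis
qed


subsection \<open>The valuations on the rational function field in two variables\<close>

definition fval :: "nat \<Rightarrow> 'k ratfun2 \<Rightarrow> rat" where "fval i = fract_val (pval i)"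

lemma fval_Fract: "a \<noteq> 0 \<Longrightarrow> b \<noteq> 0 \<Longrightarrow> fval i (Fract a b) = pval i a - pval i b"
  unfolding fval_def by (rule fract_val_Fract[OF pval_mult pval_add])

lemma fval_mult: "q \<noteq> 0 \<Longrightarrow> r \<noteq> 0 \<Longrightarrow> fval i (q * r) = fval i q + fval i r"
  unfolding fval_def by (rule fract_val_mult[OF pval_mult pval_add])

lemma fval_add:
  "q \<noteq> 0 \<Longrightarrow> r \<noteq> 0 \<Longrightarrow> q + r \<noteq> 0 \<Longrightarrow> min (fval i q) (fval i r) \<le> fval i (q + r)"
  unfolding fval_def by (rule fract_val_add[OF pval_mult pval_add])

lemma fval_to_fract: "a \<noteq> 0 \<Longrightarrow> fval i (to_fract a) = pval i a"
  unfolding fval_def by (rule fract_val_to_fract[OF pval_mult pval_add])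

lemma fval_one: "fval i 1 = 0"
  using fval_mult[of 1 1 i] by simp

lemma fval_inverse: "q \<noteq> 0 \<Longrightarrow> fval i (inverse q) = - fval i q"
  using fval_mult[of q "inverse q" i] by (simp add: fval_one)

lemma const_ratfun2_altdef: "const_ratfun2 c = to_fract [:[:c:]:]"
  by (simp add: const_ratfun2_def to_fract_def)

lemma fval_const: "c \<noteq> 0 \<Longrightarrow> fval i (const_ratfun2 c) = 0"
  by (simp add: const_ratfun2_altdef fval_to_fract pval_const)

lemma fval_residue:
  assumes "q \<noteq> 0" "fval i q = 0"
  shows "\<exists>c. c \<noteq> 0 \<and> (q - const_ratfun2 c = 0 \<or> 0 < fval i (q - const_ratfun2 c))"
proof -
  obtain f g where q: "q = Fract f g" "f \<noteq> 0" "g \<noteq> 0" using assms by (blast elim: fract_nonzeroE)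
  hence "pval i f = pval i g" using assms(2) by (simp add: fval_Fract)
  then obtain c where c: "c \<noteq> 0"
    "f - [:[:c:]:] * g = 0 \<or> pval i g < pval i (f - [:[:c:]:] * g)"
    using pval_residue[OF q(2,3)] by blast
  have eq: "q - const_ratfun2 c = Fract (f - [:[:c:]:] * g) g"
    using q by (simp add: const_ratfun2_def)
  show ?thesis
  proof (intro exI[of _ c] conjI c(1))
    show "q - const_ratfun2 c = 0 \<or> 0 < fval i (q - const_ratfun2 c)"
      using c(2) q(3) unfolding eq
      by (cases "f - [:[:c:]:] * g = 0") (auto simp: fval_Fract Fract_eq_0_iff)
  qed
qed

lemma fval_denominator:
  assumes "q \<noteq> 0" shows "\<exists>m n. fval i q = of_int m / of_nat (p ^ n)"
proof -
  obtain f g where q: "q = Fract f g" "f \<noteq> 0" "g \<noteq> 0" using assms by (blast elim: fract_nonzeroE)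
  obtain m n where f: "pval i f = of_int m / of_nat (p ^ n)" using pval_denominator[OF q(2)] by blast
  obtain k l where g: "pval i g = of_int k / of_nat (p ^ l)" using pval_denominator[OF q(3)] by blast
  have "fval i q = of_int (m * int (p ^ l) - k * int (p ^ n)) / of_nat (p ^ (n + l))"
    using q f g p_pos by (simp add: fval_Fract power_add diff_frac_eq)
  thus ?thesis by blast
qed

text \<open>The values form a group containing 1 = -v(x) and some E/D with D a power of p and E
  prime to p. By Bezout it contains 1/D, and D can be made arbitrarily large.\<close>

lemma fval_0_surj: "\<exists>q. q \<noteq> 0 \<and> fval 0 q = of_int m / of_nat (p ^ n)"
proof -
  define S where "S = fval 0 ` {q. q \<noteq> 0}"
  have mem: "fval 0 q \<in> S" if "q \<noteq> 0" for q using that by (simp add: S_def)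
  have add: "a + b \<in> S" if ab: "a \<in> S" "b \<in> S" for a b
  proof -
    obtain q r where "a = fval 0 q" "q \<noteq> 0" "b = fval 0 r" "r \<noteq> 0" using ab by (auto simp: S_def)
    thus ?thesis using mem[of "q * r"] by (simp add: fval_mult)
  qed
  have minus: "- a \<in> S" if a: "a \<in> S" for a
  proof -
    obtain q where "a = fval 0 q" "q \<noteq> 0" using a by (auto simp: S_def)
    thus ?thesis using mem[of "inverse q"] by (simp add: fval_inverse)
  qed
  have zero: "0 \<in> S" using mem[of 1] by (simp add: fval_one)
  have nat: "of_nat k * a \<in> S" if "a \<in> S" for a k
    by (induction k) (simp_all add: zero add that distrib_right)
  have int: "of_int k * a \<in> S" if "a \<in> S" for a k
    using nat[OF that] minus[OF nat[OF that]] by (cases k rule: int_cases2) auto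
  have one: "1 \<in> S"
    using minus[OF mem[of "to_fract [:[:0, 1:]:]"]] by (simp add: fval_to_fract pval_var)
  define E D where "E = expo (Suc n)" and "D = p ^ (2 * n + 1)"
  have D: "D > 0" using p_pos by (simp add: D_def)
  obtain g where g: "g \<noteq> 0" "pval 0 g = of_nat E / of_nat D - of_nat (expo n)"
    using ex_pval_denominator[of n] unfolding E_def D_def by blast
  have "of_nat E / of_nat D - of_nat (expo n) \<in> S"
    using mem[of "to_fract g"] g(1) unfolding g(2)[symmetric] by (simp add: fval_to_fract)
  from add[OF this nat[OF one, of "expo n"]]
  have e: "of_nat E / of_nat D \<in> S" by simp
  have "coprime (int E) (int D)"
    using expo_coprime[of n] unfolding E_def D_def
    by (simp only: coprime_int_iff coprime_power_right_iff simp_thms)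
  then obtain x y where "x * int E + y * int D = 1"
    using bezout_int[of "int E" "int D"] by auto
  hence "rat_of_int (x * int E + y * int D) = 1" by simp
  hence "of_int x * rat_of_nat E + of_int y * rat_of_nat D = 1" by simp
  hence "of_int x * (of_nat E / of_nat D) + of_int y * 1 = (1 / of_nat D :: rat)"
    using D by (simp add: field_simps)
  hence "1 / of_nat D \<in> S"
    using add[OF int[OF e, of x] int[OF one, of y]] by simp
  \<comment> \<open>The multiplier is chosen because D = p^(2n+1) factors as p^(n+1) times
    p^n.\<close>
  from int[OF this, of "m * int (p ^ (n + 1))"]
  have "of_int (m * int (p ^ (n + 1))) * (1 / of_nat D) \<in> S" .
  moreover have "2 * n + 1 = (n + 1) + n" by simp
  hence "D = p ^ (n + 1) * p ^ n" unfolding D_def by (simp only: power_add)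
  hence "of_int (m * int (p ^ (n + 1))) * (1 / of_nat D) = (of_int m / of_nat (p ^ n) :: rat)"
    using p_pos by simp
  ultimately have "of_int m / of_nat (p ^ n) \<in> S" by (simp only:)
  thus ?thesis unfolding S_def by auto
qed


subsection \<open>The Artin--Schreier endomorphism and the translation\<close>

definition xs :: "'k poly \<Rightarrow> 'k ratfun2 \<Rightarrow> 'k ratfun2" where
  "xs u = fract_lift (\<lambda>g. to_fract (xsubst u g))"

abbreviation "alpha \<equiv> xs as_poly"
abbreviation "sigma \<equiv> xs [:1, 1:]"

context
  fixes u :: "'k poly"
  assumes u: "Polynomial.degree u > 0"
begin

lemma ring_morphism_to_fract_xsubst: "ring_morphism (\<lambda>g. to_fract (xsubst u g))"
  by (rule ring_morphism_comp[OF ring_morphism_to_fract ring_morphism_xsubst])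

lemma to_fract_xsubst_eq_0: "to_fract (xsubst u g) = 0 \<Longrightarrow> g = 0"
  using u by (simp add: xsubst_eq_0_iff)

lemma ring_morphism_xs: "ring_morphism (xs u)"
  unfolding xs_def by (rule ring_morphism_fract_lift[OF ring_morphism_to_fract_xsubst to_fract_xsubst_eq_0])

lemma xs_to_fract: "xs u (to_fract g) = to_fract (xsubst u g)"
  unfolding xs_def by (rule fract_lift_to_fract[OF ring_morphism_to_fract_xsubst to_fract_xsubst_eq_0])

lemma xs_Fract: "b \<noteq> 0 \<Longrightarrow> xs u (Fract a b) = Fract (xsubst u a) (xsubst u b)"
  unfolding xs_def
  by (subst fract_lift_Fract[OF ring_morphism_to_fract_xsubst to_fract_xsubst_eq_0])
    (simp_all add: Fract_conv_to_fract)

lemma fval_xs: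
  assumes "q \<noteq> 0" and v: "\<And>g. g \<noteq> 0 \<Longrightarrow> pval j (xsubst u g) = pval i g"
  shows "fval j (xs u q) = fval i q"
proof -
  obtain a b where q: "q = Fract a b" "a \<noteq> 0" "b \<noteq> 0" using assms by (blast elim: fract_nonzeroE)
  moreover have "xsubst u a \<noteq> 0" "xsubst u b \<noteq> 0" using q u by (simp_all add: xsubst_eq_0_iff)
  ultimately show ?thesis using v by (simp add: xs_Fract fval_Fract)
qed

end

lemmas ring_morphism_alpha = ring_morphism_xs[OF degree_as_poly_pos]

lemma ring_morphism_sigma: "ring_morphism sigma"
  by (rule ring_morphism_xs) simp

lemma fval_alpha: "q \<noteq> 0 \<Longrightarrow> fval (Suc i) (alpha q) = fval i q"
  by (rule fval_xs[OF degree_as_poly_pos]) (simp_all add: pval_xsubst_as_poly)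

lemma fval_sigma: "q \<noteq> 0 \<Longrightarrow> fval (Suc i) (sigma q) = fval (Suc i) q"
  by (rule fval_xs) (simp_all add: pval_xsubst_shift)

lemma sigma_power: "(sigma ^^ j) q = xs [:of_nat j, 1:] q"
proof (rule morphism_fract_eqI[where f = "sigma ^^ j"])
  show "ring_morphism (sigma ^^ j)"
    by (induction j) (simp_all add: ring_morphism_def morphism_simps[OF ring_morphism_sigma])
  show "ring_morphism (xs [:of_nat j, 1:])" by (rule ring_morphism_xs) simp
  fix g
  have "(sigma ^^ j) (to_fract g) = to_fract ((xsubst [:1, 1:] ^^ j) g)"
    by (induction j) (simp_all add: xs_to_fract)
  thus "(sigma ^^ j) (to_fract g) = xs [:of_nat j, 1:] (to_fract g)"
    by (simp add: xs_to_fract xsubst_shift_power)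
qed

lemma sigma_power_p: "(sigma ^^ p) q = q"
proof -
  have "(sigma ^^ p) q = (sigma ^^ 0) q"
    unfolding sigma_power using of_nat_CHAR[where 'a = 'k] char_p by simp
  thus ?thesis by simp
qed

lemma sigma_var: "sigma (to_fract [:[:0, 1:]:]) = to_fract [:[:0, 1:]:] + 1"
proof -
  have "xsubst [:1, 1:] [:[:0, 1:]:] = [:[:0, 1:]:] + 1"
    by (simp add: xsubst_const pcompose_pCons one_pCons)
  thus ?thesis by (simp add: xs_to_fract)
qed

lemma sigma_alpha: "sigma (alpha q) = alpha q"
proof (rule morphism_fract_eqI[where f = "\<lambda>q. sigma (alpha q)"])
  show "ring_morphism (\<lambda>q. sigma (alpha q))"
    by (rule ring_morphism_comp[OF ring_morphism_sigma ring_morphism_alpha])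
  show "sigma (alpha (to_fract g)) = alpha (to_fract g)" for g
    by (simp add: xs_to_fract degree_as_poly p_pos xsubst_xsubst as_poly_shift)
qed (rule ring_morphism_alpha)

text \<open>Once the denominator is replaced by an invariant multiple, the numerator of a fixed
  fraction is invariant too, and invariant polynomials are known from
  \<open>shift_invariant_poly2\<close>.\<close>

lemma fixed_sigma: "{q. sigma q = q} = range alpha"
proof (intro equalityI subsetI)
  fix q assume "q \<in> {q. sigma q = q}"
  hence fixed: "sigma q = q" by simp
  obtain a b where q: "q = Fract a b" "b \<noteq> 0" by (cases q)
  obtain c e where e: "e \<noteq> 0" "b * c = xsubst as_poly e" using ex_invariant_multiple[OF q(2)] by blast
  have e': "to_fract (xsubst as_poly e) = alpha (to_fract e)" "xsubst as_poly e \<noteq> 0"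
    using e(1) by (simp_all add: xs_to_fract degree_as_poly p_pos xsubst_eq_0_iff)
  have nz: "alpha (to_fract e) \<noteq> 0"
    using to_fract_eq_0_iff[of "xsubst as_poly e"] e' by simp
  have "c \<noteq> 0" using e e'(2) by auto
  hence "q = to_fract (a * c) / to_fract (b * c)"
    using q by (simp add: Fract_conv_to_fract)
  hence ac: "to_fract (a * c) = q * alpha (to_fract e)"
    using e(2) e'(1) nz by (simp del: to_fract_mult)
  hence "sigma (to_fract (a * c)) = to_fract (a * c)"
    by (simp only: morphism_mult[OF ring_morphism_sigma] sigma_alpha fixed)
  hence "xsubst [:1, 1:] (a * c) = a * c" by (simp add: xs_to_fract del: to_fract_mult)
  then obtain f where "a * c = xsubst as_poly f" using shift_invariant_poly2 by blast
  hence "q * alpha (to_fract e) = alpha (to_fract f)"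
    using ac by (simp add: xs_to_fract degree_as_poly p_pos del: to_fract_mult)
  hence "q = alpha (to_fract f / to_fract e)"
    using nz by (simp add: field_morphism_divide[OF ring_morphism_alpha] eq_divide_eq)
  thus "q \<in> range alpha" by blast
qed (auto simp: sigma_alpha)

text \<open>Produces the next field of the tower inside an algebraically closed field: constants and
  y keep their images, and x goes to an Artin--Schreier root \<open>th\<close> of its old
  image.\<close>

lemma ex_alpha_lift:
  fixes psi :: "'k ratfun2 \<Rightarrow> 'b::alg_closed_field"
  assumes psi: "ring_morphism psi"
  shows "\<exists>psi'. ring_morphism psi' \<and> (\<forall>q. psi' (alpha q) = psi q)"
proof -
  define c where "c = (\<lambda>a :: 'k. psi (to_fract [:[:a:]:]))"
  define t where "t = psi (to_fract [:[:0, 1:]:])"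
  note ps = morphism_simps[OF psi]
  have const: "ring_morphism (\<lambda>a :: 'k. to_fract [:[:a:]:])"
    by (rule ring_morphismI) (simp_all flip: to_fract_add to_fract_mult to_fract_1 add: one_pCons)
  have c: "ring_morphism c" unfolding c_def by (rule ring_morphism_comp[OF psi const])
  \<comment> \<open>This is T^p - T - t; its degree must be positive for a root to exist.\<close>
  have "Polynomial.degree (monom 1 p + - [:t, 1:]) = Polynomial.degree (monom (1 :: 'b) p)"
    using p_gt_1 by (intro degree_add_eq_left) (simp add: degree_monom_eq)
  hence "Polynomial.degree (monom 1 p + - [:t, 1:]) > 0"
    using p_pos by (simp add: degree_monom_eq)
  then obtain th where "poly (monom 1 p + - [:t, 1:]) th = 0"
    using alg_closed_imp_poly_has_root by blast
  hence th: "th ^ p - th = t" by (simp add: poly_monom algebra_simps)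
  define e1 where "e1 = eval_at c th"
  have e1: "ring_morphism e1" unfolding e1_def by (rule ring_morphism_eval_at[OF c])
  define e2 where "e2 = eval_at e1 (psi (to_fract [:0, 1:]))"
  have e2: "ring_morphism e2" unfolding e2_def by (rule ring_morphism_eval_at[OF e1])
  have psi_poly: "ring_morphism (\<lambda>g. psi (to_fract g))"
    by (rule ring_morphism_comp[OF psi ring_morphism_to_fract])
  have pC: "ring_morphism (\<lambda>f :: 'k poly. [:f:])"
    by (rule ring_morphismI) (simp_all add: one_pCons)
  have inner: "e1 (pcompose f as_poly) = psi (to_fract [:f:])" for f
  proof (rule morphism_poly_eqI[where f = "\<lambda>f. e1 (pcompose f as_poly)" and g = "\<lambda>f. psi (to_fract [:f:])"])
    show "ring_morphism (\<lambda>f. e1 (pcompose f as_poly))"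
      by (rule ring_morphism_comp[OF e1 pcompose_morphism])
    show "ring_morphism (\<lambda>f. psi (to_fract [:f:]))"
      by (rule ring_morphism_comp[OF psi_poly pC])
    show "e1 (pcompose [:a:] as_poly) = psi (to_fract [:[:a:]:])" for a
      by (simp add: e1_def eval_at_const[OF c]) (simp add: c_def)
    have "as_poly = [:0, 1:] ^ p - [:0, 1:]" by (simp add: as_poly_def monom_altdef)
    hence "e1 as_poly = th ^ p - th"
      by (simp only: morphism_simps[OF e1]) (simp only: e1_def eval_at_var[OF c])
    thus "e1 (pcompose [:0, 1:] as_poly) = psi (to_fract [:[:0, 1:]:])"
      using th by (simp add: pcompose_pCons t_def)
  qed
  have outer: "e2 (xsubst as_poly g) = psi (to_fract g)" for g
  proof (rule morphism_poly_eqI[where f = "\<lambda>g. e2 (xsubst as_poly g)" and g = "\<lambda>g. psi (to_fract g)"])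
    show "ring_morphism (\<lambda>g. e2 (xsubst as_poly g))"
      by (rule ring_morphism_comp[OF e2 ring_morphism_xsubst])
    show "e2 (xsubst as_poly [:f:]) = psi (to_fract [:f:])" for f
      by (simp only: xsubst_const e2_def eval_at_const[OF e1] inner)
    show "e2 (xsubst as_poly [:0, 1:]) = psi (to_fract [:0, 1:])"
      by (simp only: xsubst_var e2_def eval_at_var[OF e1])
  qed (rule psi_poly)
  \<comment> \<open>Needed to extend \<open>e2\<close> to fractions: a zero \<open>b\<close> of
    \<open>e2\<close> divides some \<open>xsubst as_poly e\<close>, on which \<open>e2\<close>
    agrees with the injective \<open>psi\<close>.\<close>
  have inj: "b = 0" if "e2 b = 0" for b
  proof (rule ccontr)
    assume "b \<noteq> 0"
    then obtain d e where e: "e \<noteq> 0" "b * d = xsubst as_poly e" using ex_invariant_multiple by blast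
    have "psi (to_fract e) = e2 (b * d)" by (simp only: e(2) outer)
    also have "\<dots> = e2 b * e2 d" by (rule morphism_mult[OF e2])
    finally have "psi (to_fract e) = e2 b * e2 d" .
    hence "psi (to_fract e) = 0" using that by simp
    thus False using e(1) by (simp add: field_morphism_eq_0_iff[OF psi])
  qed
  show ?thesis
  proof (intro exI[of _ "fract_lift e2"] conjI allI)
    show lift: "ring_morphism (fract_lift e2)" by (rule ring_morphism_fract_lift[OF e2 inj])
    show "fract_lift e2 (alpha q) = psi q" for q
    proof (rule morphism_fract_eqI[where f = "\<lambda>q. fract_lift e2 (alpha q)"])
      show "ring_morphism (\<lambda>q. fract_lift e2 (alpha q))"
        by (rule ring_morphism_comp[OF lift ring_morphism_alpha])
      show "fract_lift e2 (alpha (to_fract g)) = psi (to_fract g)" for g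
        by (simp only: xs_to_fract[OF degree_as_poly_pos] fract_lift_to_fract[OF e2 inj] outer)
    qed (rule psi)
  qed
qed

end

section \<open>Artin--Schreier extensions\<close>

lemma poly_eq_0_of_roots:
  fixes q :: "'a::field poly"
  assumes "\<And>j. j \<ge> card S \<Longrightarrow> coeff q j = 0" "finite S" "\<And>s. s \<in> S \<Longrightarrow> poly q s = 0"
  shows "q = 0"
proof (rule ccontr)
  assume q: "q \<noteq> 0"
  have "card S \<le> card {s. poly q s = 0}"
    by (rule card_mono[OF poly_roots_finite[OF q]]) (use assms in auto)
  also have "\<dots> \<le> Polynomial.degree q" by (rule card_poly_roots_bound[OF q])
  finally have "Polynomial.lead_coeff q = 0" by (rule assms(1))
  thus False using q by simp
qed

text \<open>Newton's scheme: a new node is served by adding a multiple of the polynomial that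
  vanishes at the old ones.\<close>

lemma ex_interpolation:
  fixes f :: "'a::field \<Rightarrow> 'a"
  assumes "finite S"
  shows "\<exists>q. (\<forall>j\<ge>card S. coeff q j = 0) \<and> (\<forall>s\<in>S. poly q s = f s)"
  using assms
proof (induction S)
  case (insert x S)
  then obtain q where q: "\<forall>j\<ge>card S. coeff q j = 0" "\<forall>s\<in>S. poly q s = f s" by blast
  define r where "r = (\<Prod>s\<in>S. [:- s, 1:])"
  have x: "poly r x \<noteq> 0" using insert by (simp add: r_def poly_prod)
  have "Polynomial.degree r = card S"
    unfolding r_def by (subst degree_prod_eq_sum_degree) simp_all
  hence "coeff r j = 0" if "j \<ge> card (insert x S)" for j
    using that insert by (intro coeff_eq_0) simp
  moreover have "poly r s = 0" if "s \<in> S" for s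
    using that insert.hyps by (auto simp: r_def poly_prod)
  ultimately show ?case using insert q x
    by (intro exI[of _ "q + smult ((f x - poly q x) / poly r x) r"]) auto
qed (intro exI[of _ 0], simp)

locale translation =
  fixes \<sigma> :: "'e::field \<Rightarrow> 'e" and x :: 'e and p :: nat
  assumes \<sigma>: "ring_morphism \<sigma>" and \<sigma>_power_p: "\<And>q. (\<sigma> ^^ p) q = q" and \<sigma>_x: "\<sigma> x = x + 1"
    and CHAR: "CHAR('e) = p" and p_pos: "p > 0"
begin

abbreviation Fix :: "'e set" where "Fix \<equiv> {q. \<sigma> q = q}"

text \<open>Polynomials over the fixed field of degree below \<open>n\<close>. Bounding coefficients
  instead of \<open>degree\<close> leaves only the zero polynomial for n = 0.\<close>

definition low_poly :: "nat \<Rightarrow> 'e poly \<Rightarrow> bool" where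
  "low_poly n q \<longleftrightarrow> (\<forall>j. coeff q j \<in> Fix) \<and> (\<forall>j\<ge>n. coeff q j = 0)"

lemma \<sigma>_power: "ring_morphism (\<sigma> ^^ j)"
  by (induction j) (simp_all add: ring_morphism_def morphism_simps[OF \<sigma>])

lemma \<sigma>_power_x: "(\<sigma> ^^ j) x = x + of_nat j"
  by (induction j) (simp_all add: \<sigma>_x morphism_simps[OF \<sigma>] add_ac)

lemma \<sigma>_power_fix: "q \<in> Fix \<Longrightarrow> (\<sigma> ^^ j) q = q"
  by (induction j) simp_all

lemma prime_p: "Factorial_Ring.prime p"
  using prime_CHAR_semidom[where 'a = 'e] CHAR p_pos by simp

lemma inj_nodes: "inj_on (\<lambda>j. x + of_nat j) {..<p}"
proof (rule linorder_inj_onI')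
  fix i j assume "i \<in> {..<p}" "j \<in> {..<p}" "i < j"
  hence "\<not> p dvd j - i" by (auto dest: dvd_imp_le)
  hence "of_nat (j - i) \<noteq> (0 :: 'e)" by (simp add: of_nat_eq_0_iff_char_dvd CHAR)
  thus "x + of_nat i \<noteq> x + of_nat j" using \<open>i < j\<close> by (simp add: of_nat_diff)
qed

lemma card_nodes: "card ((\<lambda>j. x + of_nat j) ` {..<p}) = p"
  using card_image[OF inj_nodes] by simp

lemma poly_\<sigma>_power:
  assumes "\<And>j. coeff q j \<in> Fix" shows "poly q ((\<sigma> ^^ j) a) = (\<sigma> ^^ j) (poly q a)"
  unfolding poly_altdef
  by (simp add: morphism_simps[OF \<sigma>_power] \<sigma>_power_fix[OF assms])

text \<open>Since \<sigma> fixes the coefficients, \<open>q\<close> vanishes at all p conjugates x +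
  j, more points than its degree allows.\<close>

lemma low_poly_independent:
  assumes "low_poly p q" "poly q x = 0" shows "q = 0"
proof (rule poly_eq_0_of_roots)
  show "coeff q j = 0" if "j \<ge> card ((\<lambda>j. x + of_nat j) ` {..<p})" for j
    using assms(1) that by (simp add: low_poly_def card_nodes)
  fix s assume "s \<in> (\<lambda>j. x + of_nat j) ` {..<p}"
  then obtain j where "s = (\<sigma> ^^ j) x" by (auto simp: \<sigma>_power_x)
  thus "poly q s = 0"
    using poly_\<sigma>_power[of q j x] assms by (simp add: low_poly_def morphism_simps[OF \<sigma>_power])
qed simp

text \<open>
  The interpolation polynomial with value \<open>\<sigma>\<^sup>j a\<close> at \<open>\<sigma>\<^sup>j x\<close> is invariant because \<open>\<sigma>\<close> permutes the
  nodes and the values compatibly.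
\<close>

lemma ex_low_poly: "\<exists>q. low_poly p q \<and> poly q x = a"
proof -
  define S where "S = (\<lambda>j. x + of_nat j) ` {..<p}"
  define f where "f = (\<lambda>s. (\<sigma> ^^ (THE j. j < p \<and> s = x + of_nat j)) a)"
  have cS: "card S = p" by (simp add: S_def card_nodes)
  have f: "f (x + of_nat j) = (\<sigma> ^^ j) a" if "j < p" for j
  proof -
    have "(THE i. i < p \<and> x + of_nat j = x + of_nat i) = j"
      using that inj_nodes by (intro the_equality) (auto simp: inj_on_def)
    thus ?thesis by (simp add: f_def)
  qed
  obtain q where q: "\<forall>j\<ge>card S. coeff q j = 0" "\<forall>s\<in>S. poly q s = f s"
    using ex_interpolation[of S f] by (auto simp: S_def)
  have val: "poly q (x + of_nat j) = (\<sigma> ^^ j) a" if "j < p" for j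
    using q(2) f that by (simp add: S_def)
  have coeff_map: "coeff (map_poly \<sigma> q) j = \<sigma> (coeff q j)" for j
    by (simp add: coeff_map_poly morphism_zero[OF \<sigma>])
  have map: "poly (map_poly \<sigma> q) (\<sigma> b) = \<sigma> (poly q b)" for b
  proof -
    have "poly (map_poly \<sigma> q) (\<sigma> b) = eval_at \<sigma> (\<sigma> b) q" by (simp add: eval_at_def)
    also have "\<dots> = (\<Sum>i\<le>Polynomial.degree q. \<sigma> (coeff q i) * \<sigma> b ^ i)"
      by (rule eval_at_altdef[OF \<sigma>]) simp
    also have "\<dots> = \<sigma> (poly q b)" by (simp add: poly_altdef morphism_simps[OF \<sigma>])
    finally show ?thesis .
  qed
  have "poly (map_poly \<sigma> q) (x + of_nat j) = (\<sigma> ^^ j) a" if j: "j < p" for j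
  proof -
    \<comment> \<open>The cyclic predecessor of \<open>j\<close>. For j = 0 it is p - 1, where p = 0
      in the field and \<sigma>^p = id close the cycle of nodes and of values.\<close>
    obtain i where i: "i < p" "\<sigma> (x + of_nat i) = x + of_nat j" "(\<sigma> ^^ Suc i) a = (\<sigma> ^^ j) a"
    proof (cases j)
      case 0
      have "of_nat (Suc (p - 1)) = (0 :: 'e)"
        using of_nat_CHAR[where 'a = 'e] CHAR p_pos by simp
      moreover have "(\<sigma> ^^ Suc (p - 1)) a = a" using \<sigma>_power_p[of a] p_pos by simp
      ultimately show ?thesis using that[of "p - 1"] p_pos 0
        by (simp add: morphism_simps[OF \<sigma>] \<sigma>_x add_ac)
    next
      case (Suc i)
      thus ?thesis using that[of i] j by (simp add: morphism_simps[OF \<sigma>] \<sigma>_x add_ac)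
    qed
    have "poly (map_poly \<sigma> q) (x + of_nat j) = \<sigma> ((\<sigma> ^^ i) a)"
      by (simp only: i(2)[symmetric] map val[OF i(1)])
    thus ?thesis using i(3) by simp
  qed
  hence "map_poly \<sigma> q - q = 0"
    using q(1) val unfolding cS
    by (intro poly_eq_0_of_roots[of S]) (auto simp: S_def card_nodes coeff_map morphism_zero[OF \<sigma>])
  hence "\<sigma> (coeff q j) = coeff q j" for j
    using coeff_map[of j] by simp
  hence "low_poly p q" using q(1) by (simp add: low_poly_def cS)
  moreover have "poly q x = a" using val[of 0] p_pos by simp
  ultimately show ?thesis by blast
qed

text \<open>A coincidence gives an exponent m prime to p with \<sigma>^m a = a. As \<sigma>^p a = a
  as well, Bezout yields \<sigma> a = a.\<close>

lemma \<sigma>_power_inj: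
  assumes "a \<notin> Fix" shows "inj_on (\<lambda>j. (\<sigma> ^^ j) a) {..<p}"
proof (rule linorder_inj_onI')
  fix i j assume ij: "i \<in> {..<p}" "j \<in> {..<p}" "i < j"
  show "(\<sigma> ^^ i) a \<noteq> (\<sigma> ^^ j) a"
  proof
    assume eq: "(\<sigma> ^^ i) a = (\<sigma> ^^ j) a"
    define m where "m = j - i"
    have "(\<sigma> ^^ j) a = (\<sigma> ^^ i) ((\<sigma> ^^ m) a)"
      using ij by (simp add: m_def flip: funpow_add comp_apply[of "\<sigma> ^^ i"])
    hence m: "(\<sigma> ^^ m) a = a"
      using eq field_morphism_inj[OF \<sigma>_power[of i]] by (simp add: inj_eq)
    have "\<not> p dvd m" using ij by (auto simp: m_def dest: dvd_imp_le)
    hence "coprime p m" using prime_p by (simp add: prime_imp_coprime)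
    hence "gcd m p = 1" by (simp add: coprime_iff_gcd_eq_1 gcd.commute)
    then obtain u w where uw: "m * u = p * w + 1"
      using bezout_nat[of m p] ij by (auto simp: m_def)
    have per: "(\<sigma> ^^ (n * u)) a = a" if "(\<sigma> ^^ n) a = a" for n u
      using that by (induction u) (simp_all add: funpow_add)
    have "a = (\<sigma> ^^ (m * u)) a" using per[OF m] by simp
    also have "\<dots> = \<sigma> a" by (simp add: uw per[OF \<sigma>_power_p])
    finally show False using assms by simp
  qed
qed


subsection \<open>Uniqueness of the extension of an invariant valuation\<close>

text \<open>The coefficients come from the product of the factors T - \<sigma>^j b, which \<sigma>
  permutes. So a \<sigma>-stable ring \<open>W\<close> is integral over its invariants.\<close>

lemma monic_annihilator:
  assumes W: "1 \<in> W" "\<And>a b. a \<in> W \<Longrightarrow> b \<in> W \<Longrightarrow> a + b \<in> W"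
      "\<And>a b. a \<in> W \<Longrightarrow> b \<in> W \<Longrightarrow> a * b \<in> W" "\<And>a. a \<in> W \<Longrightarrow> - a \<in> W"
      "\<And>a. a \<in> W \<Longrightarrow> \<sigma> a \<in> W"
    and b: "b \<in> W"
  shows "\<exists>c. (\<forall>j<p. c j \<in> W \<inter> Fix) \<and> b ^ p = (\<Sum>j<p. c j * b ^ j)"
proof -
  define Q where "Q = (\<Prod>j<p. [:- (\<sigma> ^^ j) b, 1:])"
  have zero: "0 \<in> W" using W(1,2,4) by (metis add.right_inverse)
  have sum: "sum f A \<in> W" if "\<And>i. i \<in> A \<Longrightarrow> f i \<in> W" for f and A :: "nat set"
    using that by (induction A rule: infinite_finite_induct) (simp_all add: zero W(2))
  have coeff_mult: "coeff (f * g) j \<in> W" if "\<And>i. coeff f i \<in> W" "\<And>i. coeff g i \<in> W" for f g j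
    unfolding coeff_mult by (intro sum W(3) that)
  have "(\<sigma> ^^ j) b \<in> W" for j by (induction j) (simp_all add: b W(5))
  hence lin: "coeff [:- (\<sigma> ^^ j) b, 1:] i \<in> W" for i j
    by (cases i) (auto simp: zero W coeff_pCons split: nat.splits)
  have "coeff (\<Prod>j<n. [:- (\<sigma> ^^ j) b, 1:]) i \<in> W" for n i
  proof (induction n arbitrary: i)
    case (Suc n)
    show ?case unfolding prod.lessThan_Suc by (intro coeff_mult Suc lin)
  qed (auto simp: zero W coeff_pCons one_pCons split: nat.splits)
  hence coeff: "coeff Q i \<in> W" for i by (simp add: Q_def)
  note mp = morphism_simps[OF ring_morphism_map_poly[OF \<sigma>]]
  define s where "s = (\<lambda>j. [:- (\<sigma> ^^ j) b, 1:])"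
  have Q: "Q = (\<Prod>j<p. s j)" by (simp add: Q_def s_def)
  have "map_poly \<sigma> (s j) = s (Suc j)" for j
    by (simp add: s_def map_poly_pCons morphism_simps[OF \<sigma>])
  hence "map_poly \<sigma> Q = (\<Prod>j<p. s (Suc j))"
    by (simp add: Q mp)
  moreover have "s 0 * (\<Prod>j<p. s (Suc j)) = (\<Prod>j<p. s j) * s p"
    by (metis prod.lessThan_Suc prod.lessThan_Suc_shift)
  moreover have "s p = s 0" "s 0 \<noteq> 0" by (simp_all add: s_def \<sigma>_power_p)
  ultimately have "map_poly \<sigma> Q = Q" by (simp add: Q)
  hence inva: "\<sigma> (coeff Q j) = coeff Q j" for j
    by (metis coeff_map_poly morphism_zero[OF \<sigma>])
  have deg: "Polynomial.degree Q = p"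
    unfolding Q_def by (subst degree_prod_eq_sum_degree) simp_all
  have "Polynomial.lead_coeff Q = 1" by (simp add: Q_def lead_coeff_prod)
  hence lead: "coeff Q p = 1" by (simp add: deg)
  have "poly Q b = 0" unfolding Q_def poly_prod
    using p_pos by (intro prod_zero) (auto intro!: bexI[of _ 0])
  hence "(\<Sum>j<p. coeff Q j * b ^ j) + b ^ p = 0"
    by (simp add: poly_altdef deg lead flip: lessThan_Suc_atMost)
  hence "b ^ p = (\<Sum>j<p. - coeff Q j * b ^ j)"
    by (simp add: sum_negf eq_neg_iff_add_eq_0 add.commute)
  moreover have "- coeff Q j \<in> W \<inter> Fix" for j
    using coeff inva by (simp add: W(4) morphism_simps[OF \<sigma>])
  ultimately show ?thesis by (intro exI[of _ "\<lambda>j. - coeff Q j"]) simp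
qed

text \<open>Integrality over the common invariants puts the ring of \<open>v\<close> inside
  \<open>V\<close>; norms, whose values are known because \<open>v\<close> is invariant, give the
  converse.\<close>

lemma unique_valuation_ring:
  fixes v :: "'e \<Rightarrow> rat"
  assumes mult: "\<And>a b. a \<noteq> 0 \<Longrightarrow> b \<noteq> 0 \<Longrightarrow> v (a * b) = v a + v b"
    and add: "\<And>a b. a \<noteq> 0 \<Longrightarrow> b \<noteq> 0 \<Longrightarrow> a + b \<noteq> 0 \<Longrightarrow> min (v a) (v b) \<le> v (a + b)"
    and inv: "\<And>a. a \<noteq> 0 \<Longrightarrow> v (\<sigma> a) = v a"
    and V: "1 \<in> V" "\<And>a b. a \<in> V \<Longrightarrow> b \<in> V \<Longrightarrow> a + b \<in> V"
      "\<And>a b. a \<in> V \<Longrightarrow> b \<in> V \<Longrightarrow> a * b \<in> V" "\<And>a. a \<in> V \<Longrightarrow> - a \<in> V"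
    and VV: "\<And>a. a \<noteq> 0 \<Longrightarrow> a \<in> V \<or> inverse a \<in> V"
    and VL: "V \<inter> Fix = {q. q = 0 \<or> 0 \<le> v q} \<inter> Fix"
  shows "V = {q. q = 0 \<or> 0 \<le> v q}"
proof -
  define W where "W = {q. q = 0 \<or> 0 \<le> v q}"
  have v1: "v 1 = 0" using mult[of 1 1] by simp
  have "v (- 1) + v (- 1) = 0" using mult[of "- 1" "- 1"] v1 by simp
  hence vm1: "v (- 1) = 0" by simp
  have vminus: "v (- a) = v a" if "a \<noteq> 0" for a using mult[of "- 1" a] that vm1 by simp
  have vpow: "v (a ^ n) = of_nat n * v a" if "a \<noteq> 0" for a n
    using that by (induction n) (simp_all add: v1 mult algebra_simps)
  have vinv: "v (inverse a) = - v a" if "a \<noteq> 0" for a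
    using mult[of a "inverse a"] that v1 by simp
  have W: "1 \<in> W" "\<And>a b. a \<in> W \<Longrightarrow> b \<in> W \<Longrightarrow> a + b \<in> W"
      "\<And>a b. a \<in> W \<Longrightarrow> b \<in> W \<Longrightarrow> a * b \<in> W" "\<And>a. a \<in> W \<Longrightarrow> - a \<in> W"
      "\<And>a. a \<in> W \<Longrightarrow> \<sigma> a \<in> W"
  proof -
    show "1 \<in> W" by (simp add: W_def v1)
    show "a + b \<in> W" if "a \<in> W" "b \<in> W" for a b
      using that add[of a b]
      by (cases "a = 0 \<or> b = 0 \<or> a + b = 0") (auto simp: W_def min_def split: if_splits)
    show "a * b \<in> W" if "a \<in> W" "b \<in> W" for a b
      using that by (cases "a = 0 \<or> b = 0") (auto simp: W_def mult)
    show "- a \<in> W" if "a \<in> W" for a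
      using that by (cases "a = 0") (auto simp: W_def vminus)
    show "\<sigma> a \<in> W" if "a \<in> W" for a
      using that by (cases "a = 0") (auto simp: W_def inv morphism_simps[OF \<sigma>])
  qed
  have V0: "0 \<in> V" using V(1,2,4) by (metis add.right_inverse)
  have sumV: "sum f A \<in> V" if "\<And>i. i \<in> A \<Longrightarrow> f i \<in> V" for f and A :: "nat set"
    using that by (induction A rule: infinite_finite_induct) (simp_all add: V0 V(2))
  have powV: "a ^ n \<in> V" if "a \<in> V" for a n
    using that by (induction n) (simp_all add: V(1,3))
  have OV: "b \<in> V" if b: "b \<in> W" for b
  proof (rule ccontr)
    assume nV: "b \<notin> V"
    hence b0: "b \<noteq> 0" using V0 by auto
    hence iV: "inverse b \<in> V" using VV nV by blast
    obtain c where c: "\<forall>j<p. c j \<in> W \<inter> Fix" "b ^ p = (\<Sum>j<p. c j * b ^ j)"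
      using monic_annihilator[of W b] W b by blast
    \<comment> \<open>Dividing the integral equation by b^(p-1) writes \<open>b\<close> as a
      polynomial in \<open>inverse b\<close> with coefficients in \<open>V\<close>.\<close>
    have "b = b ^ p * inverse b ^ (p - 1)"
      using p_pos b0 by (cases p) (simp_all add: power_inverse mult.assoc)
    also have "\<dots> = (\<Sum>j<p. c j * inverse b ^ (p - 1 - j))"
      unfolding c(2) sum_distrib_right
    proof (rule sum.cong)
      fix j assume "j \<in> {..<p}"
      hence "p - 1 = j + (p - 1 - j)" by simp
      hence "inverse b ^ (p - 1) = inverse b ^ j * inverse b ^ (p - 1 - j)"
        by (metis power_add)
      moreover have "b ^ j * inverse b ^ j = 1" using b0 by (simp add: power_inverse)
      ultimately show "c j * b ^ j * inverse b ^ (p - 1) = c j * inverse b ^ (p - 1 - j)"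
        by (simp add: mult.assoc)
    qed simp
    also have "\<dots> \<in> V"
    proof (intro sumV V(3) powV iV)
      fix j assume "j \<in> {..<p}"
      thus "c j \<in> V" using c(1) VL by (auto simp: W_def)
    qed
    finally show False using nV by simp
  qed
  have "a \<in> W" if a: "a \<in> V" for a
  proof (rule ccontr)
    assume "a \<notin> W"
    hence a0: "a \<noteq> 0" "v a < 0" by (auto simp: W_def)
    define z where "z = (\<Prod>j<p. (\<sigma> ^^ j) a)"
    have nz: "(\<sigma> ^^ j) a \<noteq> 0" for j using a0 field_morphism_eq_0_iff[OF \<sigma>_power] by blast
    hence z0: "z \<noteq> 0" by (simp add: z_def)
    have "v ((\<sigma> ^^ j) a) = v a" for j by (induction j) (simp_all add: inv nz)
    hence "v (\<Prod>j<n. (\<sigma> ^^ j) a) = of_nat n * v a" for n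
    proof (induction n)
      case (Suc n)
      have "(\<Prod>j<n. (\<sigma> ^^ j) a) \<noteq> 0" using nz by simp
      thus ?case using Suc nz[of n] by (simp add: mult algebra_simps)
    qed (simp add: v1)
    hence vz: "v z = of_nat p * v a" by (simp add: z_def)
    have "\<sigma> z = (\<Prod>j<p. (\<sigma> ^^ Suc j) a)" by (simp add: z_def morphism_simps[OF \<sigma>])
    moreover have "a * (\<Prod>j<p. (\<sigma> ^^ Suc j) a) = (\<Prod>j<p. (\<sigma> ^^ j) a) * (\<sigma> ^^ p) a"
      using prod.lessThan_Suc[of "\<lambda>j. (\<sigma> ^^ j) a" p] prod.lessThan_Suc_shift[of "\<lambda>j. (\<sigma> ^^ j) a" p]
      by simp
    ultimately have inva: "\<sigma> z = z" using a0 by (simp add: \<sigma>_power_p z_def)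
    \<comment> \<open>The norm \<open>z\<close> has the value of a^p, so the quotient has value 0
      and lies in \<open>V\<close> by the first inclusion. Hence \<open>z\<close> is an invariant
      element of \<open>V\<close> of negative value, which \<open>VL\<close> excludes.\<close>
    have "z * inverse a ^ p \<in> W"
      using z0 a0 by (simp add: W_def mult vpow vinv vz)
    hence "z * inverse a ^ p * a ^ p \<in> V" by (intro V(3) OV powV a)
    hence "z \<in> V" using a0 by (simp add: power_inverse mult.assoc)
    hence "0 \<le> v z" using VL inva z0 by auto
    thus False using a0 p_pos by (simp add: vz zero_le_mult_iff)
  qed
  thus ?thesis using OV unfolding W_def by blast
qed

end

subsection \<open>Fields as rings in the sense of HOL-Algebra\<close>

lemma type_algebra_simps:
  "carrier (ring_of_type_algebra :: 'a::field ring) = UNIV"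
  "\<zero>\<^bsub>ring_of_type_algebra\<^esub> = (0 :: 'a)"
  "\<one>\<^bsub>ring_of_type_algebra\<^esub> = (1 :: 'a)"
  "a \<oplus>\<^bsub>ring_of_type_algebra\<^esub> b = (a + b :: 'a)"
  "a \<otimes>\<^bsub>ring_of_type_algebra\<^esub> b = (a * b :: 'a)"
  by (simp_all add: ring_of_type_algebra_def)

lemma type_algebra_minus: "\<ominus>\<^bsub>ring_of_type_algebra\<^esub> a = (- a :: 'a::field)"
proof -
  interpret R: field "ring_of_type_algebra :: 'a ring" by (rule field_from_type_algebra)
  show ?thesis by (rule R.minus_equality) (simp_all add: type_algebra_simps)
qed

lemma type_algebra_inv: "a \<noteq> 0 \<Longrightarrow> inv\<^bsub>ring_of_type_algebra\<^esub> a = (inverse a :: 'a::field)"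
proof -
  interpret R: field "ring_of_type_algebra :: 'a ring" by (rule field_from_type_algebra)
  show "a \<noteq> 0 \<Longrightarrow> ?thesis" by (rule R.comm_inv_char) (simp_all add: type_algebra_simps)
qed

lemma type_algebra_power: "a [^]\<^bsub>ring_of_type_algebra\<^esub> (n :: nat) = (a ^ n :: 'a::field)"
proof -
  interpret R: field "ring_of_type_algebra :: 'a ring" by (rule field_from_type_algebra)
  show ?thesis by (induction n) (simp_all add: type_algebra_simps mult.commute)
qed

lemma type_algebra_subring:
  fixes S :: "'a::field set"
  shows "subring S ring_of_type_algebra \<longleftrightarrow> 1 \<in> S \<and> (\<forall>a\<in>S. \<forall>b\<in>S. a + b \<in> S) \<and>
    (\<forall>a\<in>S. \<forall>b\<in>S. a * b \<in> S) \<and> (\<forall>a\<in>S. - a \<in> S)"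
proof -
  interpret R: field "ring_of_type_algebra :: 'a ring" by (rule field_from_type_algebra)
  show ?thesis
  proof
    assume S: "subring S ring_of_type_algebra"
    show "1 \<in> S \<and> (\<forall>a\<in>S. \<forall>b\<in>S. a + b \<in> S) \<and> (\<forall>a\<in>S. \<forall>b\<in>S. a * b \<in> S) \<and> (\<forall>a\<in>S. - a \<in> S)"
      using subringE(3,5-7)[OF S] by (simp add: type_algebra_simps type_algebra_minus)
  qed (intro R.subringI, auto simp: type_algebra_simps type_algebra_minus)
qed

lemma type_algebra_subfield:
  assumes "subring S ring_of_type_algebra" "\<And>a. a \<in> S \<Longrightarrow> inverse a \<in> (S :: 'a::field set)"
  shows "subfield S ring_of_type_algebra"
proof -
  interpret R: field "ring_of_type_algebra :: 'a ring" by (rule field_from_type_algebra)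
  show ?thesis using assms by (intro R.subfieldI') (auto simp: type_algebra_simps type_algebra_inv)
qed

lemma subfield_morphism_image:
  fixes f :: "'e::field \<Rightarrow> 'o::field"
  assumes f: "ring_morphism f"
    and S: "1 \<in> S" "\<And>a b. a \<in> S \<Longrightarrow> b \<in> S \<Longrightarrow> a + b \<in> S"
      "\<And>a b. a \<in> S \<Longrightarrow> b \<in> S \<Longrightarrow> a * b \<in> S" "\<And>a. a \<in> S \<Longrightarrow> - a \<in> S"
      "\<And>a. a \<in> S \<Longrightarrow> inverse a \<in> S"
  shows "subfield (f ` S) ring_of_type_algebra"
proof (rule type_algebra_subfield)
  have "1 \<in> f ` S" using S(1) by (metis image_eqI morphism_one[OF f])
  thus "subring (f ` S) ring_of_type_algebra"
    using S unfolding type_algebra_subring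
    by (auto simp flip: morphism_add[OF f] morphism_mult[OF f] morphism_minus[OF f])
  show "inverse a \<in> f ` S" if "a \<in> f ` S" for a
    using that S(5) by (auto simp flip: field_morphism_inverse[OF f])
qed

text \<open>All members of the tower have to lie in one field, so the extension of the fixed field
  is carried into \<open>'o\<close> by an embedding.\<close>

locale embedded_translation = translation \<sigma> x p
  for \<sigma> :: "'e::field \<Rightarrow> 'e" and x :: 'e and p :: nat +
  fixes \<psi> :: "'e \<Rightarrow> 'o::field"
  assumes \<psi>: "ring_morphism \<psi>"
begin

abbreviation R :: "'o ring" where "R \<equiv> ring_of_type_algebra"

sublocale R: field R by (rule field_from_type_algebra)

abbreviation F0 :: "'o set" where "F0 \<equiv> \<psi> ` Fix"
abbreviation F1 :: "'o set" where "F1 \<equiv> range \<psi>"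

lemmas \<psi>_simps = morphism_simps[OF \<psi>]

lemma subfield_F0: "subfield F0 R"
  by (rule subfield_morphism_image[OF \<psi>])
    (auto simp: morphism_simps[OF \<sigma>] field_morphism_inverse[OF \<sigma>])

lemma subfield_F1: "subfield F1 R"
  by (rule subfield_morphism_image[OF \<psi>]) auto

text \<open>The span over \<open>F0\<close> of the first \<open>n\<close> powers of the generator.
  Raising \<open>n\<close> by one is a \<open>line_extension\<close>, the step by which
  \<open>dimension\<close> is built up; for n = p interpolation shows that everything is
  reached.\<close>

definition low_space :: "nat \<Rightarrow> 'o set" where
  "low_space n = {\<psi> (poly q x) |q. low_poly n q}"

lemma low_space_Suc: "low_space (Suc n) = R.line_extension F0 (\<psi> x ^ n) (low_space n)"
proof (intro equalityI subsetI)
  fix a assume "a \<in> low_space (Suc n)"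
  then obtain q where q: "low_poly (Suc n) q" "a = \<psi> (poly q x)" by (auto simp: low_space_def)
  define r where "r = q - monom (coeff q n) n"
  have "low_poly n r"
    using q(1) by (auto simp: r_def low_poly_def morphism_simps[OF \<sigma>] not_less_eq_eq le_Suc_eq)
  moreover have "a = \<psi> (coeff q n) * \<psi> x ^ n + \<psi> (poly r x)"
    by (simp add: q(2) r_def poly_monom \<psi>_simps)
  ultimately show "a \<in> R.line_extension F0 (\<psi> x ^ n) (low_space n)"
    using q(1) unfolding R.line_extension_mem_iff type_algebra_simps low_space_def low_poly_def by blast
next
  fix a assume "a \<in> R.line_extension F0 (\<psi> x ^ n) (low_space n)"
  then obtain c q where c: "c \<in> Fix" "low_poly n q" "a = \<psi> c * \<psi> x ^ n + \<psi> (poly q x)"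
    unfolding R.line_extension_mem_iff type_algebra_simps low_space_def by blast
  have "low_poly (Suc n) (monom c n + q)"
    using c by (auto simp: low_poly_def morphism_simps[OF \<sigma>])
  moreover have "a = \<psi> (poly (monom c n + q) x)"
    by (simp add: c(3) poly_monom \<psi>_simps)
  ultimately show "a \<in> low_space (Suc n)" unfolding low_space_def by blast
qed

lemma dimension_low_space: "n \<le> p \<Longrightarrow> R.dimension n F0 (low_space n)"
proof (induction n)
  case 0
  have "low_poly 0 q \<longleftrightarrow> q = 0" for q
    by (auto simp: low_poly_def morphism_zero[OF \<sigma>] poly_eq_iff)
  hence "low_space 0 = {\<zero>\<^bsub>R\<^esub>}" by (simp add: low_space_def type_algebra_simps \<psi>_simps)
  thus ?case by simp
next
  case (Suc n)
  have "\<psi> x ^ n \<notin> low_space n"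
  proof
    assume "\<psi> x ^ n \<in> low_space n"
    then obtain q where q: "low_poly n q" "\<psi> (x ^ n) = \<psi> (poly q x)"
      by (auto simp: low_space_def \<psi>_simps)
    have "low_poly p (monom 1 n - q)"
      using q(1) Suc.prems by (auto simp: low_poly_def morphism_simps[OF \<sigma>])
    moreover have "poly (monom 1 n - q) x = 0"
      using q(2) field_morphism_inj[OF \<psi>] by (simp add: poly_monom inj_eq)
    ultimately have "monom 1 n - q = 0" by (rule low_poly_independent)
    hence "coeff q n = 1" by (metis coeff_monom eq_iff_diff_eq_0)
    thus False using q(1) by (simp add: low_poly_def)
  qed
  thus ?case unfolding low_space_Suc
    using Suc by (intro R.Suc_dim) (simp_all add: type_algebra_simps)
qed

lemma dimension_p: "R.dimension p F0 F1"
proof -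
  have "\<psi> a \<in> low_space p" for a
    using ex_low_poly[of a] by (auto simp: low_space_def)
  hence "low_space p = F1" by (auto simp: low_space_def)
  thus ?thesis using dimension_low_space[of p] by simp
qed

lemma eval_conjugate:
  assumes "set f \<subseteq> F0" "R.eval f (\<psi> a) = 0"
  shows "R.eval f (\<psi> ((\<sigma> ^^ j) a)) = 0"
proof -
  \<comment> \<open>Strengthened for the induction: the value at the conjugate is the conjugate of
    the value, stated through a common preimage \<open>b\<close>.\<close>
  have "\<exists>b. R.eval f (\<psi> a) = \<psi> b \<and> R.eval f (\<psi> ((\<sigma> ^^ j) a)) = \<psi> ((\<sigma> ^^ j) b)"
    using assms(1)
  proof (induction f)
    case (Cons c f)
    then obtain b where b: "R.eval f (\<psi> a) = \<psi> b" "R.eval f (\<psi> ((\<sigma> ^^ j) a)) = \<psi> ((\<sigma> ^^ j) b)"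
      by auto
    obtain e where e: "c = \<psi> e" "e \<in> Fix" using Cons.prems by auto
    show ?case
      by (intro exI[of _ "e * a ^ length f + b"])
        (simp add: b e(1) type_algebra_simps type_algebra_power \<psi>_simps
          morphism_simps[OF \<sigma>_power] \<sigma>_power_fix[OF e(2)])
  qed (auto intro!: exI[of _ 0] simp: type_algebra_simps \<psi>_simps morphism_simps[OF \<sigma>_power])
  then obtain b where b: "R.eval f (\<psi> a) = \<psi> b" "R.eval f (\<psi> ((\<sigma> ^^ j) a)) = \<psi> ((\<sigma> ^^ j) b)"
    by blast
  hence "b = 0" using assms(2) field_morphism_eq_0_iff[OF \<psi>] by simp
  thus ?thesis using b(2) by (simp add: \<psi>_simps morphism_simps[OF \<sigma>_power])
qed

lemma algebraic_F1: "a \<in> F1 \<Longrightarrow> R.algebraic F0 a"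
  using R.finite_dimension_imp_algebraic[OF subfield_F0 subfieldE(1)[OF subfield_F1]
      R.finite_dimensionI[OF dimension_p]]
  unfolding over_def by blast

text \<open>The powers of \<open>a\<close> below the degree of its minimal polynomial are
  independent, and all of them lie in \<open>G\<close>.\<close>

lemma degree_Irr_le:
  assumes a: "R.algebraic F0 a" and G: "subring G R" "F0 \<subseteq> G" "a \<in> G" "R.dimension n F0 G"
  shows "Polynomials.degree (R.Irr F0 a) \<le> n"
proof -
  have alg: "(R.algebraic over F0) a" using a by (simp add: over_def)
  have a': "a \<in> carrier R" by (simp add: type_algebra_simps)
  have "b ^ i \<in> G" if "b \<in> G" for b i
    using that G(1) by (induction i) (simp_all add: type_algebra_subring)
  hence "set (R.exp_base a (Polynomials.degree (R.Irr F0 a))) \<subseteq> G"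
    using G(3) by (auto simp: R.exp_base_def type_algebra_power)
  from R.independent_length_le_dimension[OF subfield_F0 G(4)
      R.exp_base_independent[OF subfield_F0 a' alg] this]
  show ?thesis by (simp add: R.exp_base_def)
qed

text \<open>The size bound leaves no room for repetitions or further elements. Applied to roots, it
  gives splitting and separability at once.\<close>

lemma multiset_eq_mset_set:
  assumes "S \<subseteq> set_mset M" "size M \<le> card S"
  shows "size M = card S" "count M b \<le> 1"
proof -
  have fin: "finite S" using assms(1) by (rule finite_subset) simp
  have "mset_set S \<subseteq># M"
    using assms(1) fin
    by (metis finite_set_mset mset_set_set_mset_msubset msubset_mset_set_iff subset_mset.trans)
  hence "mset_set S = M"
    using assms(2) mset_subset_size[of "mset_set S" M] by (auto simp: subset_mset.le_less)
  thus "size M = card S" "count M b \<le> 1" using fin by (auto simp: count_mset_set')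
qed

text \<open>The conjugates of \<open>a\<close> are roots of its minimal polynomial and at least as
  many as its degree, so they are all its roots, each simple.\<close>

lemma galois_F1: "galois_extension R F0 F1"
  unfolding galois_extension_def
proof (intro conjI ballI allI subfield_F0 subfield_F1 algebraic_F1)
  show "F0 \<subseteq> F1" by auto
next
  fix a assume a: "a \<in> F1"
  then obtain b where b: "a = \<psi> b" by auto
  define f where "f = R.Irr F0 a"
  define S where "S = (\<lambda>j. \<psi> ((\<sigma> ^^ j) b)) ` {..<p}"
  let ?R1 = "R\<lparr>carrier := F1\<rparr>"
  interpret R1: field ?R1 using R.subfield_iff(2)[OF subfield_F1] .
  have alg: "R.algebraic F0 a" by (rule algebraic_F1[OF a])
  have "(R.algebraic over F0) a" using alg by (simp add: over_def)
  note f = R.IrrE[OF subfield_F0 _ this, folded f_def, unfolded type_algebra_simps, OF UNIV_I]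
  have set_f: "set f \<subseteq> F0"
    using f(1) R.polynomial_incl[of F0 f] by (simp flip: univ_poly_carrier)
  have nz: "f \<noteq> []" using f(3) f(2) unfolding ring_irreducible_def univ_poly_zero by auto
  have "polynomial\<^bsub>R\<^esub> F1 f"
    using set_f f(1) nz unfolding univ_poly_carrier[symmetric] polynomial_def by auto
  hence carr: "f \<in> carrier (poly_ring ?R1)"
    by (simp add: R.univ_poly_consistent[OF subfieldE(1)[OF subfield_F1]] flip: univ_poly_carrier)
  have "S \<subseteq> set_mset (R1.roots f)"
  proof
    fix s assume "s \<in> S"
    then obtain j where s: "s = \<psi> ((\<sigma> ^^ j) b)" by (auto simp: S_def)
    have "R.eval f s = 0" unfolding s
      by (rule eval_conjugate[OF set_f]) (use f(4) b in \<open>simp add: type_algebra_simps\<close>)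
    hence "R1.is_root f s"
      using nz s unfolding R1.is_root_def R.eval_consistent[OF subfieldE(1)[OF subfield_F1]]
      by (simp add: type_algebra_simps)
    thus "s \<in> set_mset (R1.roots f)" using R1.roots_mem_iff_is_root[OF carr] by simp
  qed
  \<comment> \<open>Since p is prime there are either 1 or p conjugates; the bound comes from
    dimension 1 or dimension p accordingly.\<close>
  moreover have deg: "Polynomials.degree f \<le> card S"
  proof (cases "b \<in> Fix")
    case True
    hence "(\<sigma> ^^ j) b = b" for j by (rule \<sigma>_power_fix)
    hence "S = {a}" using p_pos by (auto simp: S_def b)
    moreover have "Polynomials.degree f \<le> 1" unfolding f_def
      using True b R.dimension_one[OF subfield_F0]
      by (intro degree_Irr_le[OF alg, of F0] subfieldE(1)[OF subfield_F0]) (auto simp: over_def)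
    ultimately show ?thesis by simp
  next
    case False
    have "inj_on (\<lambda>j. \<psi> ((\<sigma> ^^ j) b)) {..<p}"
      using \<sigma>_power_inj[OF False] field_morphism_inj[OF \<psi>] by (auto simp: inj_on_def)
    hence "card S = p" by (simp add: S_def card_image)
    moreover have "Polynomials.degree f \<le> p" unfolding f_def
      using a dimension_p by (intro degree_Irr_le[OF alg, of F1] subfieldE(1)[OF subfield_F1]) auto
    ultimately show ?thesis by simp
  qed
  moreover have size: "size (R1.roots f) \<le> Polynomials.degree f" by (rule R1.size_roots_le_degree[OF carr])
  ultimately have *: "size (R1.roots f) = card S" "count (R1.roots f) c \<le> 1" for c
    using multiset_eq_mset_set[of S "R1.roots f"] by simp_all
  show "R1.splitted (R.Irr F0 a)"
    using *(1) deg size unfolding R1.splitted_def f_def by simp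
  show "count (R1.roots (R.Irr F0 a)) c \<le> 1" for c using *(2) unfolding f_def .
qed

end

section \<open>Rational valuations as Krull valuations\<close>

text \<open>Values are rational, but the value group must live in a prescribed type. The ordered
  group of rationals is moved along an injection \<open>c\<close>, with \<open>inv_into\<close>
  decoding.\<close>

definition coded_group :: "(rat \<Rightarrow> 'g) \<Rightarrow> 'g ordered_group" where
  "coded_group c = \<lparr>carrier = range c,
     monoid.mult = (\<lambda>a b. c (inv_into UNIV c a + inv_into UNIV c b)), one = c 0,
     gle = (\<lambda>a b. inv_into UNIV c a \<le> inv_into UNIV c b)\<rparr>"

locale coded_valuation =
  fixes c :: "rat \<Rightarrow> 'g" and v :: "'e::field \<Rightarrow> rat" and \<psi> :: "'e \<Rightarrow> 'o::field"
  assumes inj_c: "inj c"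
    and v_mult: "\<And>a b. a \<noteq> 0 \<Longrightarrow> b \<noteq> 0 \<Longrightarrow> v (a * b) = v a + v b"
    and v_add: "\<And>a b. a \<noteq> 0 \<Longrightarrow> b \<noteq> 0 \<Longrightarrow> a + b \<noteq> 0 \<Longrightarrow> min (v a) (v b) \<le> v (a + b)"
    and \<psi>: "ring_morphism \<psi>"
begin

definition w :: "'o \<Rightarrow> 'g" where "w a = c (v (inv_into UNIV \<psi> a))"

lemma w_image: "w (\<psi> a) = c (v a)"
  using field_morphism_inj[OF \<psi>] by (simp add: w_def inv_f_f)

lemma coded_group_simps:
  "carrier (coded_group c) = range c"
  "c r \<otimes>\<^bsub>coded_group c\<^esub> c s = c (r + s)"
  "\<one>\<^bsub>coded_group c\<^esub> = c 0"
  "c r \<preceq>\<^bsub>coded_group c\<^esub> c s \<longleftrightarrow> r \<le> s"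
  using inj_c by (simp_all add: coded_group_def inv_f_f)

lemma ordered_abelian_group_coded: "ordered_abelian_group (coded_group c)"
proof -
  interpret comm_group "coded_group c"
  proof (rule comm_groupI)
    show "\<exists>b\<in>carrier (coded_group c). b \<otimes>\<^bsub>coded_group c\<^esub> a = \<one>\<^bsub>coded_group c\<^esub>"
      if a: "a \<in> carrier (coded_group c)" for a
    proof -
      obtain r where "a = c r" using a unfolding coded_group_simps by blast
      thus ?thesis by (intro bexI[of _ "c (- r)"]) (simp_all add: coded_group_simps)
    qed
  qed (auto simp: coded_group_simps add_ac)
  show ?thesis
    by unfold_locales (auto simp: coded_group_simps inj_eq[OF inj_c])
qed

lemma valuation_on_image:
  assumes "subfield (\<psi> ` S) ring_of_type_algebra"
  shows "valuation_on (coded_group c) ring_of_type_algebra (\<psi> ` S) w"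
  unfolding valuation_on_def type_algebra_simps
proof (intro conjI ordered_abelian_group_coded assms ballI impI)
  fix a assume "a \<in> \<psi> ` S - {0}"
  then obtain a' where a: "a = \<psi> a'" "a' \<noteq> 0" using field_morphism_eq_0_iff[OF \<psi>] by blast
  show "w a \<in> carrier (coded_group c)" by (simp add: a w_image coded_group_simps)
  fix b assume "b \<in> \<psi> ` S - {0}"
  then obtain b' where b: "b = \<psi> b'" "b' \<noteq> 0" using field_morphism_eq_0_iff[OF \<psi>] by blast
  show "w (a * b) = w a \<otimes>\<^bsub>coded_group c\<^esub> w b"
    using a(2) b(2)
    by (simp add: a(1) b(1) w_image coded_group_simps v_mult flip: morphism_mult[OF \<psi>])
  assume "a + b \<noteq> 0"
  hence "a' + b' \<noteq> 0" by (auto simp: a b morphism_zero[OF \<psi>] simp flip: morphism_add[OF \<psi>])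
  thus "w a \<preceq>\<^bsub>coded_group c\<^esub> w (a + b) \<or> w b \<preceq>\<^bsub>coded_group c\<^esub> w (a + b)"
    using v_add[OF a(2) b(2)]
    by (simp add: a(1) b(1) w_image coded_group_simps min_le_iff_disj flip: morphism_add[OF \<psi>])
qed

lemma subfield_range: "subfield (range \<psi>) ring_of_type_algebra"
  by (rule subfield_morphism_image[OF \<psi>]) auto

lemma value_group_range: "value_group ring_of_type_algebra (range \<psi>) w = c ` v ` (- {0})"
proof -
  have "range \<psi> - {0} = \<psi> ` (- {0})"
    using field_morphism_eq_0_iff[OF \<psi>] by auto
  thus ?thesis by (simp add: value_group_def type_algebra_simps image_image w_image)
qed

lemma valuation_ring_range:
  "valuation_ring (coded_group c) ring_of_type_algebra (range \<psi>) w = \<psi> ` {a. a = 0 \<or> 0 \<le> v a}"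
proof -
  have "\<psi> a \<in> valuation_ring (coded_group c) ring_of_type_algebra (range \<psi>) w \<longleftrightarrow>
      a \<in> {a. a = 0 \<or> 0 \<le> v a}" for a
    by (simp add: valuation_ring_def type_algebra_simps w_image coded_group_simps
        field_morphism_eq_0_iff[OF \<psi>])
  moreover have "valuation_ring (coded_group c) ring_of_type_algebra (range \<psi>) w \<subseteq> range \<psi>"
    unfolding valuation_ring_def by blast
  ultimately show ?thesis by blast
qed

lemma valuation_ideal_range:
  "valuation_ideal (coded_group c) ring_of_type_algebra (range \<psi>) w = \<psi> ` {a. a = 0 \<or> 0 < v a}"
proof -
  have "\<psi> a \<in> valuation_ideal (coded_group c) ring_of_type_algebra (range \<psi>) w \<longleftrightarrow>
      a \<in> {a. a = 0 \<or> 0 < v a}" for a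
    by (simp add: valuation_ideal_def type_algebra_simps w_image coded_group_simps
        field_morphism_eq_0_iff[OF \<psi>] inj_eq[OF inj_c] less_le eq_commute[of 0])
  moreover have "valuation_ideal (coded_group c) ring_of_type_algebra (range \<psi>) w \<subseteq> range \<psi>"
    unfolding valuation_ideal_def by blast
  ultimately show ?thesis by blast
qed

end

lemma residue_field_carrier:
  fixes L :: "'o::field set"
  shows "carrier (residue_field \<Gamma> ring_of_type_algebra L v) =
    (\<lambda>a. valuation_ideal \<Gamma> ring_of_type_algebra L v +>\<^bsub>ring_of_type_algebra\<^esub> a) `
      valuation_ring \<Gamma> ring_of_type_algebra L v"
  unfolding residue_field_def FactRing_def
  by (auto simp: A_RCOSETS_def' a_r_coset_def')

lemma a_r_coset_type_algebra: "S +>\<^bsub>ring_of_type_algebra\<^esub> a = (\<lambda>s. s + a) ` S" for a :: "'o::field"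
  by (auto simp: a_r_coset_def' type_algebra_simps)


section \<open>The tower\<close>

text \<open>Only injectivity matters: distinct monomials serve as labels for the countably many
  rationals.\<close>

definition value_code :: "rat \<Rightarrow> 'k::field ratfun2 set" where
  "value_code q = {to_fract [:monom 1 (to_nat q):]}"

lemma inj_value_code: "inj (value_code :: rat \<Rightarrow> 'k::field ratfun2 set)"
proof (rule injI)
  fix q r assume "(value_code q :: 'k ratfun2 set) = value_code r"
  hence "(monom 1 (to_nat q) :: 'k poly) = monom 1 (to_nat r)" by (simp add: value_code_def)
  hence "Polynomial.degree (monom (1 :: 'k) (to_nat q)) = Polynomial.degree (monom (1 :: 'k) (to_nat r))"
    by simp
  thus "q = r" by (simp add: degree_monom_eq)
qed

context char_p
begin

text \<open>Surjectivity is needed at level 0 alone, since \<open>alpha\<close> carries every value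
  to the next level. As the set does not depend on \<open>i\<close>, value groups never
  grow.\<close>

lemma fval_image: "fval i ` (- {0}) = {of_int m / of_nat (p ^ n) |m n. True}"
proof (intro equalityI subsetI)
  fix r assume "r \<in> fval i ` (- {0})"
  thus "r \<in> {of_int m / of_nat (p ^ n) |m n. True}" using fval_denominator[of _ i] by auto
next
  fix r :: rat assume "r \<in> {of_int m / of_nat (p ^ n) |m n. True}"
  then obtain m n where r: "r = of_int m / of_nat (p ^ n)" by blast
  have "\<exists>q. q \<noteq> 0 \<and> fval i q = r"
  proof (induction i)
    case 0
    show ?case using fval_0_surj[of m n] by (simp add: r)
  next
    case (Suc i)
    then obtain q where "q \<noteq> 0" "fval i q = r" by blast
    thus ?case
      by (intro exI[of _ "alpha q"]) (simp add: fval_alpha field_morphism_eq_0_iff[OF ring_morphism_alpha])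
  qed
  thus "r \<in> fval i ` (- {0})" by auto
qed

lemma alpha_const: "alpha (const_ratfun2 a) = const_ratfun2 a"
  by (simp add: const_ratfun2_altdef xs_to_fract degree_as_poly p_pos xsubst_const)

lemma translation_sigma: "translation sigma (to_fract [:[:0, 1:]:]) p"
proof
  show "CHAR('k ratfun2) = p" by (simp add: CHAR_fract char_p)
qed (simp_all add: ring_morphism_sigma sigma_power_p sigma_var p_pos del: funpow.simps)

text \<open>Both fields are copies of \<open>K(x,y)\<close>, with valuations \<open>fval i\<close>
  and \<open>fval (Suc i)\<close>. Inside the larger copy the smaller one is the fixed field of
  \<open>sigma\<close>.\<close>

lemma tower_step:
  fixes psi psi' :: "'k ratfun2 \<Rightarrow> 'o::field" and i :: nat
  assumes psi: "ring_morphism psi" and psi': "ring_morphism psi'"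
    and lift: "\<And>q. psi' (alpha q) = psi q"
  defines "\<Gamma> \<equiv> coded_group (value_code :: rat \<Rightarrow> 'k ratfun2 set)"
    and "w \<equiv> coded_valuation.w value_code (fval i) psi"
    and "w' \<equiv> coded_valuation.w value_code (fval (Suc i)) psi'"
  shows "range psi \<subset> range psi'"
    and "immediate_extension \<Gamma> ring_of_type_algebra (range psi) w (range psi') w'"
    and "galois_extension ring_of_type_algebra (range psi) (range psi')"
    and "ring.dimension ring_of_type_algebra p (range psi) (range psi')"
    and "has_defect \<Gamma> ring_of_type_algebra (range psi) w (range psi') w' p"
proof -
  let ?R = "ring_of_type_algebra :: 'o ring"
  let ?x = "to_fract [:[:0, 1:]:] :: 'k ratfun2"
  interpret A: coded_valuation "value_code :: rat \<Rightarrow> 'k ratfun2 set" "fval i" psi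
    by unfold_locales (simp_all add: inj_value_code fval_mult fval_add psi)
  interpret B: coded_valuation "value_code :: rat \<Rightarrow> 'k ratfun2 set" "fval (Suc i)" psi'
    by unfold_locales (simp_all add: inj_value_code fval_mult fval_add psi')
  interpret T: embedded_translation sigma ?x p psi'
    by (intro embedded_translation.intro translation_sigma) (unfold_locales, rule psi')
  have F: "range psi = psi' ` {q. sigma q = q}"
    by (simp add: fixed_sigma image_image lift)
  note ring_A = A.valuation_ring_range[folded \<Gamma>_def w_def]
  note ring_B = B.valuation_ring_range[folded \<Gamma>_def w'_def]
  note ideal_B = B.valuation_ideal_range[folded \<Gamma>_def w'_def]
  have val_A: "valuation_on \<Gamma> ?R (range psi) w"
    unfolding \<Gamma>_def w_def by (rule A.valuation_on_image[OF A.subfield_range])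
  have val_B: "valuation_on \<Gamma> ?R (range psi') w'"
    unfolding \<Gamma>_def w'_def by (rule B.valuation_on_image[OF B.subfield_range])
  interpret V: valued_field ?R \<Gamma> "range psi'" w'
    by (intro valued_field.intro valued_field_axioms.intro val_B field_from_type_algebra)
  have sub: "range psi \<subseteq> range psi'" by (auto simp: F)
  have "psi' ?x \<notin> range psi"
  proof
    assume "psi' ?x \<in> range psi"
    hence "sigma ?x = ?x" unfolding F using field_morphism_inj[OF psi'] by (auto simp: inj_eq)
    thus False by (simp add: sigma_var)
  qed
  thus "range psi \<subset> range psi'" using sub by blast
  have eq: "w' a = w a" if a: "a \<in> range psi" "a \<noteq> 0" for a
  proof -
    obtain q where q: "a = psi q" using a by blast
    hence "q \<noteq> 0" using a by (auto simp: morphism_zero[OF psi])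
    moreover have "w' a = value_code (fval (Suc i) (alpha q))"
      using B.w_image[of "alpha q"] by (simp add: q w'_def lift)
    moreover have "w a = value_code (fval i q)" using A.w_image[of q] by (simp add: q w_def)
    ultimately show ?thesis by (simp add: fval_alpha)
  qed
  have OF: "valuation_ring \<Gamma> ?R (range psi') w' \<inter> range psi = valuation_ring \<Gamma> ?R (range psi) w"
  proof -
    have "a \<in> valuation_ring \<Gamma> ?R (range psi') w' \<longleftrightarrow> a \<in> valuation_ring \<Gamma> ?R (range psi) w"
      if "a \<in> range psi" for a
      using that sub eq[OF that] by (cases "a = 0") (auto simp: valuation_ring_def type_algebra_simps)
    moreover have "valuation_ring \<Gamma> ?R (range psi) w \<subseteq> range psi" by (auto simp: valuation_ring_def)
    ultimately show ?thesis by blast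
  qed
  have ext: "valued_extension \<Gamma> ?R (range psi) w (range psi') w'"
    unfolding valued_extension_def using val_A val_B sub eq by (simp add: type_algebra_simps)
  show gal: "galois_extension ?R (range psi) (range psi')"
    using T.galois_F1 unfolding F .
  show dim: "ring.dimension ?R p (range psi) (range psi')"
    using T.dimension_p unfolding F .
  show imm: "immediate_extension \<Gamma> ?R (range psi) w (range psi') w'"
    unfolding immediate_extension_def
  proof (intro conjI ext)
    show "value_group ?R (range psi') w' = value_group ?R (range psi) w"
      unfolding w_def w'_def by (simp only: A.value_group_range B.value_group_range fval_image)
    let ?M = "valuation_ideal \<Gamma> ?R (range psi') w'"
    have "\<exists>b\<in>valuation_ring \<Gamma> ?R (range psi) w. ?M +>\<^bsub>?R\<^esub> a = ?M +>\<^bsub>?R\<^esub> b"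
      if a: "a \<in> valuation_ring \<Gamma> ?R (range psi') w'" for a
    proof -
      have coset: "?M +>\<^bsub>?R\<^esub> a = ?M +>\<^bsub>?R\<^esub> b" if "a - b \<in> ?M" for b
      proof -
        have M: "s + t \<in> ?M" "- s \<in> ?M" if "s \<in> ?M" "t \<in> ?M" for s t
          using V.M_add[of s t] V.M_neg[of s] that by (simp_all add: type_algebra_simps type_algebra_minus)
        have "s + a \<in> (\<lambda>s. s + b) ` ?M" if "s \<in> ?M" for s
          using M(1)[OF that \<open>a - b \<in> ?M\<close>] by (intro image_eqI[of _ _ "s + (a - b)"]) simp_all
        moreover have "s + b \<in> (\<lambda>s. s + a) ` ?M" if "s \<in> ?M" for s
          using M(1)[OF that M(2)[OF \<open>a - b \<in> ?M\<close> that]]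
          by (intro image_eqI[of _ _ "s + - (a - b)"]) simp_all
        ultimately show ?thesis unfolding a_r_coset_type_algebra by blast
      qed
      obtain q where q: "a = psi' q" "q = 0 \<or> 0 \<le> fval (Suc i) q" using a unfolding ring_B by blast
      show ?thesis
      \<comment> \<open>A unit is represented by its residue constant, which lies in the lower field
        because \<open>alpha\<close> fixes constants; everything else in the valuation ring has
        residue 0.\<close>
      proof (cases "q \<noteq> 0 \<and> fval (Suc i) q = 0")
        case True
        then obtain c where c: "c \<noteq> 0"
          "q - const_ratfun2 c = 0 \<or> 0 < fval (Suc i) (q - const_ratfun2 c)"
          using fval_residue by blast
        have "psi (const_ratfun2 c) = psi' (const_ratfun2 c)"
          using lift[of "const_ratfun2 c"] by (simp add: alpha_const)
        hence "a - psi (const_ratfun2 c) = psi' (q - const_ratfun2 c)"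
          by (simp add: q(1) morphism_diff[OF psi'])
        hence "a - psi (const_ratfun2 c) \<in> ?M" using c(2) unfolding ideal_B by blast
        moreover have "psi (const_ratfun2 c) \<in> valuation_ring \<Gamma> ?R (range psi) w"
          unfolding ring_A using fval_const[OF c(1), of i] by simp
        ultimately show ?thesis using coset by blast
      next
        case False
        hence "a \<in> ?M" unfolding ideal_B using q by auto
        moreover have "0 \<in> valuation_ring \<Gamma> ?R (range psi) w"
          unfolding ring_A using morphism_zero[OF psi] by force
        ultimately show ?thesis using coset[of 0] by auto
      qed
    qed
    moreover have "valuation_ring \<Gamma> ?R (range psi) w \<subseteq> valuation_ring \<Gamma> ?R (range psi') w'"
      unfolding OF[symmetric] by blast
    ultimately show "carrier (residue_field \<Gamma> ?R (range psi') w') =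
        residue_image \<Gamma> ?R (range psi) w (range psi') w'"
      unfolding residue_field_carrier residue_image_def by blast
  qed
  have "\<exists>!V. V \<in> valuation_extensions \<Gamma> ?R (range psi) w (range psi')"
  proof (rule ex1I)
    let ?O = "valuation_ring \<Gamma> ?R (range psi') w'"
    have "a \<in> ?O \<or> inv\<^bsub>?R\<^esub> a \<in> ?O" if a: "a \<in> range psi'" "a \<noteq> 0" for a
    proof -
      obtain q where q: "a = psi' q" using a by blast
      hence "q \<noteq> 0" using a by (auto simp: morphism_zero[OF psi'])
      hence "fval (Suc i) (inverse q) = - fval (Suc i) q" by (rule fval_inverse)
      moreover have "inv\<^bsub>?R\<^esub> a = psi' (inverse q)"
        using a(2) by (simp add: type_algebra_inv q field_morphism_inverse[OF psi'])
      ultimately show ?thesis unfolding ring_B q by (cases "0 \<le> fval (Suc i) q") auto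
    qed
    thus "?O \<in> valuation_extensions \<Gamma> ?R (range psi) w (range psi')"
      unfolding valuation_extensions_def type_algebra_simps
      using V.valuation_ring_subring V.O_subset_L OF by blast
    fix W assume "W \<in> valuation_extensions \<Gamma> ?R (range psi) w (range psi')"
    hence W: "subring W ?R" "W \<subseteq> range psi'" "\<And>a. a \<in> range psi' \<Longrightarrow> a \<noteq> 0 \<Longrightarrow> a \<in> W \<or> inv\<^bsub>?R\<^esub> a \<in> W"
        "W \<inter> range psi = ?O \<inter> range psi"
      unfolding valuation_extensions_def type_algebra_simps OF by auto
    \<comment> \<open>A competing ring \<open>W\<close> is pulled back to \<open>K(x,y)\<close>,
      where \<open>sigma\<close> acts and preserves \<open>fval (Suc i)\<close>.\<close>
    have "psi' -` W = {q. q = 0 \<or> 0 \<le> fval (Suc i) q}"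
    proof (rule T.unique_valuation_ring)
      show "a \<in> psi' -` W \<or> inverse a \<in> psi' -` W" if "a \<noteq> 0" for a
        using W(3)[of "psi' a"] that
        by (simp add: field_morphism_eq_0_iff[OF psi'] type_algebra_inv field_morphism_inverse[OF psi'])
      have fixed: "psi' -` (S \<inter> range psi) \<inter> {q. sigma q = q} = psi' -` S \<inter> {q. sigma q = q}" for S
        unfolding F by blast
      have "psi' -` W \<inter> {q. sigma q = q} = psi' -` ?O \<inter> {q. sigma q = q}"
        using fixed[of W] fixed[of ?O] by (simp only: W(4))
      also have "psi' -` ?O = {q. q = 0 \<or> 0 \<le> fval (Suc i) q}"
        unfolding ring_B by (rule inj_vimage_image_eq[OF field_morphism_inj[OF psi']])
      finally show "psi' -` W \<inter> {q. sigma q = q} = {q. q = 0 \<or> 0 \<le> fval (Suc i) q} \<inter> {q. sigma q = q}" .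
    qed (use W(1) in \<open>auto simp: type_algebra_subring fval_mult fval_add fval_sigma morphism_simps[OF psi']\<close>)
    hence "psi' ` (psi' -` W) = ?O" by (simp only: ring_B)
    thus "W = ?O" using W(2) by (auto simp: image_vimage_eq)
  qed
  thus "has_defect \<Gamma> ?R (range psi) w (range psi') w' p"
    using has_defect_degree_iff_unique_extension[OF field_from_type_algebra imm gal dim] by blast
qed

end

theorem theorem1p2:
  fixes p :: nat
  assumes "CHAR('k :: alg_closed_field) = p" and "p > 0"
  shows "\<exists>(\<Gamma> :: 'k ratfun2 set ordered_group) v.
           valuation_on \<Gamma> ring_of_type_algebra (UNIV :: 'k ratfun2 set) v \<and>
           (\<forall>c :: 'k. c \<noteq> 0 \<longrightarrow> v (const_ratfun2 c) = \<one>\<^bsub>\<Gamma>\<^esub>) \<and>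
           (\<exists>(F :: nat \<Rightarrow> 'k ratfun2 alg_closure set) w.
              F 0 = range to_ac \<and>
              (\<forall>a. a \<noteq> 0 \<longrightarrow> w 0 (to_ac a) = v a) \<and>
              (\<forall>i. F i \<subset> F (Suc i) \<and>
                   immediate_extension \<Gamma> ring_of_type_algebra (F i) (w i) (F (Suc i)) (w (Suc i)) \<and>
                   galois_extension ring_of_type_algebra (F i) (F (Suc i)) \<and>
                   ring.dimension ring_of_type_algebra p (F i) (F (Suc i)) \<and>
                   has_defect \<Gamma> ring_of_type_algebra (F i) (w i) (F (Suc i)) (w (Suc i)) p))"
proof -
  interpret char_p p "TYPE('k)" by unfold_locales (fact assms)+
  let ?\<Gamma> = "coded_group (value_code :: rat \<Rightarrow> 'k ratfun2 set)"
  have to_ac: "ring_morphism (to_ac :: 'k ratfun2 \<Rightarrow> 'k ratfun2 alg_closure)"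
    by (rule ring_morphismI) simp_all
  \<comment> \<open>Dependent choice, since each embedding extends its predecessor along
    \<open>alpha\<close>; the clause for index 0 anchors the tower at \<open>to_ac\<close>.\<close>
  have "\<exists>psi :: nat \<Rightarrow> 'k ratfun2 \<Rightarrow> 'k ratfun2 alg_closure.
      \<forall>i. (ring_morphism (psi i) \<and> (i = 0 \<longrightarrow> psi i = to_ac)) \<and> (\<forall>q. psi (Suc i) (alpha q) = psi i q)"
  proof (rule dependent_nat_choice)
    show "\<exists>psi :: 'k ratfun2 \<Rightarrow> 'k ratfun2 alg_closure. ring_morphism psi \<and> (0 = (0 :: nat) \<longrightarrow> psi = to_ac)"
      using to_ac by blast
    show "\<exists>psi'. (ring_morphism psi' \<and> (Suc n = 0 \<longrightarrow> psi' = to_ac)) \<and> (\<forall>q. psi' (alpha q) = psi q)"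
      if "ring_morphism psi \<and> (n = 0 \<longrightarrow> psi = to_ac)" for psi :: "'k ratfun2 \<Rightarrow> 'k ratfun2 alg_closure" and n
      using ex_alpha_lift[of psi] that by auto
  qed
  then obtain psi :: "nat \<Rightarrow> 'k ratfun2 \<Rightarrow> 'k ratfun2 alg_closure"
    where psi: "\<And>i. ring_morphism (psi i)" "psi 0 = to_ac" "\<And>i q. psi (Suc i) (alpha q) = psi i q"
    by blast
  define w where "w = (\<lambda>i. coded_valuation.w (value_code :: rat \<Rightarrow> 'k ratfun2 set) (fval i) (psi i))"
  \<comment> \<open>\<open>A\<close> is the valuation on \<open>K(x,y)\<close> itself and
    \<open>B\<close> its copy in the closure. Using one code for both makes them agree along
    \<open>to_ac\<close>.\<close>
  interpret A: coded_valuation "value_code :: rat \<Rightarrow> 'k ratfun2 set" "fval 0" "\<lambda>q. q"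
    by unfold_locales (simp_all add: inj_value_code fval_mult fval_add ring_morphism_ident)
  interpret B: coded_valuation "value_code :: rat \<Rightarrow> 'k ratfun2 set" "fval 0" "psi 0"
    by unfold_locales (simp_all add: inj_value_code fval_mult fval_add psi(1))
  have val: "valuation_on ?\<Gamma> ring_of_type_algebra UNIV A.w"
    using A.valuation_on_image[OF A.subfield_range] by simp
  have const: "A.w (const_ratfun2 c) = \<one>\<^bsub>?\<Gamma>\<^esub>" if "c \<noteq> 0" for c
    using that by (simp add: A.w_image A.coded_group_simps fval_const)
  have base: "w 0 (to_ac a) = A.w a" for a
    using B.w_image[of a] by (simp add: w_def A.w_image psi(2))
  show ?thesis
  proof (intro exI[of _ ?\<Gamma>] exI[of _ A.w] exI[of _ "\<lambda>i. range (psi i)"] exI[of _ w] conjI allI impI)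
    fix i
    show "range (psi i) \<subset> range (psi (Suc i))" by (rule tower_step(1)[OF psi(1) psi(1) psi(3)])
    show "galois_extension ring_of_type_algebra (range (psi i)) (range (psi (Suc i)))"
      by (rule tower_step(3)[OF psi(1) psi(1) psi(3)])
    show "ring.dimension ring_of_type_algebra p (range (psi i)) (range (psi (Suc i)))"
      by (rule tower_step(4)[OF psi(1) psi(1) psi(3)])
    show "immediate_extension ?\<Gamma> ring_of_type_algebra (range (psi i)) (w i) (range (psi (Suc i))) (w (Suc i))"
      unfolding w_def by (rule tower_step(2)[OF psi(1) psi(1) psi(3)])
    show "has_defect ?\<Gamma> ring_of_type_algebra (range (psi i)) (w i) (range (psi (Suc i))) (w (Suc i)) p"
      unfolding w_def by (rule tower_step(5)[OF psi(1) psi(1) psi(3)])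
  qed (simp_all add: val const base psi(2))
qed

end
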